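(* Let $\mathcal{S}$ be a finite skew translation generalized quadrangle of order $s$ (i.e. of order $(s,s)$) with $s$ even. Then $\mathcal{S}$ is a translation generalized quadrangle.
   Context: A generalized quadrangle of order $(s,t)$ is a finite point-line incidence structure in which each line has $s+1$ points, each point lies on $t+1$ lines, and for each non-incident point-line pair $(P,\ell)$ there is a unique point on $\ell$ collinear with $P$; it has order $s$ if $s=t$. An elation about a point $P$ is an automorphism that is either the identity or fixes every line through $P$ and fixes no point not collinear with $P$; a symmetry about $P$ is an elation about $P$ that also fixes every point collinear with $P$. $\mathcal{S}$ is an elation generalized quadrangle with base point $P$ and elation group $G$ if $G$ is a group of automorphisms consisting of elations about $P$ acting regularly on the points not collinear with $P$. It is a skew translation generalized quadrangle if moreover $G$ contains a subgroup consisting of $t$ symmetries about $P$. It is a translation generalized quadrangle if it is an elation generalized quadrangle with an abelian elation group. *)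

theory Defs
  imports Main
begin

text \<open>A finite point-line incidence structure: points are the elements of a finite
type 'p, lines the elements of a finite type 'l, incidence is I.
An automorphism is a pair (point map, line map).\<close>

definition collinear :: "('p \<Rightarrow> 'l \<Rightarrow> bool) \<Rightarrow> 'p \<Rightarrow> 'p \<Rightarrow> bool" where
  "collinear I x y \<longleftrightarrow> (\<exists>l. I x l \<and> I y l)"

definition gq_order :: "('p \<Rightarrow> 'l \<Rightarrow> bool) \<Rightarrow> nat \<Rightarrow> nat \<Rightarrow> bool" where
  "gq_order I s t \<longleftrightarrow>
     (\<forall>l. card {x. I x l} = s + 1) \<and>
     (\<forall>x. card {l. I x l} = t + 1) \<and>
     (\<forall>x y l m. x \<noteq> y \<and> I x l \<and> I y l \<and> I x m \<and> I y m \<longrightarrow> l = m) \<and>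
     (\<forall>x l. \<not> I x l \<longrightarrow> (\<exists>!y. I y l \<and> collinear I x y))"

definition is_aut :: "('p \<Rightarrow> 'l \<Rightarrow> bool) \<Rightarrow> ('p \<Rightarrow> 'p) \<times> ('l \<Rightarrow> 'l) \<Rightarrow> bool" where
  "is_aut I a \<longleftrightarrow> bij (fst a) \<and> bij (snd a) \<and>
     (\<forall>x l. I (fst a x) (snd a l) \<longleftrightarrow> I x l)"

definition aut_comp :: "('p \<Rightarrow> 'p) \<times> ('l \<Rightarrow> 'l) \<Rightarrow> ('p \<Rightarrow> 'p) \<times> ('l \<Rightarrow> 'l) \<Rightarrow> ('p \<Rightarrow> 'p) \<times> ('l \<Rightarrow> 'l)" where
  "aut_comp a b = (fst a \<circ> fst b, snd a \<circ> snd b)"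

definition aut_inv :: "('p \<Rightarrow> 'p) \<times> ('l \<Rightarrow> 'l) \<Rightarrow> ('p \<Rightarrow> 'p) \<times> ('l \<Rightarrow> 'l)" where
  "aut_inv a = (inv (fst a), inv (snd a))"

definition perm_group :: "(('p \<Rightarrow> 'p) \<times> ('l \<Rightarrow> 'l)) set \<Rightarrow> bool" where
  "perm_group H \<longleftrightarrow> (id, id) \<in> H \<and>
     (\<forall>a\<in>H. \<forall>b\<in>H. aut_comp a b \<in> H) \<and> (\<forall>a\<in>H. aut_inv a \<in> H)"

definition aut_group :: "('p \<Rightarrow> 'l \<Rightarrow> bool) \<Rightarrow> (('p \<Rightarrow> 'p) \<times> ('l \<Rightarrow> 'l)) set \<Rightarrow> bool" where
  "aut_group I G \<longleftrightarrow> (\<forall>a\<in>G. is_aut I a) \<and> perm_group G"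

definition is_elation :: "('p \<Rightarrow> 'l \<Rightarrow> bool) \<Rightarrow> 'p \<Rightarrow> ('p \<Rightarrow> 'p) \<times> ('l \<Rightarrow> 'l) \<Rightarrow> bool" where
  "is_elation I P a \<longleftrightarrow> is_aut I a \<and>
     (a = (id, id) \<or>
      ((\<forall>l. I P l \<longrightarrow> snd a l = l) \<and> (\<forall>x. \<not> collinear I P x \<longrightarrow> fst a x \<noteq> x)))"

definition is_symmetry :: "('p \<Rightarrow> 'l \<Rightarrow> bool) \<Rightarrow> 'p \<Rightarrow> ('p \<Rightarrow> 'p) \<times> ('l \<Rightarrow> 'l) \<Rightarrow> bool" where
  "is_symmetry I P a \<longleftrightarrow> is_elation I P a \<and> (\<forall>x. collinear I P x \<longrightarrow> fst a x = x)"

definition is_egq :: "('p \<Rightarrow> 'l \<Rightarrow> bool) \<Rightarrow> nat \<Rightarrow> nat \<Rightarrow> 'p \<Rightarrow> (('p \<Rightarrow> 'p) \<times> ('l \<Rightarrow> 'l)) set \<Rightarrow> bool" where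
  "is_egq I s t P G \<longleftrightarrow> gq_order I s t \<and> aut_group I G \<and> (\<forall>a\<in>G. is_elation I P a) \<and>
     (\<forall>x y. \<not> collinear I P x \<and> \<not> collinear I P y \<longrightarrow> (\<exists>!a. a \<in> G \<and> fst a x = y))"

definition is_stgq :: "('p \<Rightarrow> 'l \<Rightarrow> bool) \<Rightarrow> nat \<Rightarrow> nat \<Rightarrow> 'p \<Rightarrow> (('p \<Rightarrow> 'p) \<times> ('l \<Rightarrow> 'l)) set \<Rightarrow> bool" where
  "is_stgq I s t P G \<longleftrightarrow> is_egq I s t P G \<and>
     (\<exists>H. H \<subseteq> G \<and> perm_group H \<and> card H = t \<and> (\<forall>a\<in>H. is_symmetry I P a))"

definition skew_translation_gq :: "('p \<Rightarrow> 'l \<Rightarrow> bool) \<Rightarrow> nat \<Rightarrow> nat \<Rightarrow> bool" where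
  "skew_translation_gq I s t \<longleftrightarrow> (\<exists>P G. is_stgq I s t P G)"

definition translation_gq :: "('p \<Rightarrow> 'l \<Rightarrow> bool) \<Rightarrow> nat \<Rightarrow> nat \<Rightarrow> bool" where
  "translation_gq I s t \<longleftrightarrow>
     (\<exists>P G. is_egq I s t P G \<and> (\<forall>a\<in>G. \<forall>b\<in>G. aut_comp a b = aut_comp b a))"

end

theory Submission
  imports Defs Complex_Main
begin

text \<open>
  Fix a point \<open>Q\<close> opposite the base point \<open>P\<close>. The stabilizers \<open>A\<^sub>i\<close> of the \<open>q + 1\<close> lines through \<open>Q\<close> and the
  group \<open>U\<close> of symmetries, all of order \<open>q\<close>, form a Kantor family of \<open>G\<close>, where \<open>|G| = q\<^sup>3\<close>. The union \<open>D\<close> of the \<open>A\<^sub>i\<close>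
  is a transversal of \<open>U\<close>, and every element outside \<open>A\<^sub>i + U\<close> is uniquely of the form \<open>a + b\<close> with \<open>a \<in> A\<^sub>i\<close> and
  \<open>b \<in> D\<close>. The subgroups \<open>(A\<^sub>i + U) / U\<close> partition \<open>G / U\<close>, whence \<open>G / U\<close> is elementary abelian and \<open>D\<close>
  consists of involutions.

  Suppose that \<open>G\<close> is not abelian, and let \<open>N \<subseteq> U\<close> be a maximal normal subgroup with \<open>G / N\<close> not abelian. The
  commutators of \<open>G / N\<close> lie in a central subgroup of order 2, so commutators and squares define a bilinear form
  \<open>\<beta>\<close> and a quadratic form on \<open>G\<close>. An element centralizing \<open>A\<^sub>i\<close> and lying outside \<open>A\<^sub>i + U\<close> is a sum of commuting
  involutions, hence an involution.

  If \<open>U\<close> is not central modulo \<open>N\<close>, it follows that the centre of \<open>G / N\<close> has exponent 2, and then the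
  exponential sum of the quadratic form over \<open>G\<close>, evaluated along the cosets of \<open>U\<close> with the difference set
  property of \<open>D\<close>, is at the same time too large and too small. If \<open>U\<close> is central modulo \<open>N\<close>, then \<open>U / N\<close> is
  cyclic of order 4 and \<open>A\<^sub>i + U\<close> is the centralizer of \<open>A\<^sub>i\<close>. For fixed \<open>i \<noteq> j\<close>, each of the \<open>q - 1\<close> other
  indices \<open>k\<close> gives a Gauss sum over the triples in \<open>A\<^sub>i \<times> A\<^sub>k \<times> A\<^sub>j\<close> with sum in \<open>U\<close>. These Gaussian integers have norm \<open>q\<close>
  and add up to 0, which is impossible because their number is odd.
\<close>

section \<open>Subgroups of additively written, not necessarily commutative groups\<close>

text \<open>Flattens a term to a right-nested sum of letters and negated letters. It is used with
  \<open>add_uminus_conv_diff\<close> deleted, which would fold negated letters back into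
  differences; the cancellation simp rules then prove the group word identities below.\<close>

lemmas word_normalize = add.assoc minus_add diff_conv_add_uminus

definition subgrp :: "'a::group_add set \<Rightarrow> bool" where
  "subgrp H \<longleftrightarrow> 0 \<in> H \<and> (\<forall>x\<in>H. \<forall>y\<in>H. x + y \<in> H) \<and> (\<forall>x\<in>H. - x \<in> H)"

definition normal_in :: "'a::group_add set \<Rightarrow> 'a set \<Rightarrow> bool" where
  "normal_in N G \<longleftrightarrow> subgrp N \<and> N \<subseteq> G \<and> (\<forall>g\<in>G. \<forall>n\<in>N. g + n - g \<in> N)"

definition comm :: "'a::group_add \<Rightarrow> 'a \<Rightarrow> 'a" where
  "comm x y = x + y - x - y"

lemma subgrp_zero: "subgrp H \<Longrightarrow> 0 \<in> H"
  and subgrp_add: "subgrp H \<Longrightarrow> x \<in> H \<Longrightarrow> y \<in> H \<Longrightarrow> x + y \<in> H"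
  and subgrp_minus: "subgrp H \<Longrightarrow> x \<in> H \<Longrightarrow> - x \<in> H"
  by (auto simp: subgrp_def)

lemma subgrp_diff: "subgrp H \<Longrightarrow> x \<in> H \<Longrightarrow> y \<in> H \<Longrightarrow> x - y \<in> H"
  by (metis diff_conv_add_uminus subgrp_add subgrp_minus)

lemmas subgrp_closed = subgrp_zero subgrp_add subgrp_minus subgrp_diff

lemma subgrp_add_right_iff: "subgrp H \<Longrightarrow> y \<in> H \<Longrightarrow> x + y \<in> H \<longleftrightarrow> x \<in> H"
  by (metis add_diff_cancel subgrp_add subgrp_diff)

lemma subgrp_add_left_iff: "subgrp H \<Longrightarrow> x \<in> H \<Longrightarrow> x + y \<in> H \<longleftrightarrow> y \<in> H"
  by (metis minus_add_cancel subgrp_add subgrp_minus)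

lemma subgrp_minus_iff: "subgrp H \<Longrightarrow> - x \<in> H \<longleftrightarrow> x \<in> H"
  by (metis minus_minus subgrp_minus)

lemma normal_in_subgrp: "normal_in N G \<Longrightarrow> subgrp N"
  and normal_in_conj: "normal_in N G \<Longrightarrow> g \<in> G \<Longrightarrow> n \<in> N \<Longrightarrow> g + n - g \<in> N"
  by (auto simp: normal_in_def)

lemma normal_in_conj': "normal_in N G \<Longrightarrow> subgrp G \<Longrightarrow> g \<in> G \<Longrightarrow> n \<in> N \<Longrightarrow> - g + n + g \<in> N"
  using normal_in_conj[of N G "- g" n] by (auto simp: subgrp_minus)

lemma normal_in_conj_iff:
  assumes "normal_in N G" "subgrp G" "g \<in> G"
  shows "g + n - g \<in> N \<longleftrightarrow> n \<in> N"
proof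
  assume "g + n - g \<in> N"
  from normal_in_conj'[OF assms this] show "n \<in> N"
    by (simp add: word_normalize del: add_uminus_conv_diff)
qed (rule normal_in_conj[OF assms(1,3)])

lemma normal_in_swap:
  assumes "normal_in N G" "subgrp G" "x \<in> G" "y \<in> G" "x + y \<in> N"
  shows "y + x \<in> N"
  using normal_in_conj'[OF assms(1,2,3,5)] by (simp add: word_normalize del: add_uminus_conv_diff)

lemma comm_add_right: "comm g (x + y) = comm g x + (x + comm g y - x)"
  and comm_add_left: "comm (x + y) g = (x + comm y g - x) + comm x g"
  and comm_minus_right: "comm g (- x) = - x + - comm g x + x"
  and minus_comm: "- comm x y = comm y x"
  by (simp_all add: comm_def word_normalize del: add_uminus_conv_diff)

text \<open>This is the preimage of the centralizer of the image of \<open>g\<close> in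
  \<open>G / N\<close>. Factor groups are not formed as types: statements about \<open>G / N\<close>
  are phrased as membership in \<open>N\<close> or as equality of cosets.\<close>

lemma centralizer_mod_subgrp:
  assumes G: "subgrp G" and N: "normal_in N G" and g: "g \<in> G"
  shows "subgrp {x \<in> G. comm g x \<in> N}"
proof -
  have sN: "subgrp N" using N by (rule normal_in_subgrp)
  have "comm g (x + y) \<in> N" if "x \<in> G" "comm g x \<in> N" "comm g y \<in> N" for x y
    unfolding comm_add_right using that by (intro subgrp_add[OF sN] normal_in_conj[OF N])
  moreover have "comm g (- x) \<in> N" if "x \<in> G" "comm g x \<in> N" for x
    unfolding comm_minus_right using that by (intro normal_in_conj'[OF N G] subgrp_minus[OF sN])
  moreover have "comm g 0 \<in> N" using sN by (simp add: comm_def subgrp_zero)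
  ultimately show ?thesis using G by (auto simp: subgrp_def)
qed

lemma subgrp_Inter: "(\<And>H. H \<in> C \<Longrightarrow> subgrp H) \<Longrightarrow> subgrp (\<Inter>C)"
  by (auto simp: subgrp_def)

section \<open>Counting cosets and orbits\<close>

lemma card_fibres:
  assumes "finite G" "\<And>g. g \<in> G \<Longrightarrow> card {h \<in> G. f h = f g} = k"
  shows "card (f ` G) * k = card G"
proof -
  have "card G = (\<Sum>x\<in>G. 1)" by simp
  also have "\<dots> = (\<Sum>y\<in>f ` G. \<Sum>x\<in>{x \<in> G. f x = y}. 1)"
    by (rule sum.group[symmetric]) (use assms in auto)
  also have "\<dots> = (\<Sum>y\<in>f ` G. k)"
    by (rule sum.cong) (use assms(2) in auto)
  finally show ?thesis by simp
qed

text \<open>Orbit-stabilizer counting without an explicit action: the fibres of \<open>f\<close> are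
  the left translates of \<open>S\<close>. It serves both for cosets and for conjugacy orbits on
  cosets.\<close>

lemma card_image_stabilizer:
  fixes G :: "'a::group_add set"
  assumes "finite G" "subgrp G" "S \<subseteq> G"
    and eq: "\<And>g h. g \<in> G \<Longrightarrow> h \<in> G \<Longrightarrow> f h = f g \<longleftrightarrow> - g + h \<in> S"
  shows "card (f ` G) * card S = card G"
proof (rule card_fibres[OF assms(1)])
  fix g assume g: "g \<in> G"
  have "{h \<in> G. f h = f g} = (+) g ` S"
  proof (intro set_eqI iffI)
    fix h assume h: "h \<in> {h \<in> G. f h = f g}"
    then have "- g + h \<in> S" using eq g by auto
    then show "h \<in> (+) g ` S" by (intro image_eqI[where x = "- g + h"]) auto
  next
    fix h assume "h \<in> (+) g ` S"
    then obtain s where s: "s \<in> S" "h = g + s" by auto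
    then have "h \<in> G" using g assms by (auto intro: subgrp_add)
    then show "h \<in> {h \<in> G. f h = f g}" using s eq[OF g, of h] by auto
  qed
  then show "card {h \<in> G. f h = f g} = card S"
    by (simp add: card_image inj_on_def)
qed

lemma lcoset_eq_iff:
  assumes "subgrp (S :: 'a::group_add set)"
  shows "(+) h ` S = (+) g ` S \<longleftrightarrow> - g + h \<in> S"
proof
  assume "(+) h ` S = (+) g ` S"
  moreover have "h \<in> (+) h ` S" using assms by (auto simp: image_iff subgrp_zero intro!: bexI[of _ 0])
  ultimately obtain s where "s \<in> S" "h = g + s" by auto
  then show "- g + h \<in> S" by simp
next
  assume *: "- g + h \<in> S"
  have "x \<in> (+) h ` S \<longleftrightarrow> x \<in> (+) g ` S" for x
  proof -
    have "x \<in> (+) h ` S \<longleftrightarrow> - h + x \<in> S"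
      by (metis (no_types, lifting) add_minus_cancel image_iff minus_add_cancel)
    also have "\<dots> \<longleftrightarrow> - g + x \<in> S"
    proof -
      have "- g + x = (- g + h) + (- h + x)" by (simp add: word_normalize del: add_uminus_conv_diff)
      then show ?thesis using subgrp_add_left_iff[OF assms *] by metis
    qed
    also have "\<dots> \<longleftrightarrow> x \<in> (+) g ` S"
      by (metis (no_types, lifting) add_minus_cancel image_iff minus_add_cancel)
    finally show ?thesis .
  qed
  then show "(+) h ` S = (+) g ` S" by blast
qed

lemma card_cosets:
  fixes G :: "'a::group_add set"
  assumes "finite G" "subgrp G" "subgrp S" "S \<subseteq> G"
  shows "card ((\<lambda>g. (+) g ` S) ` G) * card S = card G"
  by (rule card_image_stabilizer) (use assms lcoset_eq_iff[OF assms(3)] in auto)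

lemma in_lcoset_iff: "x \<in> (+) (g::'a::group_add) ` S \<longleftrightarrow> - g + x \<in> S"
  by (metis (no_types, lifting) add_minus_cancel image_iff minus_add_cancel)

section \<open>Cauchy's theorem and the class equation at the prime 2\<close>

lemma even_dvd_power2: "k dvd (2::nat) ^ n \<Longrightarrow> k \<noteq> 1 \<Longrightarrow> even k"
proof (rule ccontr)
  assume *: "k dvd 2 ^ n" "k \<noteq> 1" "odd k"
  then have "coprime k (2 ^ n)" by simp
  then have "k dvd 1" using *(1) by (metis coprime_common_divisor dvd_refl)
  then show False using *(2) by simp
qed

text \<open>Cauchy's theorem for the prime 2 in \<open>H / N\<close>: without an involution the
  nontrivial cosets fall into pairs of mutually inverse ones, which makes the index odd.\<close>

lemma exists_square_in_normal:
  fixes H :: "'a::group_add set"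
  assumes fin: "finite H" and H: "subgrp H" and N: "normal_in N H"
    and ev: "even (card ((\<lambda>g. (+) g ` N) ` H))"
  shows "\<exists>x\<in>H. x \<notin> N \<and> x + x \<in> N"
proof (rule ccontr)
  assume "\<not> ?thesis"
  then have no: "x \<in> H \<Longrightarrow> x + x \<in> N \<Longrightarrow> x \<in> N" for x by blast
  have sN: "subgrp N" using N by (rule normal_in_subgrp)
  let ?c = "\<lambda>g. (+) g ` N"
  let ?X = "?c ` H - {N}"
  let ?C = "(\<lambda>x. {?c x, ?c (- x)}) ` (H - N)"
  have c0: "?c x = N \<longleftrightarrow> x \<in> N" if "x \<in> H" for x
    using lcoset_eq_iff[OF sN, of x 0] by simp
  have neg: "?c (- x) = ?c (- y)" if "?c x = ?c y" "x \<in> H" "y \<in> H" for x y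
  proof -
    have "- y + x \<in> N" using that lcoset_eq_iff[OF sN, of x y] by simp
    then have "x - y \<in> N"
      using normal_in_swap[OF N H, of "- y" x] that H by (simp add: subgrp_minus)
    then have "- (- y) + - x \<in> N" using subgrp_minus[OF sN, of "x - y"] by simp
    then show ?thesis using lcoset_eq_iff[OF sN, of "- x" "- y"] by simp
  qed
  have union: "\<Union>?C = ?X"
  proof (intro set_eqI iffI)
    fix z assume "z \<in> \<Union>?C"
    then obtain x where x: "x \<in> H" "x \<notin> N" "z = ?c x \<or> z = ?c (- x)" by auto
    then have "- x \<in> H" "- x \<notin> N" using H sN by (auto simp: subgrp_minus_iff)
    then show "z \<in> ?X" using c0[of x] c0[of "- x"] x by auto
  next
    fix z assume "z \<in> ?X"
    then obtain x where x: "x \<in> H" "z = ?c x" "z \<noteq> N" by auto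
    then have "x \<notin> N" using c0 by auto
    then show "z \<in> \<Union>?C" using x by blast
  qed
  have "2 dvd card (\<Union>?C)"
  proof (rule dvd_partition)
    show "finite (\<Union>?C)" using fin by auto
    show "\<forall>c\<in>?C. 2 dvd card c"
    proof
      fix c assume "c \<in> ?C"
      then obtain x where x: "x \<in> H" "x \<notin> N" "c = {?c x, ?c (- x)}" by auto
      have "?c x \<noteq> ?c (- x)"
      proof
        assume "?c x = ?c (- x)"
        then have "x + x \<in> N" using lcoset_eq_iff[OF sN, of x "- x"] by simp
        then show False using no x by blast
      qed
      then show "2 dvd card c" using x(3) by simp
    qed
    show "\<forall>c1\<in>?C. \<forall>c2\<in>?C. c1 \<noteq> c2 \<longrightarrow> c1 \<inter> c2 = {}"
    proof (intro ballI impI)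
      fix c1 c2 assume "c1 \<in> ?C" "c2 \<in> ?C" and ne: "c1 \<noteq> c2"
      then obtain x y where xy: "x \<in> H" "c1 = {?c x, ?c (- x)}" "y \<in> H" "c2 = {?c y, ?c (- y)}"
        by auto
      have mx: "- x \<in> H" "- y \<in> H" using xy H by (auto intro: subgrp_minus)
      have same: "{?c z, ?c (- z)} = {?c w, ?c (- w)}" if "?c z = ?c w" "z \<in> H" "w \<in> H" for z w
        using that(1) neg[OF that] by (rule arg_cong2[where f = "\<lambda>a b. {a, b}"])
      have sw: "{?c z, ?c (- z)} = {?c (- z), ?c (- (- z))}" for z
        unfolding minus_minus by (rule insert_commute)
      have "{?c x, ?c (- x)} \<noteq> {?c y, ?c (- y)}" using ne xy(2,4) by metis
      then have "?c x \<noteq> ?c y" "?c x \<noteq> ?c (- y)" "?c (- x) \<noteq> ?c y" "?c (- x) \<noteq> ?c (- y)"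
        using same[of x y] same[of x "- y"] same[of "- x" y] same[of "- x" "- y"] mx xy(1,3)
          sw[of x] sw[of y] by metis+
      then show "c1 \<inter> c2 = {}" unfolding xy(2,4) by blast
    qed
  qed
  then have "even (card ?X)" using union by simp
  moreover have "N \<in> ?c ` H" using c0[of 0] H sN by (metis imageI subgrp_zero)
  then have "card (?c ` H) = Suc (card ?X)"
    using card_Suc_Diff1[of "?c ` H" N] fin by simp
  ultimately show False using ev by simp
qed

text \<open>A subgroup \<open>K\<close> maximal among those of 2-power order is everything, because
  a further element \<open>x\<close> commutes with \<open>K\<close> and adjoining it doubles the
  order.\<close>

lemma exponent_two_card:
  fixes H :: "'a::group_add set"
  assumes fin: "finite H" and H: "subgrp H" and two: "\<And>x. x \<in> H \<Longrightarrow> x + x = 0"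
  shows "\<exists>n. card H = 2 ^ n"
proof -
  let ?P = "\<lambda>K. subgrp K \<and> K \<subseteq> H \<and> (\<exists>n. card K = 2 ^ n)"
  have "?P {0}" using H by (auto simp: subgrp_def intro: exI[of _ 0])
  moreover have "finite {K. ?P K}" using fin by (auto intro: finite_subset[of _ "Pow H"])
  ultimately have "\<exists>K\<in>{K. ?P K}. \<forall>L\<in>{K. ?P K}. K \<subseteq> L \<longrightarrow> K = L"
    by (intro finite_has_maximal) auto
  then obtain K where K: "?P K" and mx: "\<forall>L\<in>{K. ?P K}. K \<subseteq> L \<longrightarrow> K = L" by auto
  have neg: "- x = x" if "x \<in> H" for x using minus_unique[OF two[OF that]] .
  have com: "x + y = y + x" if "x \<in> H" "y \<in> H" for x y
  proof -
    have "x + y = - (x + y)" using neg[OF subgrp_add[OF H that]] by simp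
    also have "\<dots> = y + x" using neg[OF that(1)] neg[OF that(2)] by (simp add: minus_add)
    finally show ?thesis .
  qed
  have "K = H"
  proof (rule ccontr)
    assume "K \<noteq> H"
    then obtain x where x: "x \<in> H" "x \<notin> K" using K by auto
    let ?L = "K \<union> (+) x ` K"
    have sK: "subgrp K" "K \<subseteq> H" using K by auto
    have "subgrp ?L"
    proof -
      have a: "k + (x + l) \<in> (+) x ` K" if "k \<in> K" "l \<in> K" for k l
      proof -
        have "k + (x + l) = x + (k + l)"
          using com[of k x] that x sK by (simp add: subset_iff flip: add.assoc)
        then show ?thesis using that sK by (auto intro: subgrp_add)
      qed
      have b: "(x + k) + (x + l) \<in> K" if "k \<in> K" "l \<in> K" for k l
      proof -
        have "(x + k) + (x + l) = x + x + (k + l)"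
          using com[of k x] that x sK by (simp add: subset_iff add.assoc) (simp add: subset_iff flip: add.assoc)
        then show ?thesis using that sK two[OF x(1)] by (auto intro: subgrp_add)
      qed
      have "- y \<in> ?L" if "y \<in> ?L" for y
      proof -
        have "y \<in> H" using that sK x H by (auto intro: subgrp_add)
        then show ?thesis using neg that by metis
      qed
      moreover have "y + z \<in> ?L" if "y \<in> ?L" "z \<in> ?L" for y z
        using that a b sK by (auto simp: add.assoc intro: subgrp_add)
      ultimately show ?thesis using sK by (simp add: subgrp_def)
    qed
    moreover have "?L \<subseteq> H" using sK x H by (auto intro: subgrp_add)
    moreover have "\<exists>n. card ?L = 2 ^ n"
    proof -
      have "K \<inter> (+) x ` K = {}"
        using x sK by (auto simp: subgrp_add_right_iff)
      then have "card ?L = card K + card K"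
        using fin sK by (subst card_Un_disjoint) (auto intro: finite_subset simp: card_image)
      moreover obtain n where "card K = 2 ^ n" using K by auto
      ultimately have "card ?L = 2 ^ Suc n" by simp
      then show ?thesis by blast
    qed
    ultimately have "?L \<in> {K. ?P K}" by simp
    then have "K = ?L" using mx by (meson Un_upper1)
    moreover have "x \<in> ?L" using sK by (auto simp: image_iff subgrp_zero intro!: bexI[of _ 0])
    ultimately show False using x by simp
  qed
  then show ?thesis using K by simp
qed

text \<open>A nontrivial normal subgroup \<open>U / N\<close> of the 2-group \<open>G / N\<close>
  contains a central involution: the class equation gives nontrivial central elements, and Cauchy's
  theorem gives an involution among them.\<close>

lemma exists_central_mod:
  fixes G :: "'a::group_add set"
  assumes fin: "finite G" and G: "subgrp G" and U: "normal_in U G" and N: "normal_in N G"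
    and NU: "N \<subset> U" and card: "card G = 2 ^ n"
  shows "\<exists>c\<in>U. c \<notin> N \<and> c + c \<in> N \<and> (\<forall>g\<in>G. comm g c \<in> N)"
proof -
  have sN: "subgrp N" and NG: "N \<subseteq> G" and sU: "subgrp U" and UG: "U \<subseteq> G"
    using U N by (auto simp: normal_in_def)
  have finU: "finite U" using fin UG finite_subset by blast
  let ?c = "\<lambda>g. (+) g ` N"
  define Z where "Z = {c \<in> U. \<forall>g\<in>G. comm g c \<in> N}"
  have even_index: "even (card (?c ` K))" if K: "subgrp K" "K \<subseteq> U" "N \<subset> K" for K
  proof -
    have eq: "card (?c ` K) * card N = card K"
      by (rule card_cosets) (use K finU sN in \<open>auto intro: finite_subset\<close>)
    have "card K dvd card G"
      using card_cosets[OF fin G K(1)] K UG by (metis dvd_triv_right subset_trans)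
    then have "card (?c ` K) dvd 2 ^ n" using eq card by (metis dvd_mult_left)
    moreover have "card (?c ` K) \<noteq> 1"
    proof
      assume "card (?c ` K) = 1"
      then have "card N = card K" using eq by simp
      then show False using K psubset_card_mono[of K N] finU by (auto dest: finite_subset)
    qed
    ultimately show ?thesis by (rule even_dvd_power2)
  qed
  \<comment> \<open>Two conjugates of \<open>x\<close> agree modulo \<open>N\<close> exactly if the
    conjugators differ by an element centralizing \<open>x\<close> modulo \<open>N\<close>. This is
    the stabilizer condition for the orbit count.\<close>
  have conj_eq: "?c (h + x - h) = ?c (g + x - g) \<longleftrightarrow> - g + h \<in> {k \<in> G. comm k x \<in> N}"
    if "x \<in> U" "g \<in> G" "h \<in> G" for x g h
  proof -
    have "- (g + x - g) + (h + x - h) = g + (- x + (- g + h) + x - (- g + h)) - g"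
      by (simp add: word_normalize del: add_uminus_conv_diff)
    then have "?c (h + x - h) = ?c (g + x - g)
        \<longleftrightarrow> g + (- x + (- g + h) + x - (- g + h)) - g \<in> N"
      using lcoset_eq_iff[OF sN] by metis
    also have "\<dots> \<longleftrightarrow> - x + (- g + h) + x - (- g + h) \<in> N"
      by (rule normal_in_conj_iff[OF N G that(2)])
    also have "\<dots> \<longleftrightarrow> comm (- g + h) x \<in> N"
    proof -
      have e: "comm (- g + h) x = x + (- x + (- g + h) + x - (- g + h)) - x"
        by (simp add: comm_def word_normalize del: add_uminus_conv_diff)
      have xG: "x \<in> G" using that UG by auto
      show ?thesis unfolding e by (rule normal_in_conj_iff[OF N G xG, symmetric])
    qed
    also have "\<dots> \<longleftrightarrow> - g + h \<in> {k \<in> G. comm k x \<in> N}" using that G by (auto intro: subgrp_closed)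
    finally show ?thesis .
  qed
  have Zsub: "subgrp Z"
  proof -
    have "Z = \<Inter>(insert U ((\<lambda>g. {x \<in> G. comm g x \<in> N}) ` G))"
      using UG by (auto simp: Z_def)
    moreover have "subgrp (\<Inter>(insert U ((\<lambda>g. {x \<in> G. comm g x \<in> N}) ` G)))"
      by (rule subgrp_Inter) (use sU centralizer_mod_subgrp[OF G N] in auto)
    ultimately show ?thesis by simp
  qed
  have NZ: "N \<subseteq> Z"
  proof
    fix x assume x: "x \<in> N"
    have "comm g x \<in> N" if "g \<in> G" for g
      using subgrp_diff[OF sN normal_in_conj[OF N that x] x] by (simp add: comm_def)
    then show "x \<in> Z" using x NU by (auto simp: Z_def)
  qed
  have "N \<noteq> Z"
  proof
    assume eq: "N = Z"
    \<comment> \<open>If only \<open>N\<close> were central, conjugation would have orbits of even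
      size on the nontrivial cosets in \<open>U\<close>, so the index of \<open>N\<close> in
      \<open>U\<close> would be odd.\<close>
    define orb where "orb x = (\<lambda>g. ?c (g + x - g)) ` G" for x
    let ?C = "orb ` (U - N)"
    have union: "\<Union>?C = ?c ` U - {N}"
    proof (intro set_eqI iffI)
      fix z assume "z \<in> \<Union>?C"
      then obtain x g where xg: "x \<in> U" "x \<notin> N" "g \<in> G" "z = ?c (g + x - g)" by (auto simp: orb_def)
      have "g + x - g \<in> U" using normal_in_conj[OF U] xg by auto
      moreover have "g + x - g \<notin> N"
        using normal_in_conj_iff[OF N G xg(3)] xg(2) by simp
      ultimately show "z \<in> ?c ` U - {N}"
        using xg(4) lcoset_eq_iff[OF sN, of "g + x - g" 0] by auto
    next
      fix z assume "z \<in> ?c ` U - {N}"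
      then obtain x where x: "x \<in> U" "z = ?c x" "z \<noteq> N" by auto
      then have "x \<notin> N" using lcoset_eq_iff[OF sN, of x 0] by auto
      moreover have "z \<in> orb x" using x G by (auto simp: orb_def image_iff subgrp_zero intro!: bexI[of _ 0])
      ultimately show "z \<in> \<Union>?C" using x by blast
    qed
    have "2 dvd card (\<Union>?C)"
    proof (rule dvd_partition)
      show "finite (\<Union>?C)" using union finU by simp
      show "\<forall>c\<in>?C. 2 dvd card c"
      proof
        fix c assume "c \<in> ?C"
        then obtain x where x: "x \<in> U" "x \<notin> N" "c = orb x" by auto
        have cc: "card (orb x) * card {k \<in> G. comm k x \<in> N} = card G"
          unfolding orb_def by (rule card_image_stabilizer[OF fin G]) (use conj_eq x(1) in auto)
        then have "card (orb x) dvd 2 ^ n" using card by (metis dvd_triv_left)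
        moreover have "card (orb x) \<noteq> 1"
        proof
          assume "card (orb x) = 1"
          then have "{k \<in> G. comm k x \<in> N} = G" using cc fin by (intro card_subset_eq) auto
          then have "x \<in> Z" using x by (auto simp: Z_def)
          then show False using eq x by simp
        qed
        ultimately show "2 dvd card c" using x(3) even_dvd_power2 by blast
      qed
      show "\<forall>c1\<in>?C. \<forall>c2\<in>?C. c1 \<noteq> c2 \<longrightarrow> c1 \<inter> c2 = {}"
      proof (intro ballI impI, rule ccontr)
        fix c1 c2 assume "c1 \<in> ?C" "c2 \<in> ?C" "c1 \<noteq> c2" "c1 \<inter> c2 \<noteq> {}"
        then obtain x y g h where xy: "x \<in> U" "y \<in> U" "g \<in> G" "h \<in> G" "c1 = orb x" "c2 = orb y"
          "?c (g + x - g) = ?c (h + y - h)" by (auto simp: orb_def)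
        have sub: "orb x' \<subseteq> orb y'" if "x' \<in> U" "y' \<in> U" "g' \<in> G" "h' \<in> G"
            "?c (g' + x' - g') = ?c (h' + y' - h')" for x' y' g' h'
        proof
          fix z assume "z \<in> orb x'"
          then obtain k where k: "k \<in> G" "z = ?c (k + x' - k)" by (auto simp: orb_def)
          have in1: "- (h' + y' - h') + (g' + x' - g') \<in> N"
            using that(5) lcoset_eq_iff[OF sN] by blast
          have kg: "k - g' \<in> G" using k that G by (auto intro: subgrp_closed)
          have "- ((k - g' + h') + y' - (k - g' + h')) + (k + x' - k)
              = (k - g') + (- (h' + y' - h') + (g' + x' - g')) - (k - g')"
            by (simp add: word_normalize del: add_uminus_conv_diff)
          then have "- ((k - g' + h') + y' - (k - g' + h')) + (k + x' - k) \<in> N"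
            using normal_in_conj[OF N kg in1] by simp
          then have "?c (k + x' - k) = ?c ((k - g' + h') + y' - (k - g' + h'))"
            using lcoset_eq_iff[OF sN] by blast
          moreover have "k - g' + h' \<in> G" using kg that G by (auto intro: subgrp_closed)
          ultimately show "z \<in> orb y'" using k(2) by (auto simp: orb_def)
        qed
        have "orb x = orb y" using sub[of x y g h] sub[of y x h g] xy by auto
        then show False using xy \<open>c1 \<noteq> c2\<close> by simp
      qed
    qed
    moreover have "N \<in> ?c ` U" using lcoset_eq_iff[OF sN, of 0 0] sU by (auto simp: image_iff subgrp_zero intro!: bexI[of _ 0])
    then have "card (?c ` U) = Suc (card (?c ` U - {N}))"
      using card_Suc_Diff1[of "?c ` U" N] finU by simp
    ultimately show False using even_index[OF sU] NU union by simp
  qed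
  then have "even (card (?c ` Z))" using even_index[OF Zsub] NZ by (auto simp: Z_def)
  moreover have "normal_in N Z"
    using NZ N UG sN unfolding normal_in_def Z_def by blast
  ultimately obtain c where "c \<in> Z" "c \<notin> N" "c + c \<in> N"
    using exists_square_in_normal[of Z N] Zsub finU by (auto simp: Z_def)
  then show ?thesis by (auto simp: Z_def)
qed

section \<open>Kantor families with a common normal factor\<close>

text \<open>These are also known as Ahrens--Szekeres configurations. The set \<open>T i\<close> below is the tangent space
  \<open>A\<^sub>i\<^sup>*\<close> of the Kantor family.\<close>

locale as_configuration =
  fixes G U :: "'a::group_add set" and A :: "'i \<Rightarrow> 'a set" and J :: "'i set" and q :: nat
  assumes fin_G: "finite G" and G: "subgrp G" and U: "normal_in U G"
    and A: "i \<in> J \<Longrightarrow> subgrp (A i)" and A_G: "i \<in> J \<Longrightarrow> A i \<subseteq> G"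
    and card_G: "card G = q ^ 3" and card_U: "card U = q"
    and card_A: "i \<in> J \<Longrightarrow> card (A i) = q" and card_J: "card J = q + 1" and even_q: "even q"
    and A_U: "i \<in> J \<Longrightarrow> a \<in> A i \<Longrightarrow> a \<in> U \<Longrightarrow> a = 0"
    and A_A_U: "i \<in> J \<Longrightarrow> j \<in> J \<Longrightarrow> i \<noteq> j \<Longrightarrow> a \<in> A i \<Longrightarrow> u \<in> U \<Longrightarrow> a + u \<in> A j \<Longrightarrow> a + u = 0"
    and A_D_factor: "i \<in> J \<Longrightarrow> g \<in> G \<Longrightarrow> (\<And>a u. a \<in> A i \<Longrightarrow> u \<in> U \<Longrightarrow> g \<noteq> a + u) \<Longrightarrow>
      \<exists>a\<in>A i. \<exists>b\<in>\<Union>j\<in>J. A j. g = a + b"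
    and A_D_unique: "i \<in> J \<Longrightarrow> g \<in> G \<Longrightarrow> (\<And>a u. a \<in> A i \<Longrightarrow> u \<in> U \<Longrightarrow> g \<noteq> a + u) \<Longrightarrow>
      a \<in> A i \<Longrightarrow> a' \<in> A i \<Longrightarrow> b \<in> (\<Union>j\<in>J. A j) \<Longrightarrow> b' \<in> (\<Union>j\<in>J. A j) \<Longrightarrow>
      g = a + b \<Longrightarrow> g = a' + b' \<Longrightarrow> a = a'"
begin

definition D :: "'a set" where "D = (\<Union>j\<in>J. A j)"

definition T :: "'i \<Rightarrow> 'a set" where "T i = {a + u | a u. a \<in> A i \<and> u \<in> U}"

lemma A_T: "i \<in> J \<Longrightarrow> j \<in> J \<Longrightarrow> i \<noteq> j \<Longrightarrow> a \<in> A j \<Longrightarrow> a \<in> T i \<Longrightarrow> a = 0"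
  unfolding T_def using A_A_U by blast

lemma factor: "i \<in> J \<Longrightarrow> g \<in> G \<Longrightarrow> g \<notin> T i \<Longrightarrow> \<exists>a\<in>A i. \<exists>b\<in>D. g = a + b"
  unfolding T_def D_def using A_D_factor[of i g] by blast

lemma factor_unique:
  "i \<in> J \<Longrightarrow> g \<in> G \<Longrightarrow> g \<notin> T i \<Longrightarrow> a \<in> A i \<Longrightarrow> a' \<in> A i \<Longrightarrow>
    b \<in> D \<Longrightarrow> b' \<in> D \<Longrightarrow> g = a + b \<Longrightarrow> g = a' + b' \<Longrightarrow> a = a'"
  unfolding T_def D_def using A_D_unique[of i g a a' b b'] by blast

lemma sU: "subgrp U" and U_G: "U \<subseteq> G" and U_conj: "g \<in> G \<Longrightarrow> u \<in> U \<Longrightarrow> g + u - g \<in> U"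
  using U by (auto simp: normal_in_def)

lemmas U_conj' = normal_in_conj'[OF U G]

lemma fin_U: "finite U"
  by (rule finite_subset[OF U_G fin_G])

lemma fin_A: "i \<in> J \<Longrightarrow> finite (A i)"
  by (rule finite_subset[OF A_G fin_G])

lemma fin_J: "finite J"
  by (rule card_ge_0_finite) (simp add: card_J)

lemma D_G: "D \<subseteq> G"
  using A_G by (auto simp: D_def)

lemma fin_D: "finite D"
  by (rule finite_subset[OF D_G fin_G])

lemma q_ge_2: "q \<ge> 2"
proof -
  have "q \<noteq> 0" using card_U fin_U subgrp_zero[OF sU] by (metis card_0_eq empty_iff)
  then show ?thesis using even_q by (cases "q = 1") auto
qed

lemma G_closed: "x \<in> G \<Longrightarrow> y \<in> G \<Longrightarrow> x + y \<in> G" "x \<in> G \<Longrightarrow> y \<in> G \<Longrightarrow> x - y \<in> G"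
  "x \<in> G \<Longrightarrow> - x \<in> G" "0 \<in> G"
  by (rule subgrp_closed[OF G]; assumption)+

lemma in_G: "u \<in> U \<Longrightarrow> u \<in> G" "i \<in> J \<Longrightarrow> a \<in> A i \<Longrightarrow> a \<in> G" "d \<in> D \<Longrightarrow> d \<in> G"
  using U_G A_G D_G by auto

lemma T_I: "a \<in> A i \<Longrightarrow> u \<in> U \<Longrightarrow> a + u \<in> T i"
  by (auto simp: T_def)

section \<open>The tangent spaces and the transversal \<open>D\<close> of \<open>U\<close>\<close>

lemma T_subgrp: assumes i: "i \<in> J" shows "subgrp (T i)"
proof -
  have "x + y \<in> T i" if "x \<in> T i" "y \<in> T i" for x y
  proof -
    obtain a u b v where h: "a \<in> A i" "u \<in> U" "x = a + u" "b \<in> A i" "v \<in> U" "y = b + v"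
      using \<open>x \<in> T i\<close> \<open>y \<in> T i\<close> by (auto simp: T_def)
    have "x + y = (a + b) + ((- b + u + b) + v)"
      unfolding h by (simp add: word_normalize del: add_uminus_conv_diff)
    then show ?thesis using h A[OF i] sU U_conj'[of b u] in_G(2)[OF i]
      by (auto intro!: T_I subgrp_add)
  qed
  moreover have "- x \<in> T i" if "x \<in> T i" for x
  proof -
    obtain a u where h: "a \<in> A i" "u \<in> U" "x = a + u" using \<open>x \<in> T i\<close> by (auto simp: T_def)
    have "- x = - a + (a + - u - a)"
      unfolding h by (simp add: word_normalize del: add_uminus_conv_diff)
    then show ?thesis using h A[OF i] sU U_conj[of a "- u"] in_G(2)[OF i]
      by (auto intro!: T_I subgrp_minus)
  qed
  moreover have "0 \<in> T i" using T_I[of 0 i 0] A[OF i] sU by (simp add: subgrp_zero)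
  ultimately show ?thesis by (simp add: subgrp_def)
qed

lemma U_T: "i \<in> J \<Longrightarrow> u \<in> U \<Longrightarrow> u \<in> T i"
  using T_I[of 0 i u] A by (simp add: subgrp_zero)

lemma A_subset_T: "i \<in> J \<Longrightarrow> a \<in> A i \<Longrightarrow> a \<in> T i"
  using T_I[of a i 0] sU by (simp add: subgrp_zero)

lemma T_G: "i \<in> J \<Longrightarrow> x \<in> T i \<Longrightarrow> x \<in> G"
  unfolding T_def using G_closed(1) in_G(1,2) by blast

lemma T_inter:
  assumes ij: "i \<in> J" "j \<in> J" "i \<noteq> j" and x: "x \<in> T i" "x \<in> T j"
  shows "x \<in> U"
proof -
  obtain a u where a: "a \<in> A j" "u \<in> U" "x = a + u" using x by (auto simp: T_def)
  have "a + u \<in> T i" using x a by simp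
  then have "a \<in> T i" using subgrp_add_right_iff[OF T_subgrp U_T] ij a by blast
  then have "a = 0" using A_T ij a by blast
  then show ?thesis using a by simp
qed

lemma A_inter: "i \<in> J \<Longrightarrow> j \<in> J \<Longrightarrow> i \<noteq> j \<Longrightarrow> a \<in> A i \<Longrightarrow> a \<in> A j \<Longrightarrow> a = 0"
  using A_T A_subset_T by blast

lemma card_D: "card D = q\<^sup>2"
proof -
  obtain i where i: "i \<in> J" using card_J by fastforce
  have D: "D = insert 0 (\<Union>i\<in>J. A i - {0})" using A i by (auto simp: D_def subgrp_zero)
  have "card (\<Union>i\<in>J. A i - {0}) = (\<Sum>i\<in>J. card (A i - {0}))"
    by (rule card_UN_disjoint) (use fin_J fin_A A_inter in auto)
  also have "\<dots> = (\<Sum>i\<in>J. q - 1)"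
    by (rule sum.cong) (use A card_A fin_A in \<open>auto simp: subgrp_zero card_Diff_singleton\<close>)
  also have "\<dots> = (q + 1) * (q - 1)" by (simp add: card_J)
  finally have "card D = 1 + (q + 1) * (q - 1)"
    unfolding D using fin_J fin_A by (subst card_insert_disjoint) auto
  also have "\<dots> = q\<^sup>2" using q_ge_2 by (cases q) (auto simp: power2_eq_square)
  finally show ?thesis .
qed

lemma D_E: assumes "d \<in> D" obtains i where "i \<in> J" "d \<in> A i"
  using assms by (auto simp: D_def)

lemma zero_D: "0 \<in> D"
proof -
  obtain i where "i \<in> J" using card_J by fastforce
  then show ?thesis using A by (auto simp: D_def subgrp_zero)
qed

text \<open>Congruent elements of the same \<open>A i\<close> differ by an element of both
  \<open>A i\<close> and \<open>U\<close>, which is 0. For different indices \<open>e\<close> lies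
  in \<open>T i\<close> and \<open>A j\<close>, so \<open>e = 0\<close>, and then \<open>d\<close>
  lies in \<open>A i\<close> and \<open>U\<close>.\<close>

lemma D_transversal:
  assumes d: "d \<in> D" "e \<in> D" and U: "- d + e \<in> U"
  shows "d = e"
proof -
  obtain i j where ij: "i \<in> J" "d \<in> A i" "j \<in> J" "e \<in> A j" using d by (auto simp: D_def)
  show ?thesis
  proof (cases "i = j")
    case True
    then have "- d + e \<in> A i" using ij A by (auto intro: subgrp_closed)
    then have "- d + e = 0" using A_U U ij by blast
    then show ?thesis by (metis add.right_neutral add_minus_cancel)
  next
    case False
    have "e \<in> T i" using T_I[OF ij(2) U] by simp
    then have e0: "e = 0" using A_T ij False by blast
    then have "d \<in> U" using U subgrp_minus_iff[OF sU] by simp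
    then show ?thesis using A_U ij e0 by blast
  qed
qed

lemma bij_D_U: "bij_betw (\<lambda>(d, u). d + u) (D \<times> U) G"
proof -
  have inj: "inj_on (\<lambda>(d, u). d + u) (D \<times> U)"
  proof (intro inj_onI, clarify)
    fix d u e v assume h: "d \<in> D" "u \<in> U" "e \<in> D" "v \<in> U" "d + u = e + v"
    have "- d + e = u - v"
      using h(5) by (metis add_diff_cancel minus_add_cancel add_diff_eq)
    then have "d = e" using D_transversal[of d e] h sU by (auto intro: subgrp_diff)
    then show "d = e \<and> u = v" using h(5) by simp
  qed
  have "(\<lambda>(d, u). d + u) ` (D \<times> U) \<subseteq> G" using D_G U_G G by (auto intro: subgrp_add)
  moreover have "card ((\<lambda>(d, u). d + u) ` (D \<times> U)) = card G"
    using inj by (simp add: card_image card_cartesian_product card_D card_U card_G power2_eq_square power3_eq_cube)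
  ultimately have "(\<lambda>(d, u). d + u) ` (D \<times> U) = G"
    using fin_G by (intro card_subset_eq) auto
  then show ?thesis using inj by (simp add: bij_betw_def)
qed

lemma decompose: assumes "g \<in> G" obtains d u where "d \<in> D" "u \<in> U" "g = d + u"
proof -
  have "g \<in> (\<lambda>(d, u). d + u) ` (D \<times> U)" using assms bij_D_U by (simp add: bij_betw_def)
  then show ?thesis using that by force
qed

lemma sum_G: "(\<Sum>g\<in>G. f g) = (\<Sum>d\<in>D. \<Sum>u\<in>U. f (d + u))"
  unfolding sum.cartesian_product using sum.reindex_bij_betw[OF bij_D_U, of f]
  by (simp add: case_prod_unfold)

lemma in_some_T: assumes "g \<in> G" obtains i where "i \<in> J" "g \<in> T i"
proof -
  obtain d u where du: "d \<in> D" "u \<in> U" "g = d + u" using decompose[OF assms] .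
  obtain i where "i \<in> J" "d \<in> A i" using D_E[OF du(1)] .
  then show ?thesis using that[of i] T_I du by simp
qed

lemma bij_A_A_U:
  assumes ij: "i \<in> J" "j \<in> J" "i \<noteq> j"
  shows "bij_betw (\<lambda>(a, b, u). a + b + u) (A i \<times> A j \<times> U) G"
proof -
  let ?f = "\<lambda>(a, b, u). a + b + u"
  have inj: "inj_on ?f (A i \<times> A j \<times> U)"
  proof (rule inj_onI)
    fix p p' assume "p \<in> A i \<times> A j \<times> U" "p' \<in> A i \<times> A j \<times> U" "?f p = ?f p'"
    then obtain a b u a' b' u' where p: "p = (a, b, u)" "p' = (a', b', u')"
      and h: "a \<in> A i" "b \<in> A j" "u \<in> U" "a' \<in> A i" "b' \<in> A j" "u' \<in> U"
        "a + b + u = a' + b' + u'" by (cases p; cases p') auto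
    have "- a' + a = (b' + u') - (b + u)"
      using h(7) by (metis add.assoc add_diff_cancel add_diff_eq minus_add_cancel)
    then have "- a' + a \<in> T j" using h ij by (auto intro!: subgrp_diff[OF T_subgrp] T_I)
    moreover have "- a' + a \<in> A i" using h A ij by (auto intro: subgrp_closed)
    ultimately have "- a' + a = 0" using A_T[of j i] ij by blast
    then have aa: "a = a'" by (metis add.right_neutral add_minus_cancel)
    then have bb: "b + u = b' + u'" using h(7) by (simp add: add.assoc)
    have "- b + b' = u - u'" using bb by (metis add_diff_cancel minus_add_cancel add_diff_eq)
    then have "b = b'" using D_transversal[of b b'] h sU ij by (auto simp: D_def intro: subgrp_diff)
    then show "p = p'" using aa bb p by simp
  qed
  have "?f ` (A i \<times> A j \<times> U) \<subseteq> G" using in_G ij by (auto intro!: G_closed)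
  moreover have "card (?f ` (A i \<times> A j \<times> U)) = card G"
    using inj ij by (simp add: card_image card_cartesian_product card_A card_U card_G power3_eq_cube)
  ultimately have "?f ` (A i \<times> A j \<times> U) = G"
    using fin_G by (intro card_subset_eq) auto
  then show ?thesis using inj by (simp add: bij_betw_def)
qed

lemma decompose2:
  assumes "i \<in> J" "j \<in> J" "i \<noteq> j" "g \<in> G"
  obtains a b u where "a \<in> A i" "b \<in> A j" "u \<in> U" "g = a + b + u"
proof -
  have "g \<in> (\<lambda>(a, b, u). a + b + u) ` (A i \<times> A j \<times> U)"
    using assms(4) bij_A_A_U[OF assms(1-3)] by (simp add: bij_betw_def)
  then show ?thesis using that by force
qed

section \<open>Commutativity and exponent 2 of \<open>G / U\<close>\<close>

lemma T_normal: assumes i: "i \<in> J" shows "normal_in (T i) G"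
proof -
  \<comment> \<open>The tangent spaces cover \<open>G\<close>, so the conjugate lies in some
    \<open>T k\<close>. If \<open>k\<close> differs from \<open>i\<close>, write
    \<open>x = p + y + u\<close> with \<open>y + u\<close> in \<open>T k\<close>; undoing the
    conjugation by \<open>y + u\<close> puts \<open>- p + a + p\<close> into both \<open>A i\<close>
    and \<open>T k\<close>, which forces \<open>a = 0\<close>.\<close>
  have A_conj: "- x + a + x \<in> T i" if a: "a \<in> A i" and x: "x \<in> G" for a x
  proof -
    have aG: "- x + a + x \<in> G" using a x in_G(2)[OF i] by (auto intro!: G_closed)
    then obtain k where k: "k \<in> J" "- x + a + x \<in> T k" by (elim in_some_T)
    show ?thesis
    proof (cases "k = i")
      case False
      obtain p y u where h: "p \<in> A i" "y \<in> A k" "u \<in> U" "x = p + y + u"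
        using decompose2[OF i k(1) False[symmetric] x] .
      have yu: "y + u \<in> T k" using h by (simp add: T_I)
      have e: "- p + a + p = (y + u) + (- x + a + x) - (y + u)"
        unfolding h by (simp add: word_normalize del: add_uminus_conv_diff)
      have "- p + a + p \<in> T k"
        unfolding e using yu k by (auto intro!: subgrp_closed[OF T_subgrp])
      moreover have "- p + a + p \<in> A i" using a h A[OF i] by (auto intro: subgrp_closed)
      ultimately have "- p + a + p = 0" using A_T[of k i] k i False by blast
      then have "a = 0" by (metis add.assoc add_0_left add_diff_cancel add_minus_cancel diff_conv_add_uminus)
      then show ?thesis using U_T[OF i, of 0] sU by (simp add: subgrp_zero)
    qed (use k in simp)
  qed
  have "g + x - g \<in> T i" if g: "g \<in> G" and x: "x \<in> T i" for g x
  proof -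
    obtain a u where a: "a \<in> A i" "u \<in> U" "x = a + u" using x by (auto simp: T_def)
    have e: "g + x - g = (- (- g) + a + - g) + (g + u - g)"
      unfolding a by (simp add: word_normalize del: add_uminus_conv_diff)
    have "- (- g) + a + - g \<in> T i" by (rule A_conj[OF a(1) G_closed(3)[OF g]])
    then show ?thesis unfolding e using U_T[OF i U_conj[OF g a(2)]]
      by (rule subgrp_add[OF T_subgrp[OF i]])
  qed
  then show ?thesis using T_subgrp[OF i] T_G[OF i] by (auto simp: normal_in_def)
qed

text \<open>The commutator of elements of two normal subgroups lies in both of them, and
  \<open>T i\<close> and \<open>T j\<close> meet inside \<open>U\<close>.\<close>

lemma comm_A_A:
  assumes "i \<in> J" "j \<in> J" "i \<noteq> j" "a \<in> A i" "b \<in> A j"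
  shows "comm a b \<in> U"
proof (rule T_inter[OF assms(1-3)])
  have ab: "a \<in> G" "b \<in> G" using assms in_G by auto
  have "comm a b = a + (b + - a - b)" by (simp add: comm_def word_normalize del: add_uminus_conv_diff)
  moreover have "b + - a - b \<in> T i"
    by (rule normal_in_conj[OF T_normal]) (use assms ab in \<open>auto intro!: A_subset_T subgrp_minus[OF A]\<close>)
  ultimately show "comm a b \<in> T i"
    using subgrp_add[OF T_subgrp A_subset_T] assms by metis
  have "a + b - a \<in> T j"
    by (rule normal_in_conj[OF T_normal]) (use assms ab in \<open>auto intro!: A_subset_T\<close>)
  then show "comm a b \<in> T j"
    unfolding comm_def using subgrp_diff[OF T_subgrp] A_subset_T assms by blast
qed

lemma comm_U_right: "g \<in> G \<Longrightarrow> u \<in> U \<Longrightarrow> comm g u \<in> U"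
  unfolding comm_def by (rule subgrp_diff[OF sU U_conj])

lemma exists_other: assumes "i \<in> J" obtains j where "j \<in> J" "j \<noteq> i"
proof -
  have "\<not> J \<subseteq> {i}"
  proof
    assume "J \<subseteq> {i}"
    then have "card J \<le> 1" using card_mono[of "{i}" J] by simp
    then show False using card_J q_ge_2 by simp
  qed
  then show ?thesis using that by blast
qed

lemma exists_nonzero: assumes "i \<in> J" obtains a where "a \<in> A i" "a \<noteq> 0"
proof -
  have "\<not> A i \<subseteq> {0}"
  proof
    assume "A i \<subseteq> {0}"
    then have "card (A i) \<le> 1" using card_mono[of "{0}" "A i"] by simp
    then show False using card_A[OF assms] q_ge_2 by simp
  qed
  then show ?thesis using that by blast
qed

text \<open>Inside a single \<open>A i\<close> the intersection argument says nothing. Shifting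
  \<open>b\<close> by a nonzero \<open>y\<close> of another \<open>A j\<close> moves it out of
  \<open>T i\<close>, so \<open>b + y\<close> is congruent modulo \<open>U\<close> to an element of
  some \<open>A k\<close> with \<open>k \<noteq> i\<close>. Hence \<open>a\<close> commutes modulo
  \<open>U\<close> with \<open>b + y\<close> and with \<open>y\<close>, and so with
  \<open>b\<close>.\<close>

lemma comm_A: assumes i: "i \<in> J" and a: "a \<in> A i" and b: "b \<in> A i" shows "comm a b \<in> U"
proof -
  obtain j where j: "j \<in> J" "j \<noteq> i" using exists_other[OF i] .
  obtain y where y: "y \<in> A j" "y \<noteq> 0" using exists_nonzero[OF j(1)] .
  have aG: "a \<in> G" using a i in_G by blast
  let ?C = "{x \<in> G. comm a x \<in> U}"
  have C: "subgrp ?C" by (rule centralizer_mod_subgrp[OF G U aG])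
  have yC: "y \<in> ?C" using comm_A_A[of i j a y] i j a y in_G by auto
  have byG: "b + y \<in> G" by (rule G_closed(1)[OF in_G(2)[OF i b] in_G(2)[OF j(1) y(1)]])
  then obtain d u where du: "d \<in> D" "u \<in> U" "b + y = d + u" by (elim decompose)
  then obtain k where k: "k \<in> J" "d \<in> A k" by (elim D_E)
  have "k \<noteq> i"
  proof
    assume "k = i"
    then have "b + y \<in> T i" using du k by (simp add: T_I)
    then have "y \<in> T i" using subgrp_add_left_iff[OF T_subgrp[OF i] A_subset_T[OF i b]] by simp
    then show False using A_T[of i j y] i j y by auto
  qed
  then have "d \<in> ?C" using comm_A_A[of i k a d] i k a in_G du by auto
  moreover have "u \<in> ?C" using comm_U_right du aG in_G by auto
  ultimately have "b + y \<in> ?C" unfolding du(3) using subgrp_add[OF C] by blast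
  then have "b \<in> ?C" using subgrp_add_right_iff[OF C yC] by simp
  then show ?thesis by simp
qed

lemma comm_U: assumes x: "x \<in> G" and y: "y \<in> G" shows "comm x y \<in> U"
proof -
  have D_D: "comm d e \<in> U" if d: "d \<in> D" and e: "e \<in> D" for d e
  proof -
    obtain i where i: "i \<in> J" "d \<in> A i" using d by (elim D_E)
    obtain j where j: "j \<in> J" "e \<in> A j" using e by (elim D_E)
    show ?thesis using comm_A_A[OF i(1) j(1) _ i(2) j(2)] comm_A[OF i] j(2) by blast
  qed
  have D_G: "comm d y \<in> U" if d: "d \<in> D" and y: "y \<in> G" for d y
  proof -
    have C: "subgrp {x \<in> G. comm d x \<in> U}" by (rule centralizer_mod_subgrp[OF G U]) (use d in_G in auto)
    obtain e u where eu: "e \<in> D" "u \<in> U" "y = e + u" using y by (elim decompose)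
    have "y \<in> {x \<in> G. comm d x \<in> U}"
      unfolding eu(3) using D_D[OF d eu(1)] comm_U_right eu d in_G by (intro subgrp_add[OF C]) auto
    then show ?thesis by simp
  qed
  have C: "subgrp {x \<in> G. comm y x \<in> U}" by (rule centralizer_mod_subgrp[OF G U y])
  obtain d u where du: "d \<in> D" "u \<in> U" "x = d + u" using x by (elim decompose)
  have "comm y d \<in> U" using D_G[OF du(1) y] subgrp_minus[OF sU] minus_comm by metis
  then have "x \<in> {x \<in> G. comm y x \<in> U}"
    unfolding du(3) using comm_U_right[OF y] du in_G by (intro subgrp_add[OF C]) auto
  then show ?thesis using subgrp_minus[OF sU] minus_comm by (metis (mono_tags, lifting) mem_Collect_eq)
qed

text \<open>For an involution \<open>a\<close> in \<open>A i\<close> and \<open>b\<close> in another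
  \<open>A j\<close>, the doubles of \<open>b\<close> and of \<open>a + b\<close> are congruent
  modulo \<open>U\<close>, as \<open>G / U\<close> is abelian. So \<open>b + b\<close> lies in the
  \<open>T k\<close> containing \<open>a + b\<close>; here \<open>k \<noteq> j\<close>, and
  \<open>A j\<close> meets \<open>T k\<close> trivially. \<open>A i\<close> has an involution
  because \<open>q\<close> is even, and the argument is applied from \<open>A i\<close> to
  \<open>A j\<close> and back.\<close>

lemma A_double: assumes i: "i \<in> J" and a: "a \<in> A i" shows "a + a = 0"
proof -
  have step: "b + b = 0" if ij: "i \<in> J" "j \<in> J" "i \<noteq> j" and a: "a \<in> A i" "a \<noteq> 0" "a + a = 0" and b: "b \<in> A j"
    for i j a b
  proof -
    have ab: "a \<in> G" "b \<in> G" "a + b \<in> G" 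
      using in_G(2)[OF ij(1) a(1)] in_G(2)[OF ij(2) b] G_closed(1) by simp_all
    obtain k where k: "k \<in> J" "a + b \<in> T k" using ab(3) by (elim in_some_T)
    have "k \<noteq> j"
    proof
      assume "k = j"
      then have "a \<in> T j" using subgrp_add_right_iff[OF T_subgrp[OF ij(2)] A_subset_T[OF ij(2) b]] k by simp
      then show False using A_T[of j i a] ij a by auto
    qed
    have "- comm a b + (a + b) + (a + b) = b + (a + a) + b"
      by (simp add: comm_def word_normalize del: add_uminus_conv_diff)
    then have e: "b + b = - comm a b + (a + b) + (a + b)" using a by simp
    have "b + b \<in> T k" unfolding e
      by (intro subgrp_add[OF T_subgrp[OF k(1)]] subgrp_minus[OF T_subgrp[OF k(1)]]
          U_T[OF k(1)] comm_U[OF ab(1,2)] k(2))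
    moreover have "b + b \<in> A j" using b A ij by (auto intro: subgrp_add)
    ultimately show ?thesis using A_T[of k j] k ij \<open>k \<noteq> j\<close> by blast
  qed
  obtain x where x: "x \<in> A i" "x \<noteq> 0" "x + x = 0"
  proof -
    have n: "normal_in {0} (A i)" using A[OF i] by (auto simp: normal_in_def subgrp_def)
    have "card ((\<lambda>g. (+) g ` {0}) ` A i) * card {0::'a} = card (A i)"
      by (rule card_cosets) (use fin_A[OF i] A[OF i] n in \<open>auto simp: normal_in_def\<close>)
    then have "even (card ((\<lambda>g. (+) g ` {0}) ` A i))" using card_A[OF i] even_q by simp
    from exists_square_in_normal[OF fin_A[OF i] A[OF i] n this] show ?thesis using that by auto
  qed
  obtain j where j: "j \<in> J" "j \<noteq> i" using exists_other[OF i] .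
  obtain y where y: "y \<in> A j" "y \<noteq> 0" using exists_nonzero[OF j(1)] .
  have "y + y = 0" using step[of i j x y] i j x y by auto
  then show ?thesis using step[of j i y a] i j y a by auto
qed

lemma D_double: "d \<in> D \<Longrightarrow> d + d = 0"
  using A_double by (auto simp: D_def)

lemma D_minus: "d \<in> D \<Longrightarrow> - d = d"
  using D_double minus_unique by blast

lemma q_power: "\<exists>n. q = 2 ^ n"
proof -
  obtain i where i: "i \<in> J" using card_J by fastforce
  show ?thesis using exponent_two_card[OF fin_A[OF i] A[OF i] A_double[OF i]] card_A[OF i] by simp
qed

text \<open>That is, \<open>D\<close> is a semiregular relative difference set with forbidden subgroup \<open>U\<close>.\<close>

lemma card_D_D:
  assumes g: "g \<in> G" "g \<notin> U"
  shows "card {p \<in> D \<times> D. fst p + snd p = g} = q"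
proof -
  obtain i where i: "i \<in> J" "g \<in> T i" using g(1) by (elim in_some_T)
  have not_T: "g \<notin> T j" if "j \<in> J" "j \<noteq> i" for j using T_inter[OF i(1)] that i(2) g(2) by blast
  \<comment> \<open>For each index \<open>j\<close> other than \<open>i\<close> exactly one
    factorization of \<open>g\<close> over \<open>D\<close> has its first summand in
    \<open>A j\<close>. If \<open>g\<close> is in \<open>A i\<close>, this is always
    \<open>0 + g\<close>, and the \<open>q\<close> factorizations inside \<open>A i\<close> are all.
    Otherwise the first summand cannot be in \<open>A i\<close>, and the \<open>q\<close> other
    indices give distinct pairs.\<close>
  show ?thesis
  proof (cases "g \<in> A i")
    case True
    have "{p \<in> D \<times> D. fst p + snd p = g} = (\<lambda>a. (a, - a + g)) ` A i"
    proof (intro set_eqI iffI)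
      fix p assume "p \<in> {p \<in> D \<times> D. fst p + snd p = g}"
      then obtain d e where p: "p = (d, e)" "d \<in> D" "e \<in> D" "d + e = g" by (cases p) auto
      obtain j where j: "j \<in> J" "d \<in> A j" using p(2) by (elim D_E)
      have "d \<in> A i"
      proof (cases "j = i")
        case False
        have "d = 0" using factor_unique[OF j(1) g(1) not_T[OF j(1) False] j(2) _ p(3) _ p(4)[symmetric], of 0 g]
          A[OF j(1)] True i(1) by (auto simp: D_def subgrp_zero)
        then show ?thesis using A[OF i(1)] by (simp add: subgrp_zero)
      qed (use j in simp)
      moreover have "e = - d + g" using p(4) by auto
      ultimately show "p \<in> (\<lambda>a. (a, - a + g)) ` A i" using p(1) by auto
    next
      fix p assume "p \<in> (\<lambda>a. (a, - a + g)) ` A i"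
      then obtain a where a: "a \<in> A i" "p = (a, - a + g)" by auto
      have "- a + g \<in> A i" using a True subgrp_add[OF A[OF i(1)] subgrp_minus[OF A[OF i(1)]]] by blast
      then show "p \<in> {p \<in> D \<times> D. fst p + snd p = g}" using a i(1) by (auto simp: D_def)
    qed
    then show ?thesis using card_A[OF i(1)] by (simp add: card_image inj_on_def)
  next
    case False
    have notD: "g \<notin> D"
    proof
      assume "g \<in> D"
      then obtain j where "j \<in> J" "g \<in> A j" by (elim D_E)
      then show False using not_T A_subset_T False by blast
    qed
    have "\<forall>j\<in>J - {i}. \<exists>a. a \<in> A j \<and> - a + g \<in> D"
    proof
      fix j assume j: "j \<in> J - {i}"
      then obtain a b where ab: "a \<in> A j" "b \<in> D" "g = a + b"
        using factor[of j g] g(1) not_T by blast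
      then have "a \<in> A j \<and> - a + g \<in> D" by simp
      then show "\<exists>a. a \<in> A j \<and> - a + g \<in> D" by blast
    qed
    then obtain f where f: "\<And>j. j \<in> J - {i} \<Longrightarrow> f j \<in> A j \<and> - f j + g \<in> D" by metis
    have f0: "f j \<noteq> 0" if "j \<in> J - {i}" for j using f[OF that] notD by auto
    have "{p \<in> D \<times> D. fst p + snd p = g} = (\<lambda>j. (f j, - f j + g)) ` (J - {i})"
    proof (intro set_eqI iffI)
      fix p assume "p \<in> {p \<in> D \<times> D. fst p + snd p = g}"
      then obtain d e where p: "p = (d, e)" "d \<in> D" "e \<in> D" "d + e = g" by (cases p) auto
      obtain j where j: "j \<in> J" "d \<in> A j" using p(2) by (elim D_E)
      have ji: "j \<noteq> i"
      proof
        assume "j = i"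
        then have dT: "d \<in> T i" using j A_subset_T by simp
        have "d + e \<in> T i" using i(2) p(4) by simp
        then have "e \<in> T i" using subgrp_add_left_iff[OF T_subgrp[OF i(1)] dT] by simp
        moreover obtain k where k: "k \<in> J" "e \<in> A k" using p(3) by (elim D_E)
        ultimately have "e \<in> A i" using A_T[OF i(1) k(1) _ k(2)] k A[OF i(1)] by (metis subgrp_zero)
        then have "g \<in> A i" using p(4) j \<open>j = i\<close> A[OF i(1)] by (auto intro: subgrp_add)
        then show False using False by simp
      qed
      have "d = f j" using factor_unique[OF j(1) g(1) not_T[OF j(1) ji] j(2) _ p(3) _ p(4)[symmetric], of "f j" "- f j + g"]
        f[of j] j(1) ji by simp
      moreover have "e = - d + g" using p(4) by auto
      ultimately show "p \<in> (\<lambda>j. (f j, - f j + g)) ` (J - {i})" using p(1) j ji by auto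
    next
      fix p assume "p \<in> (\<lambda>j. (f j, - f j + g)) ` (J - {i})"
      then show "p \<in> {p \<in> D \<times> D. fst p + snd p = g}" using f by (auto simp: D_def)
    qed
    moreover have "inj_on (\<lambda>j. (f j, - f j + g)) (J - {i})"
    proof (intro inj_onI)
      fix j k assume h: "j \<in> J - {i}" "k \<in> J - {i}" "(f j, - f j + g) = (f k, - f k + g)"
      then show "j = k" using A_inter[of j k "f j"] f[OF h(1)] f[OF h(2)] f0[OF h(1)] by auto
    qed
    ultimately show ?thesis using card_J i(1) fin_J by (simp add: card_image)
  qed
qed

text \<open>The group ring equation \<open>D\<^sup>2 = q\<^sup>2 + q (G - U)\<close>, evaluated at
  \<open>f\<close>. The neutral element arises as \<open>d + d\<close> for each \<open>d\<close> in
  \<open>D\<close>; no other element of \<open>U\<close> is a sum of two elements of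
  \<open>D\<close>, by \<open>D_transversal\<close> and \<open>- d = d\<close>.\<close>

lemma sum_D_D:
  fixes f :: "'a \<Rightarrow> int"
  shows "(\<Sum>d\<in>D. \<Sum>e\<in>D. f (d + e)) = int q ^ 2 * f 0 + int q * ((\<Sum>g\<in>G. f g) - (\<Sum>u\<in>U. f u))"
proof -
  let ?r = "\<lambda>g. {p \<in> D \<times> D. fst p + snd p = g}"
  have r0: "card (?r 0) = q\<^sup>2"
  proof -
    have "?r 0 = (\<lambda>d. (d, d)) ` D"
      using D_minus D_double by (auto simp: image_iff) (metis minus_unique)+
    then show ?thesis by (simp add: card_image inj_on_def card_D)
  qed
  have rU: "?r u = {}" if "u \<in> U" "u \<noteq> 0" for u
  proof -
    have False if h: "d \<in> D" "e \<in> D" "d + e = u" for d e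
    proof -
      have "- d + e \<in> U" using h \<open>u \<in> U\<close> D_minus by simp
      then have "d = e" using D_transversal h by blast
      then show False using h \<open>u \<noteq> 0\<close> D_double by simp
    qed
    then show ?thesis by auto
  qed
  have GU: "(\<Sum>g\<in>G. f g) = (\<Sum>u\<in>U. f u) + (\<Sum>g\<in>G - U. f g)"
    using sum.subset_diff[OF U_G fin_G, of f] by simp
  have "(\<Sum>d\<in>D. \<Sum>e\<in>D. f (d + e)) = (\<Sum>p\<in>D \<times> D. f (fst p + snd p))"
    by (simp add: sum.cartesian_product case_prod_unfold)
  also have "\<dots> = (\<Sum>g\<in>G. \<Sum>p\<in>?r g. f (fst p + snd p))"
    by (rule sum.group[symmetric]) (use fin_D fin_G in_G(3) G_closed(1) in auto)
  also have "\<dots> = (\<Sum>g\<in>G. int (card (?r g)) * f g)"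
    by (intro sum.cong) auto
  also have "\<dots> = (\<Sum>g\<in>G - U. int (card (?r g)) * f g) + (\<Sum>u\<in>U. int (card (?r u)) * f u)"
    using sum.subset_diff[OF U_G fin_G] .
  also have "(\<Sum>g\<in>G - U. int (card (?r g)) * f g) = int q * (\<Sum>g\<in>G - U. f g)"
    using card_D_D by (simp add: sum_distrib_left)
  also have "(\<Sum>u\<in>U. int (card (?r u)) * f u) = (\<Sum>u\<in>U. if u = 0 then int q ^ 2 * f 0 else 0)"
  proof (rule sum.cong)
    fix u assume u: "u \<in> U"
    show "int (card (?r u)) * f u = (if u = 0 then int q ^ 2 * f 0 else 0)"
    proof (cases "u = 0")
      case True then show ?thesis unfolding True r0 by simp
    next
      case False then show ?thesis unfolding rU[OF u False] by simp
    qed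
  qed simp
  also have "\<dots> = int q ^ 2 * f 0"
    using fin_U sU by (simp add: sum.delta subgrp_zero)
  finally show ?thesis using GU by simp
qed

end

section \<open>The commutator form and the squaring form\<close>

text \<open>The preimage of the central subgroup, of order at most 2, generated by the image of
  \<open>z\<close> in \<open>G / N\<close>.\<close>

lemma normal_in_adjoin:
  assumes G: "subgrp G" and N: "normal_in N G" and z: "z \<in> G" "z + z \<in> N"
    and central: "\<And>g. g \<in> G \<Longrightarrow> comm g z \<in> N"
  shows "normal_in (N \<union> (+) z ` N) G"
proof -
  have sN: "subgrp N" and NG: "N \<subseteq> G" using N by (auto simp: normal_in_def)
  let ?M = "N \<union> (+) z ` N"
  have zN: "z + n \<in> ?M" if "n \<in> N" for n using that by blast
  have conj_z: "- z + n + z \<in> N" if "n \<in> N" for n by (rule normal_in_conj'[OF N G z(1) that])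
  have "x + y \<in> ?M" if xy: "x \<in> ?M" "y \<in> ?M" for x y
  proof -
    obtain n where n: "n \<in> N" "x = n \<or> x = z + n" using xy(1) by blast
    obtain m where m: "m \<in> N" "y = m \<or> y = z + m" using xy(2) by blast
    have nm: "n + m \<in> N" and nm': "- z + n + z + m \<in> N"
      using n m conj_z by (auto intro: subgrp_add[OF sN])
    have "n + (z + m) = z + (- z + n + z + m)" "(z + n) + m = z + (n + m)"
      "(z + n) + (z + m) = (z + z) + (- z + n + z + m)"
      by (simp_all add: word_normalize del: add_uminus_conv_diff)
    then show ?thesis using n m nm nm' zN subgrp_add[OF sN z(2)] by (metis UnI1)
  qed
  moreover have "- x \<in> ?M" if x: "x \<in> ?M" for x
  proof -
    obtain n where n: "n \<in> N" "x = n \<or> x = z + n" using x by blast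
    have mn: "- n \<in> N" by (rule subgrp_minus[OF sN n(1)])
    have "- (z + n) = z + (- (z + z) + (z + - n - z))"
      by (simp add: word_normalize del: add_uminus_conv_diff)
    moreover have "- (z + z) + (z + - n - z) \<in> N"
      by (rule subgrp_add[OF sN subgrp_minus[OF sN z(2)] normal_in_conj[OF N z(1) mn]])
    ultimately show ?thesis using n mn zN by (metis UnI1)
  qed
  moreover have "g + x - g \<in> ?M" if g: "g \<in> G" and x: "x \<in> ?M" for g x
  proof -
    obtain n where n: "n \<in> N" "x = n \<or> x = z + n" using x by blast
    have c: "g + n - g \<in> N" by (rule normal_in_conj[OF N g n(1)])
    have "g + (z + n) - g = z + ((- z + comm g z + z) + (g + n - g))"
      by (simp add: comm_def word_normalize del: add_uminus_conv_diff)
    moreover have "(- z + comm g z + z) + (g + n - g) \<in> N"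
      by (rule subgrp_add[OF sN conj_z[OF central[OF g]] c])
    ultimately show ?thesis using n c zN by (metis UnI1)
  qed
  moreover have "?M \<subseteq> G" using NG z(1) subgrp_add[OF G] by blast
  ultimately show ?thesis using subgrp_zero[OF sN] by (simp add: normal_in_def subgrp_def)
qed

text \<open>In \<open>G / N\<close> the image of \<open>c\<close> is a central involution and the
  only nontrivial commutator, so commutators can be read as signs. It is also the only involution of
  \<open>U / N\<close> that is central in \<open>G / N\<close>.\<close>

locale as_reduction = as_configuration G U A J q
  for G U :: "'a::group_add set" and A :: "'i \<Rightarrow> 'a set" and J q +
  fixes N :: "'a set" and c :: 'a
  assumes N: "normal_in N G" and N_U: "N \<subseteq> U" and c: "c \<in> U" "c \<notin> N" "c + c \<in> N"
    and c_central: "g \<in> G \<Longrightarrow> comm g c \<in> N"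
    and comm_in: "x \<in> G \<Longrightarrow> y \<in> G \<Longrightarrow> comm x y \<in> N \<union> (+) c ` N"
    and nonabelian: "\<exists>x\<in>G. \<exists>y\<in>G. comm x y \<notin> N"
    and unique: "z \<in> U \<Longrightarrow> (\<And>g. g \<in> G \<Longrightarrow> comm g z \<in> N) \<Longrightarrow> z + z \<in> N \<Longrightarrow> z \<in> N \<union> (+) c ` N"

text \<open>\<open>N\<close> is chosen maximal among the normal subgroups inside \<open>U\<close> with nonabelian factor group.\<close>

lemma (in as_configuration) exists_reduction:
  assumes xy: "x \<in> G" "y \<in> G" "x + y \<noteq> y + x"
  shows "\<exists>N c. as_reduction G U A J q N c"
proof -
  let ?P = "\<lambda>N. normal_in N G \<and> N \<subseteq> U \<and> (\<exists>x\<in>G. \<exists>y\<in>G. comm x y \<notin> N)"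
  have "comm x y \<noteq> 0"
  proof
    assume "comm x y = 0"
    then have "comm x y + (y + x) = y + x" by simp
    then have "x + y = y + x" by (simp add: comm_def word_normalize del: add_uminus_conv_diff)
    then show False using xy by simp
  qed
  moreover have "normal_in {0} G" using G by (auto simp: normal_in_def subgrp_def)
  ultimately have "?P {0}" using xy sU by (auto simp: subgrp_zero)
  moreover have "finite {N. ?P N}" using fin_U by (auto intro: finite_subset[of _ "Pow U"])
  ultimately have "\<exists>N\<in>{N. ?P N}. \<forall>M\<in>{N. ?P N}. N \<subseteq> M \<longrightarrow> N = M"
    by (intro finite_has_maximal) auto
  then obtain N where N: "normal_in N G" "N \<subseteq> U" "\<exists>x\<in>G. \<exists>y\<in>G. comm x y \<notin> N"
    and mx: "\<forall>M\<in>{N. ?P N}. N \<subseteq> M \<longrightarrow> N = M" by auto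
  \<comment> \<open>Maximality of \<open>N\<close>: every larger normal subgroup inside
    \<open>U\<close> has an abelian factor group.\<close>
  have comm_in: "comm x y \<in> M" if "normal_in M G" "M \<subseteq> U" "N \<subset> M" "x \<in> G" "y \<in> G" for M x y
    using mx that by blast
  have "N \<noteq> U" using N(3) comm_U by auto
  then have "N \<subset> U" using N(2) by auto
  moreover obtain n where "q = 2 ^ n" using q_power by auto
  then have "card G = 2 ^ (n * 3)" by (simp add: card_G power_mult)
  ultimately obtain c where c: "c \<in> U" "c \<notin> N" "c + c \<in> N" "\<And>g. g \<in> G \<Longrightarrow> comm g c \<in> N"
    using exists_central_mod[OF fin_G G U N(1)] by blast
  have adj: "normal_in (N \<union> (+) z ` N) G" "N \<union> (+) z ` N \<subseteq> U" "z \<in> N \<union> (+) z ` N"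
    if z: "z \<in> U" "z + z \<in> N" "\<And>g. g \<in> G \<Longrightarrow> comm g z \<in> N" for z
  proof -
    show "normal_in (N \<union> (+) z ` N) G"
      by (rule normal_in_adjoin[OF G N(1) in_G(1)[OF z(1)] z(2,3)])
    show "N \<union> (+) z ` N \<subseteq> U" using N(2) z(1) subgrp_add[OF sU] by blast
    show "z \<in> N \<union> (+) z ` N" using subgrp_zero[OF normal_in_subgrp[OF N(1)]]
      by (metis UnI2 add.right_neutral imageI)
  qed
  have comm_adj: "comm x y \<in> N \<union> (+) z ` N"
    if z: "z \<in> U" "z \<notin> N" "z + z \<in> N" "\<And>g. g \<in> G \<Longrightarrow> comm g z \<in> N" and xy: "x \<in> G" "y \<in> G" for x y z
    by (rule comm_in[OF adj(1)[OF z(1,3,4)] adj(2)[OF z(1,3,4)] _ xy])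
       (use adj(3)[OF z(1,3,4)] z(2) in blast)+
  have "as_reduction G U A J q N c"
  proof (unfold_locales)
    show "comm x y \<in> N \<union> (+) c ` N" if "x \<in> G" "y \<in> G" for x y
      by (rule comm_adj[OF c(1,2,3,4) that])
    show "z \<in> N \<union> (+) c ` N" if z: "z \<in> U" "\<And>g. g \<in> G \<Longrightarrow> comm g z \<in> N" "z + z \<in> N" for z
    proof (cases "z \<in> N")
      case False
      \<comment> \<open>A commutator outside \<open>N\<close> lies both in \<open>c + N\<close> and
        in \<open>z + N\<close>, so these cosets coincide.\<close>
      obtain x y where xy: "x \<in> G" "y \<in> G" "comm x y \<notin> N" using N(3) by auto
      have "comm x y \<in> (+) c ` N" "comm x y \<in> (+) z ` N"
        using comm_adj[OF c(1,2,3,4) xy(1,2)] comm_adj[OF z(1) False z(3,2) xy(1,2)] xy(3) by auto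
      then have "(+) (comm x y) ` N = (+) c ` N" "(+) (comm x y) ` N = (+) z ` N"
        unfolding in_lcoset_iff lcoset_eq_iff[OF normal_in_subgrp[OF N(1)]] by auto
      then show ?thesis using adj(3)[OF z(1,3,2)] False by auto
    qed simp
  qed (use N c in auto)
  then show ?thesis by blast
qed

context as_reduction
begin

definition N1 :: "'a set" where "N1 = N \<union> (+) c ` N"

lemma comm_N1: "x \<in> G \<Longrightarrow> y \<in> G \<Longrightarrow> comm x y \<in> N1"
  unfolding N1_def by (rule comm_in)

lemma sN: "subgrp N" and N_G: "N \<subseteq> G"
  using N by (auto simp: normal_in_def)

lemma N1_normal: "normal_in N1 G"
  unfolding N1_def by (rule normal_in_adjoin[OF G N in_G(1)[OF c(1)] c(3) c_central])

lemma N1: "subgrp N1" and N1_G: "N1 \<subseteq> G"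
  using N1_normal by (auto simp: normal_in_def)

lemma N1_U: "n \<in> N1 \<Longrightarrow> n \<in> U"
  using N_U subgrp_add[OF sU c(1)] by (auto simp: N1_def)

lemma c_N1: "c \<in> N1"
  unfolding N1_def using subgrp_zero[OF sN] by (metis UnI2 add.right_neutral imageI)

lemma fin_N1: "finite N1"
  by (rule finite_subset[OF N1_G fin_G])

lemma card_N1: "card N1 \<ge> 2"
proof -
  have "c \<noteq> 0" using c(2) subgrp_zero[OF sN] by auto
  then have "card {0, c} = 2" by simp
  moreover have "{0, c} \<subseteq> N1" using c_N1 subgrp_zero[OF N1] by simp
  ultimately show ?thesis using card_mono[OF fin_N1] by metis
qed

text \<open>All forms are written multiplicatively, with values in \<open>{1, -1}\<close>. The function \<open>eps\<close> is meant for arguments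
  in \<open>N1\<close> only, where it is the character with kernel \<open>N\<close>.\<close>

definition eps :: "'a \<Rightarrow> int" where
  "eps x = (if x \<in> N then 1 else - 1)"

definition beta :: "'a \<Rightarrow> 'a \<Rightarrow> int" where
  "beta x y = eps (comm x y)"

definition sq :: "'a \<Rightarrow> int" where
  "sq x = eps (x + x)"

lemma eps_N1: "x \<in> N1 \<Longrightarrow> y \<in> N1 \<Longrightarrow> eps (x + y) = eps x * eps y"
proof -
  assume xy: "x \<in> N1" "y \<in> N1"
  have "x + y \<in> N" if nn: "x \<notin> N" "y \<notin> N"
  proof -
    obtain n m where nm: "n \<in> N" "m \<in> N" "x = c + n" "y = c + m"
      using xy nn by (auto simp: N1_def)
    have "x + y = (c + c) + ((- c + n + c) + m)"
      unfolding nm by (simp add: word_normalize del: add_uminus_conv_diff)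
    moreover have "(- c + n + c) + m \<in> N"
      by (rule subgrp_add[OF sN normal_in_conj'[OF N G in_G(1)[OF c(1)] nm(1)] nm(2)])
    ultimately show ?thesis using subgrp_add[OF sN c(3)] by simp
  qed
  then show ?thesis
    using subgrp_add_right_iff[OF sN, of y x] subgrp_add_left_iff[OF sN, of x y]
    by (auto simp: eps_def)
qed

lemma eps_conj: "g \<in> G \<Longrightarrow> eps (g + x - g) = eps x"
  by (simp add: eps_def normal_in_conj_iff[OF N G])

lemma eps_values: "eps x = 1 \<or> eps x = - 1" and eps_eq_1: "eps x = 1 \<longleftrightarrow> x \<in> N"
  and eps_minus: "eps (- x) = eps x"
  by (auto simp: eps_def subgrp_minus_iff[OF sN])

lemma beta_values: "beta x y = 1 \<or> beta x y = - 1" and sq_values: "sq x = 1 \<or> sq x = - 1"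
  unfolding beta_def sq_def using eps_values by auto

lemma beta_sq: "beta x y * beta x y = 1" and sq_sq: "sq x * sq x = 1"
  using beta_values[of x y] sq_values[of x] by auto

lemma beta_commute: "beta x y = beta y x"
  unfolding beta_def using eps_minus[of "comm x y"] by (simp add: minus_comm)

lemma beta_add_left:
  assumes "x \<in> G" "y \<in> G" "g \<in> G"
  shows "beta (x + y) g = beta x g * beta y g"
proof -
  have "beta (x + y) g = eps (x + comm y g - x) * eps (comm x g)"
    unfolding beta_def comm_add_left
    by (rule eps_N1[OF normal_in_conj[OF N1_normal assms(1) comm_N1] comm_N1]) (use assms in auto)
  then show ?thesis by (simp add: eps_conj[OF assms(1)] beta_def)
qed

lemma beta_add_right:
  assumes "x \<in> G" "y \<in> G" "g \<in> G"
  shows "beta g (x + y) = beta g x * beta g y"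
  using beta_add_left[OF assms] by (simp add: beta_commute)

lemma beta_0: "beta 0 x = 1" "beta x 0 = 1"
  by (simp_all add: beta_def comm_def eps_def subgrp_zero[OF sN])

lemma beta_minus_left: assumes "x \<in> G" "g \<in> G" shows "beta (- x) g = beta x g"
proof -
  have "beta (- x) g * beta x g = 1"
    using beta_add_left[of "- x" x g] assms G_closed(3) beta_0 by simp
  then show ?thesis using beta_values[of "- x" g] beta_values[of x g] by auto
qed

text \<open>An element outside \<open>U\<close> is a sum \<open>d + e\<close> of two elements of
  \<open>D\<close>, and its double is \<open>comm d e\<close> because \<open>d\<close> and
  \<open>e\<close> are their own negatives. An element \<open>g\<close> of \<open>U\<close> is moved
  out of \<open>U\<close> by a nonzero \<open>d\<close> of some \<open>A i\<close>; as
  \<open>d + d = 0\<close>, the double of \<open>d + g\<close> differs from \<open>g + g\<close>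
  only by a conjugate of a commutator.\<close>

lemma double_N1: assumes g: "g \<in> G" shows "g + g \<in> N1"
proof -
  have outer: "g + g \<in> N1" if g: "g \<in> G" "g \<notin> U" for g
  proof -
    have "{p \<in> D \<times> D. fst p + snd p = g} \<noteq> {}" using card_D_D[OF g] q_ge_2 by (metis card.empty not_numeral_le_zero)
    then obtain d e where de: "d \<in> D" "e \<in> D" "g = d + e" by auto
    have "g + g = d + e + d + e" by (simp add: de add.assoc)
    also have "\<dots> = d + e + - d + - e" using D_minus de by simp
    finally have "g + g = comm d e" by (simp add: comm_def)
    then show ?thesis using comm_N1 in_G(3) de by simp
  qed
  show ?thesis
  proof (cases "g \<in> U")
    case True
    obtain i where i: "i \<in> J" using card_J by fastforce
    obtain d where d: "d \<in> A i" "d \<noteq> 0" using exists_nonzero[OF i] .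
    have dG: "d \<in> G" using in_G(2)[OF i d(1)] .
    have "d \<notin> U" using A_U[OF i d(1)] d(2) by auto
    then have "d + g \<notin> U" using subgrp_add_right_iff[OF sU True] by simp
    then have "(d + g) + (d + g) \<in> N1" by (rule outer[OF G_closed(1)[OF dG g]])
    moreover have "(d + g) + (d + g) = (d + comm g d - d) + ((d + d) + (g + g))"
      by (simp add: comm_def word_normalize del: add_uminus_conv_diff)
    moreover have "d + comm g d - d \<in> N1"
      by (rule normal_in_conj[OF N1_normal dG comm_N1[OF g dG]])
    ultimately have "(d + d) + (g + g) \<in> N1" using subgrp_add_left_iff[OF N1] by metis
    then show ?thesis using A_double[OF i d(1)] by simp
  qed (rule outer[OF g])
qed

text \<open>This makes \<open>sq\<close> a quadratic form, written with signs, whose polar form is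
  \<open>beta\<close>.\<close>

lemma sq_add: assumes "g \<in> G" "h \<in> G" shows "sq (g + h) = sq g * sq h * beta g h"
proof -
  have "(g + h) + (g + h) = (g + g) + (comm (- g) h + (h + h))"
    by (simp add: comm_def word_normalize del: add_uminus_conv_diff)
  then have "sq (g + h) = eps ((g + g) + (comm (- g) h + (h + h)))" by (simp add: sq_def)
  also have "\<dots> = eps (g + g) * (eps (comm (- g) h) * eps (h + h))"
    using assms G_closed(3)[OF assms(1)]
    by (simp add: eps_N1 double_N1 comm_N1 subgrp_add[OF N1])
  also have "\<dots> = sq g * (beta (- g) h * sq h)" by (simp add: sq_def beta_def)
  finally show ?thesis using beta_minus_left[OF assms] by simp
qed

lemma sq_D: "d \<in> D \<Longrightarrow> sq d = 1"
  by (simp add: sq_def D_double eps_def subgrp_zero[OF sN])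

lemma A_D: "i \<in> J \<Longrightarrow> a \<in> A i \<Longrightarrow> a \<in> D"
  by (auto simp: D_def)

lemma beta_A: assumes i: "i \<in> J" "a \<in> A i" "b \<in> A i" shows "beta a b = 1"
proof -
  have "comm a b \<in> A i" unfolding comm_def using A[OF i(1)] i(2,3) by (intro subgrp_closed)
  then have "comm a b = 0" by (rule A_U[OF i(1) _ comm_A[OF i]])
  then show ?thesis by (simp add: beta_def eps_def subgrp_zero[OF sN])
qed

lemma sq_centralizer_A:
  assumes i: "i \<in> J" and g: "g \<in> G" "g \<notin> T i" and cent: "\<And>a. a \<in> A i \<Longrightarrow> beta g a = 1"
  shows "sq g = 1"
proof -
  obtain a b where ab: "a \<in> A i" "b \<in> D" "g = a + b" using factor[OF i g] by blast
  have abG: "a \<in> G" "b \<in> G" using ab in_G(2)[OF i] in_G(3) by auto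
  have "beta g a = beta a a * beta b a" unfolding ab(3) by (rule beta_add_left[OF abG(1) abG(2) abG(1)])
  then have "beta b a = 1" using cent[OF ab(1)] beta_A[OF i ab(1) ab(1)] by simp
  then show ?thesis unfolding ab(3) using sq_add[OF abG] sq_D[OF A_D[OF i ab(1)]] sq_D[OF ab(2)]
    by (simp add: beta_commute)
qed

lemma N1_trivial: assumes "z \<in> N1" "g \<in> G" shows "beta z g = 1" "sq z = 1"
proof -
  have eN: "beta n g = 1" "sq n = 1" if n: "n \<in> N" for n
  proof -
    have "comm g n \<in> N" unfolding comm_def by (rule subgrp_diff[OF sN normal_in_conj[OF N assms(2) n] n])
    then show "beta n g = 1" using beta_commute[of n g] by (simp add: beta_def eps_eq_1)
    show "sq n = 1" using subgrp_add[OF sN n n] by (simp add: sq_def eps_eq_1)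
  qed
  have cG: "c \<in> G" by (rule in_G(1)[OF c(1)])
  have bc: "beta c g = 1" if "g \<in> G" for g using c_central[OF that] beta_commute[of c g] by (simp add: beta_def eps_eq_1)
  have ec: "beta (c + n) g = 1" "sq (c + n) = 1" if n: "n \<in> N" for n
  proof -
    have nG: "n \<in> G" using n N_G by auto
    show "beta (c + n) g = 1" using beta_add_left[OF cG nG assms(2)] eN(1)[OF n] bc[OF assms(2)] by simp
    have "sq c = 1" using c(3) by (simp add: sq_def eps_eq_1)
    then show "sq (c + n) = 1" using sq_add[OF cG nG] eN(2)[OF n] bc[OF nG] by simp
  qed
  have "z \<in> N \<or> (\<exists>n\<in>N. z = c + n)" using assms(1) by (auto simp: N1_def)
  then show "beta z g = 1" "sq z = 1" using eN ec by auto
qed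

text \<open>Together with \<open>N1_trivial\<close> this describes \<open>N1\<close> as the part of
  \<open>U\<close> in the radical of \<open>beta\<close> on which \<open>sq\<close> is
  trivial.\<close>

lemma N1_I:
  assumes "z \<in> U" "\<And>g. g \<in> G \<Longrightarrow> beta z g = 1" "sq z = 1"
  shows "z \<in> N1"
  unfolding N1_def
proof (rule unique[OF assms(1)])
  show "comm g z \<in> N" if "g \<in> G" for g
    using assms(2)[OF that] beta_commute[of z g] by (metis beta_def eps_eq_1)
  show "z + z \<in> N" using assms(3) by (simp add: sq_def eps_eq_1)
qed

lemma beta_nontrivial: obtains x y where "x \<in> G" "y \<in> G" "beta x y = - 1"
  using nonabelian that by (auto simp: beta_def eps_def)

end

section \<open>The kernel of symmetries is central\<close>

lemma sum_subgrp_translate: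
  fixes H :: "'a::group_add set"
  assumes "subgrp H" "h \<in> H"
  shows "(\<Sum>x\<in>H. f (h + x)) = (\<Sum>x\<in>H. f x)"
  by (rule sum.reindex_bij_witness[where i = "\<lambda>x. - h + x" and j = "\<lambda>x. h + x"])
     (use subgrp_add[OF assms(1)] subgrp_minus[OF assms(1)] assms(2) in auto)

context as_reduction
begin

text \<open>Orthogonality for the character \<open>beta x\<close> of \<open>H\<close>.\<close>

lemma sum_beta:
  assumes H: "subgrp H" "H \<subseteq> G" and x: "x \<in> G"
  shows "(\<Sum>h\<in>H. beta x h) = (if \<forall>h\<in>H. beta x h = 1 then int (card H) else 0)"
proof (cases "\<forall>h\<in>H. beta x h = 1")
  case True
  then show ?thesis by simp
next
  case False
  then obtain k where k: "k \<in> H" "beta x k = - 1" using beta_values by blast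
  have "(\<Sum>h\<in>H. beta x h) = (\<Sum>h\<in>H. beta x (k + h))"
    by (rule sum_subgrp_translate[OF H(1) k(1), symmetric])
  also have "\<dots> = (\<Sum>h\<in>H. - beta x h)"
  proof (rule sum.cong)
    fix h assume "h \<in> H"
    then have "beta x (k + h) = beta x k * beta x h" using beta_add_right[OF _ _ x] k(1) H(2) by blast
    then show "beta x (k + h) = - beta x h" using k(2) by simp
  qed simp
  also have "\<dots> = - (\<Sum>h\<in>H. beta x h)" by (rule sum_negf)
  finally show ?thesis using False by auto
qed

text \<open>The square of the character sum is evaluated by the difference set equation
  \<open>sum_D_D\<close>. A nontrivial character sums to 0 over \<open>G\<close> and to a
  nonnegative value over \<open>U\<close>, which leaves at most \<open>q\<^sup>2\<close>.\<close>

lemma sum_beta_D_bound: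
  assumes x: "x \<in> G" and nontriv: "\<exists>g\<in>G. beta x g \<noteq> 1"
  shows "\<bar>\<Sum>d\<in>D. beta x d\<bar> \<le> int q"
proof -
  have "(\<Sum>d\<in>D. beta x d)\<^sup>2 = (\<Sum>d\<in>D. \<Sum>e\<in>D. beta x d * beta x e)"
    by (simp add: power2_eq_square sum_product)
  also have "\<dots> = (\<Sum>d\<in>D. \<Sum>e\<in>D. beta x (d + e))"
    by (intro sum.cong refl beta_add_right[symmetric]) (use x in_G(3) in auto)
  also have "\<dots> = (int q)\<^sup>2 * beta x 0 + int q * ((\<Sum>g\<in>G. beta x g) - (\<Sum>u\<in>U. beta x u))"
    by (rule sum_D_D)
  also have "\<dots> \<le> (int q)\<^sup>2"
  proof -
    have "(\<Sum>g\<in>G. beta x g) = 0" using sum_beta[OF G order_refl x] nontriv by auto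
    moreover have "(\<Sum>u\<in>U. beta x u) \<ge> 0" using sum_beta[OF sU U_G x] by simp
    ultimately show ?thesis by (simp add: beta_0)
  qed
  finally have "\<bar>\<Sum>d\<in>D. beta x d\<bar> \<le> \<bar>int q\<bar>" by (simp only: abs_le_square_iff)
  then show ?thesis by simp
qed

text \<open>If \<open>beta\<close> were trivial between \<open>U\<close> and \<open>D\<close>, it
  would be trivial on \<open>U\<close> as well, because for \<open>v\<close> in \<open>U\<close> and
  a nonzero \<open>d\<close> in \<open>D\<close> the element \<open>d + v\<close> is again a sum of
  two elements of \<open>D\<close>. Then \<open>u\<close> would be central modulo \<open>N\<close>,
  as \<open>G\<close> is \<open>D + U\<close>.\<close>

lemma exists_noncentralizing:
  assumes u: "u \<in> U" and g: "g \<in> G" and ne: "beta u g = - 1"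
  obtains i a v where "i \<in> J" "a \<in> A i" "v \<in> U" "beta v a = - 1"
proof -
  have False if triv: "\<And>d v. d \<in> D \<Longrightarrow> v \<in> U \<Longrightarrow> beta v d = 1"
  proof -
    have UU: "beta u v = 1" if v: "v \<in> U" for v
    proof -
      obtain i where i: "i \<in> J" using card_J by fastforce
      obtain d where d: "d \<in> A i" "d \<noteq> 0" using exists_nonzero[OF i] .
      have dD: "d \<in> D" by (rule A_D[OF i d(1)])
      have "d \<notin> U" using A_U[OF i d(1)] d(2) by auto
      then have nU: "d + v \<notin> U" using subgrp_add_right_iff[OF sU v] by simp
      have dvG: "d + v \<in> G" by (rule G_closed(1)[OF in_G(3)[OF dD] in_G(1)[OF v]])
      have "{p \<in> D \<times> D. fst p + snd p = d + v} \<noteq> {}"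
        using card_D_D[OF dvG nU] q_ge_2 by (metis card.empty not_numeral_le_zero)
      then obtain e f where ef: "e \<in> D" "f \<in> D" "d + v = e + f" by auto
      have "beta u d * beta u v = beta u (e + f)"
        using beta_add_right[OF in_G(3)[OF dD] in_G(1)[OF v] in_G(1)[OF u]] ef(3) by simp
      also have "\<dots> = 1" using beta_add_right[of e f u] in_G ef u triv by simp
      finally show ?thesis using triv[OF dD u] by simp
    qed
    obtain d v where dv: "d \<in> D" "v \<in> U" "g = d + v" using decompose[OF g] .
    have "beta u g = 1" unfolding dv(3) using beta_add_right[of d v u] in_G dv u triv UU by simp
    then show False using ne by simp
  qed
  then obtain d v where dv: "d \<in> D" "v \<in> U" "beta v d \<noteq> 1" by blast
  obtain i where "i \<in> J" "d \<in> A i" using D_E[OF dv(1)] .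
  then show ?thesis using that dv beta_values by blast
qed

lemma card_T_le: assumes i: "i \<in> J" shows "card (T i) \<le> q\<^sup>2" "finite (T i)"
proof -
  have e: "T i = (\<lambda>(a, u). a + u) ` (A i \<times> U)" by (auto simp: T_def)
  show "finite (T i)" unfolding e using fin_A[OF i] fin_U by simp
  show "card (T i) \<le> q\<^sup>2"
    unfolding e using card_image_le[of "A i \<times> U" "\<lambda>(a, u). a + u"] fin_A[OF i] fin_U
    by (simp add: card_cartesian_product card_A[OF i] card_U power2_eq_square)
qed

text \<open>Double counting of \<open>beta a g\<close> over \<open>A i\<close> and \<open>G\<close>.
  Summing over \<open>G\<close> first, \<open>a = 0\<close> gives \<open>q ^ 3\<close> and the other
  terms are not negative; summing over \<open>A i\<close> first gives \<open>q\<close> times the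
  size of the centralizer.\<close>

lemma centralizer_A_large:
  assumes i: "i \<in> J"
  shows "q\<^sup>2 \<le> card {g \<in> G. \<forall>a\<in>A i. beta g a = 1}" (is "_ \<le> card ?L")
proof -
  have z: "0 \<in> A i" using A[OF i] by (rule subgrp_zero)
  have "int q ^ 3 = (\<Sum>g\<in>G. beta 0 g)" by (simp add: beta_0 card_G)
  also have "\<dots> \<le> (\<Sum>a\<in>A i. \<Sum>g\<in>G. beta a g)"
    using sum_beta[OF G order_refl in_G(2)[OF i]]
    by (intro member_le_sum[OF z _ fin_A[OF i], of "\<lambda>a. \<Sum>g\<in>G. beta a g"]) auto
  also have "\<dots> = (\<Sum>g\<in>G. \<Sum>a\<in>A i. beta g a)"
    by (subst sum.swap) (simp add: beta_commute)
  also have "\<dots> = (\<Sum>g\<in>G. if \<forall>a\<in>A i. beta g a = 1 then int q else 0)"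
    by (intro sum.cong refl) (simp add: sum_beta[OF A[OF i] A_G[OF i]] card_A[OF i])
  also have "\<dots> = int q * int (card ?L)"
    using fin_G by (simp add: sum.If_cases Int_def)
  finally have "int (q ^ 3) \<le> int (q * card ?L)" by simp
  then have "q ^ 3 \<le> q * card ?L" by linarith
  then have "q * q\<^sup>2 \<le> q * card ?L" by (simp add: power3_eq_cube power2_eq_square)
  then show ?thesis using q_ge_2 by simp
qed

text \<open>The centralizer of \<open>A i\<close> modulo \<open>N\<close> has at least
  \<open>q\<^sup>2\<close> elements and misses some \<open>v\<close> in \<open>U\<close>, whereas
  \<open>T i\<close> has at most \<open>q\<^sup>2\<close> elements and contains \<open>v\<close>. So
  some \<open>h\<close> centralizing \<open>A i\<close> is outside \<open>T i\<close>. One of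
  \<open>z\<close> and \<open>h + z\<close> is then outside \<open>T i\<close> too, and
  \<open>sq_centralizer_A\<close> applies to it.\<close>

lemma sq_center:
  assumes u: "u \<in> U" and g: "g \<in> G" and ne: "beta u g = - 1"
    and z: "z \<in> G" "\<And>g. g \<in> G \<Longrightarrow> beta z g = 1"
  shows "sq z = 1"
proof -
  obtain i a v where i: "i \<in> J" and a: "a \<in> A i" and v: "v \<in> U" and av: "beta v a = - 1"
    using exists_noncentralizing[OF u g ne] .
  let ?L = "{g \<in> G. \<forall>a\<in>A i. beta g a = 1}"
  have "\<not> ?L \<subseteq> T i"
  proof
    assume sub: "?L \<subseteq> T i"
    moreover have "v \<in> T i" "v \<notin> ?L" using U_T[OF i v] av a by (auto intro!: bexI[of _ a])
    ultimately have "card ?L < card (T i)" using card_T_le(2)[OF i] by (intro psubset_card_mono) auto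
    then show False using card_T_le(1)[OF i] centralizer_A_large[OF i] by simp
  qed
  then obtain h where h: "h \<in> G" "h \<notin> T i" "\<And>a. a \<in> A i \<Longrightarrow> beta h a = 1" by blast
  have sh: "sq h = 1" by (rule sq_centralizer_A[OF i h])
  show ?thesis
  proof (cases "z \<in> T i")
    case True
    then have "h + z \<notin> T i" using subgrp_add_right_iff[OF T_subgrp[OF i]] h(2) by simp
    moreover have "beta (h + z) a = 1" if "a \<in> A i" for a
      using beta_add_left[OF h(1) z(1)] h(3) z(2) in_G(2)[OF i] that by simp
    ultimately have "sq (h + z) = 1" using sq_centralizer_A[OF i] G_closed(1)[OF h(1) z(1)] by blast
    then show ?thesis using sq_add[OF h(1) z(1)] sh z(2)[OF h(1)] beta_commute[of h z] by simp
  next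
    case False
    then show ?thesis using sq_centralizer_A[OF i z(1)] z(2) in_G(2)[OF i] by blast
  qed
qed

text \<open>Substituting \<open>v + g\<close> for \<open>g\<close> produces the character
  \<open>beta v\<close>. Then \<open>G\<close> is split as \<open>D + U\<close>; \<open>sq\<close>
  is 1 on \<open>D\<close>, and the cross term \<open>beta d u\<close> is absorbed into
  \<open>beta (v + u) d\<close>.\<close>

lemma sum_sq_beta:
  assumes v: "v \<in> G"
  shows "sq v * (\<Sum>g\<in>G. sq g) = (\<Sum>u\<in>U. sq u * beta v u * (\<Sum>d\<in>D. beta (v + u) d))"
proof -
  have "sq v * (\<Sum>g\<in>G. sq g) = sq v * (\<Sum>g\<in>G. sq (v + g))"
    by (simp add: sum_subgrp_translate[OF G v])
  also have "\<dots> = sq v * (\<Sum>g\<in>G. sq v * (sq g * beta v g))"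
    using sq_add[OF v] by (simp add: mult.assoc)
  also have "\<dots> = (\<Sum>g\<in>G. sq g * beta v g)"
  proof -
    have "sq v * (sq v * x) = x" for x using sq_sq[of v] by (simp flip: mult.assoc)
    then show ?thesis by (simp flip: sum_distrib_left)
  qed
  also have "\<dots> = (\<Sum>d\<in>D. \<Sum>u\<in>U. sq (d + u) * beta v (d + u))" by (rule sum_G)
  also have "\<dots> = (\<Sum>u\<in>U. \<Sum>d\<in>D. sq (d + u) * beta v (d + u))" by (rule sum.swap)
  also have "\<dots> = (\<Sum>u\<in>U. \<Sum>d\<in>D. sq u * beta v u * beta (v + u) d)"
  proof (intro sum.cong refl)
    fix u d assume u: "u \<in> U" and d: "d \<in> D"
    have uG: "u \<in> G" and dG: "d \<in> G" using u d in_G by auto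
    show "sq (d + u) * beta v (d + u) = sq u * beta v u * beta (v + u) d"
      using sq_add[OF dG uG] beta_add_right[OF dG uG v] beta_add_left[OF v uG dG] sq_D[OF d]
        beta_commute[of d u] by simp
  qed
  also have "\<dots> = (\<Sum>u\<in>U. sq u * beta v u * (\<Sum>d\<in>D. beta (v + u) d))"
    by (simp add: sum_distrib_left)
  finally show ?thesis .
qed

text \<open>Otherwise \<open>sq\<close> has, by the previous formula for \<open>v = 0\<close>, a sum over \<open>G\<close> of size about \<open>card N1 * q\<^sup>2\<close>, whereas the
  same formula for a \<open>v\<close> that is not central modulo \<open>U\<close> bounds it by \<open>q\<^sup>2\<close>.\<close>

lemma U_central:
  assumes u: "u \<in> U" and g: "g \<in> G"
  shows "beta u g = 1"
proof (rule ccontr)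
  assume "beta u g \<noteq> 1"
  then have ne: "beta u g = - 1" using beta_values by blast
  have centre: "z \<in> N1" if "z \<in> U" "\<And>g. g \<in> G \<Longrightarrow> beta z g = 1" for z
    using N1_I[OF that(1,2)] sq_center[OF u g ne in_G(1)[OF that(1)] that(2)] by blast
  let ?S = "\<Sum>g\<in>G. sq g"
  let ?L = "\<lambda>x. \<Sum>d\<in>D. beta x d"
  have L_N1: "?L z = (int q)\<^sup>2" if "z \<in> N1" for z
    using N1_trivial(1)[OF that] in_G(3) by (simp add: card_D)
  have L_bound: "\<bar>?L x\<bar> \<le> int q" if "x \<in> G" "\<exists>g\<in>G. beta x g \<noteq> 1" for x
    by (rule sum_beta_D_bound[OF that])
  have N1_sub: "N1 \<subseteq> U" using N1_U by auto
  have cN: "card N1 \<le> q" using card_mono[OF fin_U N1_sub] card_U by simp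
  have s0: "sq 0 = 1" using sq_D[OF zero_D] .
  \<comment> \<open>The formula with \<open>v = 0\<close>: each element of \<open>N1\<close>
    contributes the full \<open>q\<^sup>2\<close>. At the other elements of \<open>U\<close> the
    character sums have absolute value at most \<open>q\<close>.\<close>
  have split: "?S = int (card N1) * (int q)\<^sup>2 + (\<Sum>u\<in>U - N1. sq u * ?L u)"
  proof -
    have "?S = (\<Sum>u\<in>U. sq u * ?L u)" using sum_sq_beta[OF G_closed(4)] by (simp add: s0 beta_0)
    also have "\<dots> = (\<Sum>u\<in>U - N1. sq u * ?L u) + (\<Sum>u\<in>N1. sq u * ?L u)"
      by (rule sum.subset_diff[OF N1_sub fin_U])
    also have "(\<Sum>u\<in>N1. sq u * ?L u) = (\<Sum>u\<in>N1. (int q)\<^sup>2)"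
      by (intro sum.cong refl) (use N1_trivial(2)[OF _ g] L_N1 in simp)
    finally show ?thesis by simp
  qed
  have rest: "\<bar>\<Sum>u\<in>U - N1. sq u * ?L u\<bar> \<le> (int q - int (card N1)) * int q"
  proof -
    have "\<bar>\<Sum>u\<in>U - N1. sq u * ?L u\<bar> \<le> (\<Sum>u\<in>U - N1. \<bar>sq u * ?L u\<bar>)" by (rule sum_abs)
    also have "\<dots> \<le> (\<Sum>u\<in>U - N1. int q)"
    proof (rule sum_mono)
      fix w assume w: "w \<in> U - N1"
      then have "\<exists>g\<in>G. beta w g \<noteq> 1" using centre by blast
      then have "\<bar>?L w\<bar> \<le> int q" using L_bound[of w] in_G(1) w by blast
      moreover have "\<bar>sq w\<bar> = 1" using sq_values[of w] by auto
      ultimately show "\<bar>sq w * ?L w\<bar> \<le> int q" by (simp add: abs_mult)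
    qed
    also have "\<dots> = int (card U - card N1) * int q"
      using card_Diff_subset[OF fin_N1 N1_sub] by simp
    finally show ?thesis using cN by (simp add: card_U of_nat_diff)
  qed
  define K where "K = int (card N1)"
  define Q where "Q = int q"
  have K: "2 \<le> K" "K \<le> Q" using card_N1 cN by (auto simp: K_def Q_def)
  have rest': "\<bar>?S - K * Q\<^sup>2\<bar> \<le> (Q - K) * Q" using split rest by (simp add: K_def Q_def)
  \<comment> \<open>If some coset \<open>v + U\<close> has no element central modulo
    \<open>N\<close>, all character sums in the formula for \<open>v\<close> are at most
    \<open>q\<close> in absolute value, so \<open>?S\<close> is at most \<open>Q\<^sup>2\<close>,
    too small for \<open>K \<ge> 2\<close>.\<close>
  show False
  proof (cases "\<exists>v\<in>G. \<forall>w\<in>U. \<exists>g\<in>G. beta (v + w) g \<noteq> 1")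
    case True
    then obtain v where v: "v \<in> G" "\<And>w. w \<in> U \<Longrightarrow> \<exists>g\<in>G. beta (v + w) g \<noteq> 1" by blast
    have "\<bar>?S\<bar> = \<bar>sq v * ?S\<bar>" using sq_values[of v] by (auto simp: abs_mult)
    also have "\<dots> \<le> (\<Sum>w\<in>U. \<bar>sq w * beta v w * ?L (v + w)\<bar>)"
      unfolding sum_sq_beta[OF v(1)] by (rule sum_abs)
    also have "\<dots> \<le> (\<Sum>w\<in>U. int q)"
    proof (rule sum_mono)
      fix w assume w: "w \<in> U"
      have "\<bar>?L (v + w)\<bar> \<le> int q" by (rule L_bound[OF G_closed(1)[OF v(1) in_G(1)[OF w]] v(2)[OF w]])
      moreover have "\<bar>sq w * beta v w\<bar> = 1" using sq_values[of w] beta_values[of v w] by auto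
      ultimately show "\<bar>sq w * beta v w * ?L (v + w)\<bar> \<le> int q" by (simp add: abs_mult)
    qed
    also have "\<dots> = Q\<^sup>2" by (simp add: card_U Q_def power2_eq_square)
    finally have "?S \<le> Q\<^sup>2" by simp
    then have "K * Q\<^sup>2 \<le> Q\<^sup>2 + (Q - K) * Q" using rest' by linarith
    then have "K * (Q\<^sup>2 + Q) \<le> 2 * Q\<^sup>2" by (simp add: algebra_simps power2_eq_square)
    moreover have "2 * (Q\<^sup>2 + Q) \<le> K * (Q\<^sup>2 + Q)" using K by (intro mult_right_mono) auto
    ultimately show False using K by simp
  next
    case False
    \<comment> \<open>Now every coset of \<open>U\<close> contains an element central modulo
      \<open>N\<close>, at which \<open>sq\<close> is 1 by \<open>sq_center\<close>. Hence the sums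
      of \<open>sq\<close> over all cosets of \<open>U\<close> agree.\<close>
    define sigma where "sigma = (\<Sum>w\<in>U. sq w)"
    have "?S = (\<Sum>d\<in>D. \<Sum>w\<in>U. sq (d + w))" by (rule sum_G)
    also have "\<dots> = (\<Sum>d\<in>D. sigma)"
    proof (rule sum.cong)
      fix d assume d: "d \<in> D"
      have dG: "d \<in> G" using d in_G by auto
      obtain w where w: "w \<in> U" "\<And>g. g \<in> G \<Longrightarrow> beta (d + w) g = 1" using False dG by blast
      have dwG: "d + w \<in> G" by (rule G_closed(1)[OF dG in_G(1)[OF w(1)]])
      have "(\<Sum>x\<in>U. sq (d + x)) = (\<Sum>x\<in>U. sq (d + (w + x)))"
        by (rule sum_subgrp_translate[OF sU w(1), symmetric])
      also have "\<dots> = (\<Sum>x\<in>U. sq x)"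
      proof (rule sum.cong)
        fix x assume x: "x \<in> U"
        have "sq ((d + w) + x) = sq (d + w) * sq x * beta (d + w) x" by (rule sq_add[OF dwG in_G(1)[OF x]])
        then show "sq (d + (w + x)) = sq x"
          using sq_center[OF u g ne dwG w(2)] w(2)[OF in_G(1)[OF x]] by (simp add: add.assoc)
      qed simp
      finally show "(\<Sum>x\<in>U. sq (d + x)) = sigma" by (simp add: sigma_def)
    qed simp
    finally have S: "?S = Q\<^sup>2 * sigma" by (simp add: card_D Q_def)
    \<comment> \<open>\<open>?S\<close> is a multiple of \<open>Q\<^sup>2\<close> at distance less
      than \<open>Q\<^sup>2\<close> from \<open>K * Q\<^sup>2\<close>, so the two are equal.\<close>
    have "Q\<^sup>2 * \<bar>sigma - K\<bar> = \<bar>?S - K * Q\<^sup>2\<bar>"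
    proof -
      have "\<bar>?S - K * Q\<^sup>2\<bar> = \<bar>Q\<^sup>2 * (sigma - K)\<bar>" unfolding S by (simp add: algebra_simps)
      then show ?thesis by (simp add: abs_mult)
    qed
    also have "\<dots> \<le> (Q - K) * Q" by (rule rest')
    also have "\<dots> < Q\<^sup>2" using K by (simp add: power2_eq_square)
    finally have "\<bar>sigma - K\<bar> < 1" using K by (simp add: power2_eq_square)
    then have sK: "sigma = K" by simp
    \<comment> \<open>The square of a quadratic Gauss sum: \<open>beta\<close> has radical
      \<open>N1\<close> on \<open>U\<close>, and \<open>sq\<close> is 1 there, so the value is
      \<open>K * Q\<close>. With \<open>sigma = K\<close> this makes \<open>N1\<close> all of
      \<open>U\<close>, against \<open>beta u g = - 1\<close>.\<close>
    have "sigma\<^sup>2 = (\<Sum>x\<in>U. \<Sum>y\<in>U. sq x * sq y)"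
      by (simp add: sigma_def power2_eq_square sum_product)
    also have "\<dots> = (\<Sum>x\<in>U. \<Sum>y\<in>U. sq x * sq (x + y))"
    proof (rule sum.cong)
      fix x assume "x \<in> U"
      then show "(\<Sum>y\<in>U. sq x * sq y) = (\<Sum>y\<in>U. sq x * sq (x + y))"
        using sum_subgrp_translate[OF sU, of x "\<lambda>y. sq x * sq y"] by simp
    qed simp
    also have "\<dots> = (\<Sum>x\<in>U. \<Sum>y\<in>U. sq y * beta y x)"
    proof (intro sum.cong refl)
      fix x y assume "x \<in> U" "y \<in> U"
      then have "sq x * sq (x + y) = (sq x * sq x) * sq y * beta x y" using sq_add[of x y] in_G(1) by simp
      then show "sq x * sq (x + y) = sq y * beta y x" by (simp add: sq_sq beta_commute)
    qed
    also have "\<dots> = (\<Sum>y\<in>U. sq y * (\<Sum>x\<in>U. beta y x))"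
      by (subst sum.swap) (simp add: sum_distrib_left)
    also have "\<dots> = (\<Sum>y\<in>U. if y \<in> N1 then Q else 0)"
    proof (rule sum.cong)
      fix y assume y: "y \<in> U"
      \<comment> \<open>As each coset of \<open>U\<close> contains an element central modulo
        \<open>N\<close>, triviality of \<open>beta y\<close> on \<open>U\<close> spreads to
        \<open>G\<close>.\<close>
      have iff: "(\<forall>x\<in>U. beta y x = 1) \<longleftrightarrow> y \<in> N1"
      proof
        assume triv: "\<forall>x\<in>U. beta y x = 1"
        show "y \<in> N1"
        proof (rule centre[OF y])
          fix x assume x: "x \<in> G"
          obtain w where w: "w \<in> U" "\<And>g. g \<in> G \<Longrightarrow> beta (x + w) g = 1" using False x by blast
          have "beta y (x + w) = 1" using w(2)[OF in_G(1)[OF y]] beta_commute by metis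
          then show "beta y x = 1"
            using beta_add_right[OF x in_G(1)[OF w(1)] in_G(1)[OF y]] triv w(1) by simp
        qed
      next
        assume "y \<in> N1" then show "\<forall>x\<in>U. beta y x = 1" using N1_trivial(1) in_G(1) by blast
      qed
      show "sq y * (\<Sum>x\<in>U. beta y x) = (if y \<in> N1 then Q else 0)"
        using sum_beta[OF sU U_G in_G(1)[OF y]] N1_trivial(2)[OF _ g, of y]
        by (simp add: iff card_U Q_def)
    qed simp
    also have "\<dots> = K * Q"
      using N1_sub fin_U by (simp add: sum.If_cases Int_absorb1 K_def)
    finally have "K * K = K * Q" unfolding sK by (simp add: power2_eq_square)
    then have "card N1 = card U" using K by (simp add: K_def Q_def card_U)
    then have "N1 = U" using N1_sub fin_U by (intro card_subset_eq)
    then show False using N1_trivial(1)[of u g] u g ne by simp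
  qed
qed

end

section \<open>Gauss sums\<close>

text \<open>The descent divides all the Gaussian integers \<open>x k + \<i> y k\<close> by \<open>1 + \<i>\<close>, up to conjugation.\<close>

lemma odd_sum_equal_norm:
  fixes x y :: "'k \<Rightarrow> int"
  assumes "finite K" "odd (card K)" "n > 0" "\<And>k. k \<in> K \<Longrightarrow> (x k)\<^sup>2 + (y k)\<^sup>2 = int n"
  shows "(\<Sum>k\<in>K. x k) \<noteq> 0 \<or> (\<Sum>k\<in>K. y k) \<noteq> 0"
  using assms(3,4)
proof (induction n arbitrary: x y rule: less_induct)
  case (less n)
  have par: "even (x k + y k) \<longleftrightarrow> even n" if "k \<in> K" for k
    using less.prems(2)[OF that] by (metis even_add even_of_nat even_power pos2)
  show ?case
  proof (cases "even n")
    \<comment> \<open>For odd \<open>n\<close> every \<open>x k + y k\<close> is odd, and an odd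
      number of odd integers has a nonzero sum.\<close>
    case False
    have "odd (\<Sum>k\<in>K. x k + y k)"
    proof -
      have "odd (\<Sum>k\<in>L. x k + y k) \<longleftrightarrow> odd (card L)" if "L \<subseteq> K" "finite L" for L
        using that(2,1) by (induction L rule: finite_induct) (use par False in auto)
      then show ?thesis using assms(1,2) by blast
    qed
    then show ?thesis by (auto simp: sum.distrib)
  next
    case True
    define x' where "x' k = (x k + y k) div 2" for k
    define y' where "y' k = (x k - y k) div 2" for k
    have ev: "2 * x' k = x k + y k" "2 * y' k = x k - y k" if "k \<in> K" for k
      using par[OF that] True by (auto simp: x'_def y'_def)
    have "(x' k)\<^sup>2 + (y' k)\<^sup>2 = int (n div 2)" if k: "k \<in> K" for k
    proof -
      have "4 * ((x' k)\<^sup>2 + (y' k)\<^sup>2) = (2 * x' k)\<^sup>2 + (2 * y' k)\<^sup>2" by (simp add: power2_eq_square)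
      also have "\<dots> = 2 * ((x k)\<^sup>2 + (y k)\<^sup>2)"
        unfolding ev[OF k] by (simp add: power2_eq_square algebra_simps)
      also have "\<dots> = 4 * int (n div 2)" using less.prems(2)[OF k] True by auto
      finally show ?thesis by simp
    qed
    moreover have "n div 2 < n" "n div 2 > 0" using less.prems(1) True by auto
    ultimately have "(\<Sum>k\<in>K. x' k) \<noteq> 0 \<or> (\<Sum>k\<in>K. y' k) \<noteq> 0" using less.IH[of "n div 2" x' y'] by simp
    moreover have "2 * (\<Sum>k\<in>K. x' k) = (\<Sum>k\<in>K. x k) + (\<Sum>k\<in>K. y k)"
      "2 * (\<Sum>k\<in>K. y' k) = (\<Sum>k\<in>K. x k) - (\<Sum>k\<in>K. y k)"
      by (simp_all add: sum_distrib_left ev sum.distrib sum_subtractf)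
    ultimately show ?thesis by auto
  qed
qed

section \<open>The centralizers of the \<open>A i\<close> and the character of
  \<open>U / N\<close>\<close>

context as_reduction
begin

lemma beta_U: "u \<in> U \<Longrightarrow> g \<in> G \<Longrightarrow> beta u g = 1" "u \<in> U \<Longrightarrow> g \<in> G \<Longrightarrow> beta g u = 1"
  using U_central beta_commute by metis+

lemma sq_U_add: "u \<in> U \<Longrightarrow> v \<in> U \<Longrightarrow> sq (u + v) = sq u * sq v"
  using sq_add[OF in_G(1) in_G(1), of u v] beta_U(1)[of u v] in_G(1) by simp

text \<open>As \<open>U\<close> is central modulo \<open>N\<close>, a pair with \<open>beta\<close>
  equal to -1 may be replaced by its components \<open>d\<close>, \<open>e\<close> in
  \<open>D\<close>. Then \<open>sq (d + e) = - 1\<close>, and the component of \<open>d + e\<close>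
  in \<open>U\<close> has the same value.\<close>

lemma exists_sq_neg: "\<exists>u\<in>U. sq u = - 1"
proof -
  obtain x y where xy: "x \<in> G" "y \<in> G" "beta x y = - 1" using beta_nontrivial .
  obtain d u where du: "d \<in> D" "u \<in> U" "x = d + u" using decompose[OF xy(1)] .
  obtain e v where ev: "e \<in> D" "v \<in> U" "y = e + v" using decompose[OF xy(2)] .
  have dG: "d \<in> G" and eG: "e \<in> G" and uG: "u \<in> G" and vG: "v \<in> G" using du ev in_G by auto
  have "beta x y = beta d y" unfolding du(3) using beta_add_left[OF dG uG xy(2)] beta_U du(2) xy(2) by simp
  also have "\<dots> = beta d e" unfolding ev(3) using beta_add_right[OF eG vG dG] beta_U ev(2) dG by simp
  finally have "sq (d + e) = - 1" using sq_add[OF dG eG] sq_D du ev xy(3) by simp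
  moreover obtain f w where fw: "f \<in> D" "w \<in> U" "d + e = f + w" using decompose[OF G_closed(1)[OF dG eG]] .
  ultimately have "sq w = - 1" using sq_add[of f w] sq_D[OF fw(1)] beta_U(2)[OF fw(2)] in_G fw by simp
  then show ?thesis using fw(2) by blast
qed

definition u0 :: 'a where "u0 = (SOME u. u \<in> U \<and> sq u = - 1)"

lemma u0: "u0 \<in> U" "sq u0 = - 1"
  using someI_ex[of "\<lambda>u. u \<in> U \<and> sq u = - 1"] exists_sq_neg by (auto simp: u0_def)

text \<open>Otherwise \<open>g\<close> and \<open>g + u0\<close> both centralize \<open>A i\<close>
  and lie outside \<open>T i\<close>, so \<open>sq\<close> is 1 at both; but adding
  \<open>u0\<close> changes the sign of \<open>sq\<close>.\<close>

lemma centralizer_A_subset: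
  assumes i: "i \<in> J" and g: "g \<in> G" and cent: "\<And>a. a \<in> A i \<Longrightarrow> beta g a = 1"
  shows "g \<in> T i"
proof (rule ccontr)
  assume no: "g \<notin> T i"
  have uG: "u0 \<in> G" by (rule in_G(1)[OF u0(1)])
  have "sq g = 1" by (rule sq_centralizer_A[OF i g no cent])
  moreover have "sq (g + u0) = 1"
  proof (rule sq_centralizer_A[OF i G_closed(1)[OF g uG]])
    show "g + u0 \<notin> T i" using no subgrp_add_right_iff[OF T_subgrp[OF i] U_T[OF i u0(1)]] by simp
    show "beta (g + u0) a = 1" if "a \<in> A i" for a
      using beta_add_left[OF g uG in_G(2)[OF i that]] cent[OF that] beta_U(1)[OF u0(1) in_G(2)[OF i that]] by simp
  qed
  ultimately show False using sq_add[OF g uG] u0(2) beta_U(2)[OF u0(1) g] by simp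
qed

text \<open>\<open>U / N\<close> is cyclic of order 4; \<open>psi\<close> is a faithful character of it.\<close>

definition psi :: "'a \<Rightarrow> complex" where
  "psi u = (if sq u = 1 then of_int (eps u) else \<i> * of_int (eps (- u0 + u)))"

lemma N1_iff: "u \<in> U \<Longrightarrow> u \<in> N1 \<longleftrightarrow> sq u = 1"
  using N1_I[of u] N1_trivial(2)[OF _ G_closed(4), of u] beta_U(1) by blast

lemma minus_u0_N1:
  assumes u: "u \<in> U" "sq u = - 1" shows "- u0 + u \<in> N1"
proof -
  have mU: "- u0 \<in> U" by (rule subgrp_minus[OF sU u0(1)])
  have "sq (- u0) * sq u0 = sq 0" using sq_U_add[OF mU u0(1)] by simp
  then have "sq (- u0) = - 1" using u0(2) sq_D[OF zero_D] by simp
  then have "sq (- u0 + u) = 1" using sq_U_add[OF mU u(1)] u(2) by simp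
  then show ?thesis using N1_iff[OF subgrp_add[OF sU mU u(1)]] by simp
qed

lemma psi_N1: "u \<in> N1 \<Longrightarrow> psi u = of_int (eps u)"
  using N1_trivial(2)[OF _ G_closed(4)] by (simp add: psi_def)

lemma psi_add:
  assumes u: "u \<in> U" and v: "v \<in> U"
  shows "psi (u + v) = psi u * psi v"
proof -
  have uG: "u \<in> G" and u0G: "u0 \<in> G" using u u0 in_G by auto
  consider "sq u = 1" "sq v = 1" | "sq u = 1" "sq v = - 1" | "sq u = - 1" "sq v = 1" | "sq u = - 1" "sq v = - 1"
    using sq_values[of u] sq_values[of v] by blast
  then show ?thesis
  proof cases
    case 1
    then show ?thesis using u v eps_N1[of u v] N1_iff by (simp add: psi_def sq_U_add)
  next
    case 2
    have N: "u \<in> N1" using N1_iff[OF u] 2 by simp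
    have "- u0 + (u + v) = (- u0 + u - (- u0)) + (- u0 + v)"
      by (simp add: word_normalize del: add_uminus_conv_diff)
    moreover have "- u0 + u - (- u0) \<in> N1"
      by (rule normal_in_conj[OF N1_normal G_closed(3)[OF u0G] N])
    ultimately have "eps (- u0 + (u + v)) = eps (- u0 + u - (- u0)) * eps (- u0 + v)"
      using eps_N1 minus_u0_N1[OF v 2(2)] by simp
    then have "eps (- u0 + (u + v)) = eps u * eps (- u0 + v)"
      using eps_conj[OF G_closed(3)[OF u0G], of u] by simp
    then show ?thesis using 2 by (simp add: psi_def sq_U_add[OF u v])
  next
    case 3
    have "eps (- u0 + (u + v)) = eps (- u0 + u) * eps v"
      using eps_N1[OF minus_u0_N1[OF u 3(1)], of v] N1_iff[OF v] 3 by (simp add: add.assoc)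
    then show ?thesis using 3 by (simp add: psi_def sq_U_add[OF u v])
  next
    case 4
    \<comment> \<open>The rearrangement splits off \<open>u0 + u0\<close>, at which
      \<open>eps\<close> is -1; this accounts for the factor \<open>\<i> * \<i>\<close>.\<close>
    have "u + v = (u0 + (- u0 + u) - u0) + ((u0 + u0) + (- u0 + v))"
      by (simp add: word_normalize del: add_uminus_conv_diff)
    moreover have "u0 + (- u0 + u) - u0 \<in> N1"
      by (rule normal_in_conj[OF N1_normal u0G minus_u0_N1[OF u 4(1)]])
    moreover have "(u0 + u0) + (- u0 + v) \<in> N1"
      by (rule subgrp_add[OF N1 double_N1[OF u0G] minus_u0_N1[OF v 4(2)]])
    ultimately have "eps (u + v) = eps (u0 + (- u0 + u) - u0) * (eps (u0 + u0) * eps (- u0 + v))"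
      using eps_N1 double_N1[OF u0G] minus_u0_N1[OF v 4(2)] by metis
    also have "eps (u0 + u0) = - 1" using u0(2) by (simp add: sq_def)
    also have "eps (u0 + (- u0 + u) - u0) = eps (- u0 + u)" by (rule eps_conj[OF u0G])
    finally have "psi (u + v) = (\<i> * \<i>) * (of_int (eps (- u0 + u)) * of_int (eps (- u0 + v)))"
      using 4 by (simp add: psi_def sq_U_add[OF u v])
    then show ?thesis using 4 by (simp add: psi_def mult_ac)
  qed
qed

text \<open>Exchanging adjacent letters changes a word by a conjugate of their commutator. This lies
  in \<open>N1\<close>, where \<open>psi\<close> agrees with \<open>eps\<close>.\<close>

lemma psi_swap:
  assumes "p \<in> G" "x \<in> G" "y \<in> G" "r \<in> G" "p + x + y + r \<in> U"
  shows "p + y + x + r \<in> U" "psi (p + x + y + r) = of_int (beta x y) * psi (p + y + x + r)"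
proof -
  have e: "p + x + y + r = (p + comm x y - p) + (p + y + x + r)"
    by (simp add: comm_def word_normalize del: add_uminus_conv_diff)
  have N: "p + comm x y - p \<in> N1"
    by (rule normal_in_conj[OF N1_normal assms(1) comm_N1[OF assms(2,3)]])
  then have U': "p + comm x y - p \<in> U" by (rule N1_U)
  show U'': "p + y + x + r \<in> U" using assms(5) subgrp_add_left_iff[OF sU U'] e by metis
  have "psi (p + x + y + r) = psi (p + comm x y - p) * psi (p + y + x + r)"
    unfolding e by (rule psi_add[OF U' U''])
  also have "psi (p + comm x y - p) = of_int (beta x y)"
    using psi_N1[OF N] eps_conj[OF assms(1)] by (simp add: beta_def)
  finally show "psi (p + x + y + r) = of_int (beta x y) * psi (p + y + x + r)" .
qed

lemma psi_norm: "psi u * cnj (psi u) = 1"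
  using eps_values[of u] eps_values[of "- u0 + u"] by (auto simp: psi_def)

lemma psi_0: "psi 0 = 1"
  using psi_N1[OF subgrp_zero[OF N1]] by (simp add: eps_def subgrp_zero[OF sN])

lemma psi_Gaussian: obtains m n :: int where "psi u = Complex (of_int m) (of_int n)"
proof (cases "sq u = 1")
  case True
  show ?thesis by (rule that[of "eps u" 0]) (simp add: psi_def True complex_eq_iff)
next
  case False
  show ?thesis by (rule that[of 0 "eps (- u0 + u)"]) (simp add: psi_def False complex_eq_iff)
qed

text \<open>Translation by \<open>u0\<close> multiplies the sum by \<open>\<i>\<close>.\<close>

lemma sum_psi: "(\<Sum>u\<in>U. psi u) = 0"
proof -
  have "psi u0 = \<i>" using u0(2) by (simp add: psi_def eps_def subgrp_zero[OF sN])
  then have "(\<Sum>u\<in>U. psi u) = \<i> * (\<Sum>u\<in>U. psi u)"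
    using sum_subgrp_translate[OF sU u0(1), of psi] psi_add[OF u0(1)] by (simp add: sum_distrib_left)
  then have "(1 - \<i>) * (\<Sum>u\<in>U. psi u) = 0" by (simp add: algebra_simps)
  moreover have "1 - \<i> \<noteq> 0" by (simp add: complex_eq_iff)
  ultimately show ?thesis by simp
qed

section \<open>Gauss sums over triples\<close>

definition tri :: "'i \<Rightarrow> 'i \<Rightarrow> 'i \<Rightarrow> ('a \<times> 'a \<times> 'a) set" where
  "tri i k j = {(x, y, z). x \<in> A i \<and> y \<in> A k \<and> z \<in> A j \<and> x + y + z \<in> U}"

lemma zero_A: "i \<in> J \<Longrightarrow> 0 \<in> A i"
  using A by (rule subgrp_zero)

lemma zero_tri: "i \<in> J \<Longrightarrow> k \<in> J \<Longrightarrow> j \<in> J \<Longrightarrow> (0, 0, 0) \<in> tri i k j"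
  using zero_A subgrp_zero[OF sU] by (simp add: tri_def)

lemma fin_tri: "i \<in> J \<Longrightarrow> k \<in> J \<Longrightarrow> j \<in> J \<Longrightarrow> finite (tri i k j)"
  by (rule finite_subset[of _ "A i \<times> A k \<times> A j"]) (auto simp: tri_def fin_A)

text \<open>Moving \<open>x'\<close> to the left past \<open>y + z\<close> costs nothing, because
  \<open>x + y + z\<close> is in \<open>U\<close>, hence central modulo \<open>N\<close>, and
  \<open>x\<close> commutes with \<open>x'\<close>. Moving \<open>y'\<close> past \<open>z\<close>
  costs \<open>beta z y'\<close>. So \<open>psi\<close> of the sum is a quadratic function on the
  group of triples.\<close>

lemma tri_add:
  assumes i: "i \<in> J" and k: "k \<in> J" and j: "j \<in> J"
    and t: "(x, y, z) \<in> tri i k j" and t': "(x', y', z') \<in> tri i k j"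
  shows "(x + x', y + y', z + z') \<in> tri i k j"
    and "psi ((x + x') + (y + y') + (z + z')) = psi (x + y + z) * psi (x' + y' + z') * of_int (beta z y')"
proof -
  have m: "x \<in> A i" "y \<in> A k" "z \<in> A j" "x + y + z \<in> U" "x' \<in> A i" "y' \<in> A k" "z' \<in> A j" "x' + y' + z' \<in> U"
    using t t' by (auto simp: tri_def)
  have g: "x \<in> G" "y \<in> G" "z \<in> G" "x' \<in> G" "y' \<in> G" "z' \<in> G" using m in_G(2) i j k by auto
  have UU: "(x + y + z) + (x' + y' + z') \<in> U" by (rule subgrp_add[OF sU m(4,8)])
  have e1: "(x + y + z) + (x' + y' + z') = x + (y + z) + x' + (y' + z')" by (simp add: add.assoc)
  have yzG: "y + z \<in> G" "y' + z' \<in> G" "x + x' + y \<in> G" using g G_closed(1) by auto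
  have U1: "x + (y + z) + x' + (y' + z') \<in> U" using UU e1 by simp
  note s1 = psi_swap[OF g(1) yzG(1) g(4) yzG(2) U1]
  have "beta (x + (y + z)) x' = 1" using beta_U(1)[OF m(4) g(4)] by (simp add: add.assoc)
  then have b1: "beta (y + z) x' = 1"
    using beta_add_left[OF g(1) yzG(1) g(4)] beta_A[OF i m(1,5)] by simp
  have e2: "x + x' + (y + z) + (y' + z') = (x + x' + y) + z + y' + z'" by (simp add: add.assoc)
  have U2: "(x + x' + y) + z + y' + z' \<in> U" using s1(1) e2 by simp
  note s2 = psi_swap[OF yzG(3) g(3) g(5) g(6) U2]
  have e3: "(x + x' + y) + y' + z + z' = (x + x') + (y + y') + (z + z')" by (simp add: add.assoc)
  show "(x + x', y + y', z + z') \<in> tri i k j"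
    using s2(1) e3 m subgrp_add[OF A[OF i]] subgrp_add[OF A[OF j]] subgrp_add[OF A[OF k]]
    by (simp add: tri_def)
  have "psi (x + y + z) * psi (x' + y' + z') = psi ((x + x' + y) + z + y' + z')"
    using psi_add[OF m(4,8)] s1(2) b1 e1 e2 by simp
  also have "\<dots> = of_int (beta z y') * psi ((x + x') + (y + y') + (z + z'))"
    using s2(2) e3 by simp
  finally have "psi (x + y + z) * psi (x' + y' + z') * of_int (beta z y')
      = of_int (beta z y' * beta z y') * psi ((x + x') + (y + y') + (z + z'))" by simp
  then show "psi ((x + x') + (y + y') + (z + z')) = psi (x + y + z) * psi (x' + y' + z') * of_int (beta z y')"
    unfolding beta_sq by simp
qed

lemma tri_mid_zero:
  assumes i: "i \<in> J" and k: "k \<in> J" and j: "j \<in> J" and ne: "i \<noteq> k" "i \<noteq> j" "k \<noteq> j"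
    and t: "(x, y, z) \<in> tri i k j" and zero: "y = 0 \<or> z = 0"
  shows "x = 0" "y = 0" "z = 0"
proof -
  have m: "x \<in> A i" "y \<in> A k" "z \<in> A j" "x + y + z \<in> U" using t by (auto simp: tri_def)
  have xT: "x \<in> T i" by (rule A_subset_T[OF i m(1)])
  have "x + y + z \<in> T i" by (rule U_T[OF i m(4)])
  then have "y + z \<in> T i" using subgrp_add_left_iff[OF T_subgrp[OF i] xT] by (simp add: add.assoc)
  then have yz: "y = 0 \<and> z = 0" using zero A_T[OF i k ne(1) m(2)] A_T[OF i j ne(2) m(3)] by auto
  then show "y = 0" "z = 0" by auto
  show "x = 0" using A_U[OF i m(1)] m(4) yz by simp
qed

text \<open>Two triples with the same last entry \<open>z\<close> add up to one with last entry
  \<open>z + z = 0\<close>, which is the zero triple by \<open>tri_mid_zero\<close>; all entries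
  being their own negatives, the two agree. For existence, \<open>- z\<close> is decomposed along
  \<open>A i\<close>, \<open>A k\<close> and \<open>U\<close>.\<close>

lemma bij_tri:
  assumes i: "i \<in> J" and k: "k \<in> J" and j: "j \<in> J" and ne: "i \<noteq> k" "i \<noteq> j" "k \<noteq> j"
  shows "bij_betw (\<lambda>t. snd (snd t)) (tri i k j) (A j)"
proof -
  have "inj_on (\<lambda>t. snd (snd t)) (tri i k j)"
  proof (rule inj_onI)
    fix t t' assume t: "t \<in> tri i k j" "t' \<in> tri i k j" "snd (snd t) = snd (snd t')"
    obtain x y z where p: "t = (x, y, z)" by (cases t) auto
    obtain x' y' z' where p': "t' = (x', y', z')" by (cases t') auto
    have zz: "z' = z" using t(3) p p' by simp
    have m: "x \<in> A i" "y \<in> A k" "z \<in> A j" "x' \<in> A i" "y' \<in> A k" using t p p' by (auto simp: tri_def)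
    have "(x + x', y + y', z + z) \<in> tri i k j" using tri_add(1)[OF i k j] t(1,2) p p' zz by simp
    then have "x + x' = 0" "y + y' = 0"
      using tri_mid_zero[OF i k j ne, of "x + x'" "y + y'" "z + z"] A_double[OF j m(3)] by auto
    then have "x' = - x" "y' = - y" by (simp_all add: minus_unique)
    then have "x' = x" "y' = y" using D_minus A_D i k m by auto
    then show "t = t'" using p p' zz by simp
  qed
  moreover have "(\<lambda>t. snd (snd t)) ` tri i k j = A j"
  proof (intro set_eqI iffI)
    fix z assume z: "z \<in> A j"
    have zG: "z \<in> G" by (rule in_G(2)[OF j z])
    obtain x y u where h: "x \<in> A i" "y \<in> A k" "u \<in> U" "- z = x + y + u"
      using decompose2[OF i k ne(1) G_closed(3)[OF zG]] .
    have "x + y = - z - u" using h(4) by simp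
    then have "x + y + z = - z + - u + z" by simp
    also have "\<dots> \<in> U" by (rule U_conj'[OF zG subgrp_minus[OF sU h(3)]])
    finally have "(x, y, z) \<in> tri i k j" using h z by (simp add: tri_def)
    then show "z \<in> (\<lambda>t. snd (snd t)) ` tri i k j" by force
  qed (auto simp: tri_def)
  ultimately show ?thesis by (simp add: bij_betw_def)
qed

definition gauss :: "'i \<Rightarrow> 'i \<Rightarrow> 'i \<Rightarrow> complex" where
  "gauss i k j = (\<Sum>(x, y, z)\<in>tri i k j. psi (x + y + z))"

text \<open>The usual evaluation of the norm of a Gauss sum: after replacing \<open>t'\<close> by
  \<open>pl t t'\<close>, the sum over \<open>t\<close> becomes a character sum of
  \<open>beta y\<close> over \<open>A j\<close>, where \<open>y\<close> is the middle entry of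
  \<open>t'\<close>. It vanishes unless \<open>y\<close> centralizes \<open>A j\<close> modulo
  \<open>N\<close>, which by \<open>centralizer_A_subset\<close> puts \<open>y\<close> into
  \<open>T j\<close> and \<open>A k\<close>, so \<open>y = 0\<close>.\<close>

lemma gauss_norm:
  assumes i: "i \<in> J" and k: "k \<in> J" and j: "j \<in> J" and ne: "i \<noteq> k" "i \<noteq> j" "k \<noteq> j"
  shows "gauss i k j * cnj (gauss i k j) = of_nat q"
proof -
  define P where "P = (\<lambda>(x, y, z). psi (x + y + z))"
  define pl where "pl = (\<lambda>(x, y, z) (x', y', z'). (x + x', y + y', z + (z'::'a)) :: 'a \<times> 'a \<times> 'a)"
  let ?T = "tri i k j"
  have gauss: "gauss i k j = (\<Sum>t\<in>?T. P t)" by (simp add: gauss_def P_def)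
  have pl_in: "pl t t' \<in> ?T" if "t \<in> ?T" "t' \<in> ?T" for t t'
    using that tri_add(1)[OF i k j] by (cases t; cases t') (auto simp: pl_def)
  have pl_pl: "pl t (pl t t') = t'" if "t \<in> ?T" for t t'
  proof -
    obtain x y z where p: "t = (x, y, z)" by (cases t) auto
    then have "x + x = 0" "y + y = 0" "z + z = 0" using that A_double i j k by (auto simp: tri_def)
    then show ?thesis unfolding p pl_def by (cases t') (simp flip: add.assoc)
  qed
  have P_pl: "P (pl t t') = P t * P t' * of_int (beta (snd (snd t)) (fst (snd t')))" if "t \<in> ?T" "t' \<in> ?T" for t t'
    using that tri_add(2)[OF i k j] by (cases t; cases t') (auto simp: pl_def P_def)
  have norm: "P t * cnj (P t) = 1" for t
    unfolding P_def by (cases t) (use psi_norm in simp)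
  have "gauss i k j * cnj (gauss i k j) = (\<Sum>t\<in>?T. \<Sum>t'\<in>?T. cnj (P t) * P t')"
    unfolding gauss cnj_sum sum_product by (subst sum.swap) (simp add: mult.commute)
  also have "\<dots> = (\<Sum>t\<in>?T. \<Sum>t'\<in>?T. cnj (P t) * P (pl t t'))"
  proof (rule sum.cong)
    fix t assume t: "t \<in> ?T"
    show "(\<Sum>t'\<in>?T. cnj (P t) * P t') = (\<Sum>t'\<in>?T. cnj (P t) * P (pl t t'))"
      by (rule sum.reindex_bij_witness[where i = "pl t" and j = "pl t"])
         (use pl_in[OF t] pl_pl[OF t] in auto)
  qed simp
  also have "\<dots> = (\<Sum>t\<in>?T. \<Sum>t'\<in>?T. P t' * of_int (beta (snd (snd t)) (fst (snd t'))))"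
  proof (intro sum.cong refl)
    fix t t' assume "t \<in> ?T" "t' \<in> ?T"
    then have "cnj (P t) * P (pl t t') = (P t * cnj (P t)) * (P t' * of_int (beta (snd (snd t)) (fst (snd t'))))"
      using P_pl by simp
    then show "cnj (P t) * P (pl t t') = P t' * of_int (beta (snd (snd t)) (fst (snd t')))" by (simp add: norm)
  qed
  also have "\<dots> = (\<Sum>t'\<in>?T. P t' * of_int (\<Sum>t\<in>?T. beta (snd (snd t)) (fst (snd t'))))"
    by (subst sum.swap) (simp add: sum_distrib_left)
  also have "\<dots> = (\<Sum>t'\<in>?T. if t' = (0, 0, 0) then of_nat q else 0)"
  proof (rule sum.cong)
    fix t' assume t': "t' \<in> ?T"
    obtain x y z where p: "t' = (x, y, z)" by (cases t') auto
    have m: "y \<in> A k" "(x, y, z) \<in> ?T" using t' p by (auto simp: tri_def)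
    have yG: "y \<in> G" by (rule in_G(2)[OF k m(1)])
    have "(\<Sum>t\<in>?T. beta (snd (snd t)) y) = (\<Sum>z\<in>A j. beta z y)"
      by (rule sum.reindex_bij_betw[OF bij_tri[OF i k j ne]])
    also have "\<dots> = (\<Sum>z\<in>A j. beta y z)" by (simp add: beta_commute)
    also have "\<dots> = (if \<forall>z\<in>A j. beta y z = 1 then int q else 0)"
      using sum_beta[OF A[OF j] A_G[OF j] yG] by (simp add: card_A[OF j])
    also have "(\<forall>z\<in>A j. beta y z = 1) \<longleftrightarrow> y = 0"
      using centralizer_A_subset[OF j yG] A_T[OF j k ne(3)[symmetric] m(1)] beta_0 by auto
    finally have "(\<Sum>t\<in>?T. beta (snd (snd t)) y) = (if y = 0 then int q else 0)" .
    moreover have "y = 0 \<longleftrightarrow> t' = (0, 0, 0)" 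
      using tri_mid_zero(1,3)[OF i k j ne m(2) disjI1] p by blast
    moreover have "fst (snd t') = y" by (simp add: p)
    ultimately have "P t' * of_int (\<Sum>t\<in>?T. beta (snd (snd t)) (fst (snd t')))
        = (if t' = (0, 0, 0) then P (0, 0, 0) * of_nat q else 0)"
      by (simp split: if_splits)
    then show "P t' * of_int (\<Sum>t\<in>?T. beta (snd (snd t)) (fst (snd t'))) = (if t' = (0, 0, 0) then of_nat q else 0)"
      by (simp add: P_def psi_0)
  qed simp
  also have "\<dots> = of_nat q"
  proof -
    show ?thesis using fin_tri[OF i k j] zero_tri[OF i k j] by (simp add: sum.delta)
  qed
  finally show ?thesis .
qed

lemma gauss_integral: "\<exists>m n :: int. gauss i k j = Complex (of_int m) (of_int n)"
proof -
  have "\<exists>m n :: int. (\<Sum>t\<in>X. psi (f t)) = Complex (of_int m) (of_int n)" for X :: "('a \<times> 'a \<times> 'a) set" and f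
  proof (induction X rule: infinite_finite_induct)
    case (insert t X)
    obtain m n m' n' :: int where "(\<Sum>t\<in>X. psi (f t)) = Complex (of_int m) (of_int n)"
      "psi (f t) = Complex (of_int m') (of_int n')" using insert.IH psi_Gaussian[of "f t"] by metis
    then have "(\<Sum>t\<in>insert t X. psi (f t)) = Complex (of_int (m' + m)) (of_int (n' + n))"
      using insert.hyps by (simp add: complex_eq_iff)
    then show ?case by blast
  qed (auto simp: complex_eq_iff intro!: exI[of _ 0])
  from this[of "\<lambda>p. fst p + fst (snd p) + snd (snd p)" "tri i k j"] show ?thesis
    unfolding gauss_def case_prod_unfold .
qed

text \<open>For \<open>u = 0\<close> only zero triples occur, one for each of the
  \<open>q - 1\<close> indices \<open>k\<close>. For other \<open>u\<close> every nonzero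
  \<open>z\<close> in \<open>A j\<close> belongs to exactly one triple, because \<open>u - z\<close>
  is outside \<open>T i\<close> and factors uniquely over \<open>A i\<close> and
  \<open>D\<close>.\<close>

lemma card_tri_fibre:
  assumes i: "i \<in> J" and j: "j \<in> J" and ij: "i \<noteq> j" and u: "u \<in> U"
  shows "card {p \<in> Sigma (J - {i, j}) (\<lambda>k. tri i k j). (case p of (k, x, y, z) \<Rightarrow> x + y + z) = u} = q - 1"
    (is "card ?X = _")
proof (cases "u = 0")
  case True
  have "?X = (\<lambda>k. (k, 0 :: 'a, 0 :: 'a, 0 :: 'a)) ` (J - {i, j})"
  proof (intro set_eqI iffI)
    fix p assume "p \<in> ?X"
    then obtain k x y z where p: "p = (k, x, y, z)" "k \<in> J" "k \<noteq> i" "k \<noteq> j" "(x, y, z) \<in> tri i k j" "x + y + z = 0"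
      using True by (cases p) auto
    have m: "x \<in> A i" "y \<in> A k" "z \<in> A j" using p(5) by (auto simp: tri_def)
    \<comment> \<open>A nonzero \<open>- z\<close> would have the two factorizations
      \<open>x + y\<close> and \<open>0 + - z\<close> over \<open>A i\<close> and \<open>D\<close>.
      Hence \<open>x = 0\<close>, and \<open>y = - z\<close> lies in both \<open>A k\<close> and
      \<open>A j\<close>.\<close>
    have z0: "z = 0"
    proof (rule ccontr)
      assume z: "z \<noteq> 0"
      have "- z = x + y" using p(6) by (metis minus_unique minus_minus)
      moreover have mz: "- z \<in> A j" by (rule subgrp_minus[OF A[OF j] m(3)])
      moreover have "- z \<notin> T i" using A_T[OF i j ij mz] z by auto
      ultimately have "x = 0"
        using factor_unique[OF i in_G(2)[OF j mz] _ m(1) subgrp_zero[OF A[OF i]] A_D[OF p(2) m(2)] A_D[OF j mz]] by simp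
      then have "y \<in> A j" using \<open>- z = x + y\<close> mz by simp
      then have "y = 0" using A_inter[OF p(2) j p(4) m(2)] by simp
      then show False using \<open>x = 0\<close> p(6) z by simp
    qed
    then show "p \<in> (\<lambda>k. (k, 0 :: 'a, 0 :: 'a, 0 :: 'a)) ` (J - {i, j})"
      using tri_mid_zero(1,2)[OF i p(2) j p(3)[symmetric] ij p(4,5) disjI2[OF z0]] z0 p(1-4) by simp
  next
    fix p assume "p \<in> (\<lambda>k. (k, 0 :: 'a, 0 :: 'a, 0 :: 'a)) ` (J - {i, j})"
    then show "p \<in> ?X" using True zero_tri[OF i _ j] by auto
  qed
  then have "card ?X = card (J - {i, j})" by (simp add: card_image inj_on_def)
  also have "\<dots> = q - 1" using i j ij card_J fin_J by (simp add: card_Diff_subset)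
  finally show ?thesis .
next
  case False
  have "bij_betw (\<lambda>(k, x, y, z). z) ?X (A j - {0})"
  proof (rule bij_betw_imageI)
    have zero: "z \<noteq> 0" and out: "u - z \<notin> T i" and mem: "y \<in> D" "y \<noteq> 0" "u - z \<in> G"
      and eq: "u - z = x + y"
      if h: "x \<in> A i" "y \<in> A k" "z \<in> A j" "x + y + z = u" "k \<in> J" "k \<noteq> i" for k x y z
    proof -
      show eq: "u - z = x + y" using h(4) by (metis add_diff_cancel)
      have t: "(x, y, z) \<in> tri i k j" using h u by (simp add: tri_def)
      show z0: "z \<noteq> 0"
      proof
        assume z: "z = 0"
        have "x + y \<in> T i" using eq z U_T[OF i u] by simp
        then have "y \<in> T i" using subgrp_add_left_iff[OF T_subgrp[OF i] A_subset_T[OF i h(1)]] by simp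
        then have "y = 0" using A_T[OF i h(5) h(6)[symmetric] h(2)] by simp
        then have "x = u" using h(4) z by simp
        then show False using A_U[OF i h(1)] u False by simp
      qed
      show out: "u - z \<notin> T i"
      proof
        assume "u - z \<in> T i"
        then have "- (u - z) + u \<in> T i" using U_T[OF i u] T_subgrp[OF i] by (intro subgrp_add subgrp_minus)
        then have "z \<in> T i" by simp
        then show False using A_T[OF i j ij h(3)] z0 by simp
      qed
      show "y \<in> D" by (rule A_D[OF h(5,2)])
      show "y \<noteq> 0" using out eq A_subset_T[OF i h(1)] by auto
      show "u - z \<in> G" by (rule G_closed(2)[OF in_G(1)[OF u] in_G(2)[OF j h(3)]])
    qed
    show "inj_on (\<lambda>(k, x, y, z). z) ?X"
    proof (rule inj_onI)
      fix p p' assume "p \<in> ?X" "p' \<in> ?X" and e: "(case p of (k, x, y, z) \<Rightarrow> z) = (case p' of (k, x, y, z) \<Rightarrow> z)"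
      then obtain k x y z k' x' y' where p: "p = (k, x, y, z)" "p' = (k', x', y', z)"
        and h: "x \<in> A i" "y \<in> A k" "z \<in> A j" "x + y + z = u" "k \<in> J" "k \<noteq> i"
        and h': "x' \<in> A i" "y' \<in> A k'" "z \<in> A j" "x' + y' + z = u" "k' \<in> J" "k' \<noteq> i"
        by (cases p; cases p') (auto simp: tri_def)
      have xx: "x = x'"
        by (rule factor_unique[OF i mem(3)[OF h] out[OF h] h(1) h'(1) mem(1)[OF h] mem(1)[OF h'] eq[OF h] eq[OF h']])
      then have yy: "y = y'" using eq[OF h] eq[OF h'] by simp
      have "k = k'" using A_inter[OF h(5) h'(5) _ h(2)] h'(2) yy mem(2)[OF h] by blast
      then show "p = p'" using p xx yy by simp
    qed
    show "(\<lambda>(k, x, y, z). z) ` ?X = A j - {0}"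
    proof (intro set_eqI iffI)
      fix z assume "z \<in> (\<lambda>(k, x, y, z). z) ` ?X"
      then obtain k x y where "x \<in> A i" "y \<in> A k" "z \<in> A j" "x + y + z = u" "k \<in> J" "k \<noteq> i"
        by (auto simp: tri_def)
      then show "z \<in> A j - {0}" using zero[of x y k z] by simp
    next
      fix z assume z: "z \<in> A j - {0}"
      have zj: "z \<in> A j" "z \<noteq> 0" using z by auto
      have uzG: "u - z \<in> G" by (rule G_closed(2)[OF in_G(1)[OF u] in_G(2)[OF j zj(1)]])
      have out: "u - z \<notin> T i"
      proof
        assume "u - z \<in> T i"
        then have "- (u - z) + u \<in> T i" using U_T[OF i u] T_subgrp[OF i] by (intro subgrp_add subgrp_minus)
        then have "z \<in> T i" by simp
        then show False using A_T[OF i j ij zj(1)] zj(2) by simp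
      qed
      obtain x y where xy: "x \<in> A i" "y \<in> D" "u - z = x + y" using factor[OF i uzG out] by blast
      obtain k where k: "k \<in> J" "y \<in> A k" using D_E[OF xy(2)] .
      have sum: "x + y + z = u" using xy(3) by (metis diff_add_cancel)
      have "k \<noteq> i"
      proof
        assume "k = i"
        then have "u - z \<in> A i" using k xy(1,3) subgrp_add[OF A[OF i]] by simp
        then show False using out A_subset_T[OF i] by blast
      qed
      moreover have "k \<noteq> j"
      proof
        assume "k = j"
        then have yz: "y + z \<in> A j" using k zj subgrp_add[OF A[OF j]] by simp
        have "x + (y + z) \<in> T j" using sum U_T[OF j u] by (simp add: add.assoc)
        then have "x \<in> T j" using subgrp_add_right_iff[OF T_subgrp[OF j] A_subset_T[OF j yz]] by simp
        then have "x = 0" using A_T[OF j i ij[symmetric] xy(1)] by simp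
        then have "u \<in> A j" using sum yz by simp
        then show False using A_U[OF j _ u] False by simp
      qed
      ultimately have "(k, x, y, z) \<in> ?X" using k xy(1) zj(1) sum u by (simp add: tri_def)
      then show "z \<in> (\<lambda>(k, x, y, z). z) ` ?X" by force
    qed
  qed
  then have "card ?X = card (A j - {0})" by (rule bij_betw_same_card)
  also have "\<dots> = q - 1" using card_A[OF j] subgrp_zero[OF A[OF j]] by simp
  finally show ?thesis .
qed

text \<open>As all fibres over \<open>U\<close> have the same size, the double sum is
  \<open>q - 1\<close> times the sum of \<open>psi\<close> over \<open>U\<close>.\<close>

lemma sum_gauss:
  assumes i: "i \<in> J" and j: "j \<in> J" and ij: "i \<noteq> j"
  shows "(\<Sum>k\<in>J - {i, j}. gauss i k j) = 0"
proof -
  let ?X = "Sigma (J - {i, j}) (\<lambda>k. tri i k j)"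
  let ?f = "\<lambda>(k, x, y, z). x + y + z"
  have fin: "finite ?X" using fin_J fin_tri i j by auto
  have "(\<Sum>k\<in>J - {i, j}. gauss i k j) = (\<Sum>p\<in>?X. psi (?f p))"
    unfolding gauss_def by (subst sum.Sigma) (use fin_J fin_tri i j in \<open>auto simp: case_prod_unfold\<close>)
  also have "\<dots> = (\<Sum>u\<in>U. \<Sum>p\<in>{p \<in> ?X. ?f p = u}. psi (?f p))"
    by (rule sum.group[symmetric, OF fin fin_U]) (auto simp: tri_def)
  also have "\<dots> = (\<Sum>u\<in>U. of_nat (q - 1) * psi u)"
  proof (rule sum.cong)
    fix u assume u: "u \<in> U"
    have "(\<Sum>p\<in>{p \<in> ?X. ?f p = u}. psi (?f p)) = (\<Sum>p\<in>{p \<in> ?X. ?f p = u}. psi u)"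
      by (rule sum.cong) auto
    then show "(\<Sum>p\<in>{p \<in> ?X. ?f p = u}. psi (?f p)) = of_nat (q - 1) * psi u"
      using card_tri_fibre[OF i j ij u] by simp
  qed simp
  also have "\<dots> = 0" using sum_psi by (simp flip: sum_distrib_left)
  finally show ?thesis .
qed

lemma contradiction: False
proof -
  obtain i where i: "i \<in> J" using card_J by fastforce
  obtain j where j: "j \<in> J" "j \<noteq> i" using exists_other[OF i] .
  let ?K = "J - {i, j}"
  obtain m n :: "'i \<Rightarrow> int" where mn: "\<And>k. gauss i k j = Complex (of_int (m k)) (of_int (n k))"
    using gauss_integral[of i _ j] by metis
  have "(m k)\<^sup>2 + (n k)\<^sup>2 = int q" if k: "k \<in> ?K" for k
  proof -
    have "gauss i k j * cnj (gauss i k j) = of_nat q" by (rule gauss_norm) (use i j k in auto)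
    then have "real_of_int ((m k)\<^sup>2 + (n k)\<^sup>2) = real_of_int (int q)"
      unfolding mn by (simp add: complex_eq_iff power2_eq_square)
    then show ?thesis by linarith
  qed
  \<comment> \<open>\<open>?K\<close> has \<open>q + 1 - 2 = q - 1\<close> elements.\<close>
  moreover have "odd (card ?K)" using i j card_J fin_J even_q q_ge_2 by (simp add: card_Diff_subset)
  ultimately have "(\<Sum>k\<in>?K. m k) \<noteq> 0 \<or> (\<Sum>k\<in>?K. n k) \<noteq> 0"
    using fin_J q_ge_2 by (intro odd_sum_equal_norm[where n = q]) auto
  moreover have "(\<Sum>k\<in>?K. Complex (of_int (m k)) (of_int (n k))) = 0"
    using sum_gauss[OF i j(1) j(2)[symmetric]] mn by simp
  then have "of_int (\<Sum>k\<in>?K. m k) = (0::real)" "of_int (\<Sum>k\<in>?K. n k) = (0::real)"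
    by (simp_all add: complex_eq_iff)
  ultimately show False by (simp del: of_int_sum)
qed

end

theorem (in as_configuration) G_abelian:
  assumes "x \<in> G" "y \<in> G" shows "x + y = y + x"
proof (rule ccontr)
  assume "x + y \<noteq> y + x"
  then obtain N c where "as_reduction G U A J q N c" using exists_reduction assms by blast
  then show False by (rule as_reduction.contradiction)
qed

section \<open>The elation group of a skew translation generalized quadrangle\<close>

text \<open>A type of class \<open>group_add\<close> keeps the group computations free of carrier conditions.\<close>

typedef ('p, 'l) bij_pair = "{a :: ('p \<Rightarrow> 'p) \<times> ('l \<Rightarrow> 'l). bij (fst a) \<and> bij (snd a)}"
  morphisms the_pair Bij_pair
  by (rule exI[of _ "(id, id)"]) simp

lemma bij_fst: "bij (fst (the_pair x))" and bij_snd: "bij (snd (the_pair x))"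
  using the_pair[of x] by auto

instantiation bij_pair :: (type, type) group_add
begin

definition "0 = Bij_pair (id, id)"
definition "x + y = Bij_pair (aut_comp (the_pair x) (the_pair y))"
definition "- x = Bij_pair (aut_inv (the_pair x))"
definition "x - y = x + - (y :: ('a, 'b) bij_pair)"

lemma the_pair_zero: "the_pair 0 = (id, id)"
  by (simp add: zero_bij_pair_def Bij_pair_inverse)

lemma the_pair_plus: "the_pair (x + y) = aut_comp (the_pair x) (the_pair y)"
  by (simp add: plus_bij_pair_def Bij_pair_inverse aut_comp_def bij_fst bij_snd bij_comp)

lemma the_pair_minus: "the_pair (- x) = aut_inv (the_pair x)"
  by (simp add: uminus_bij_pair_def Bij_pair_inverse aut_inv_def bij_fst bij_snd bij_imp_bij_inv)

instance
proof
  fix a b c :: "('a, 'b) bij_pair"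
  show "a + b + c = a + (b + c)"
    by (simp add: the_pair_plus aut_comp_def comp_assoc flip: the_pair_inject)
  show "0 + a = a" "a + 0 = a"
    by (simp_all add: the_pair_plus the_pair_zero aut_comp_def flip: the_pair_inject)
  show "- a + a = 0"
    by (simp add: the_pair_plus the_pair_minus the_pair_zero aut_comp_def aut_inv_def
        bij_fst bij_snd bij_is_inj flip: the_pair_inject)
  show "a + - b = a - b" by (simp add: minus_bij_pair_def)
qed

end

definition pmap :: "('p, 'l) bij_pair \<Rightarrow> 'p \<Rightarrow> 'p" where "pmap g = fst (the_pair g)"

definition lmap :: "('p, 'l) bij_pair \<Rightarrow> 'l \<Rightarrow> 'l" where "lmap g = snd (the_pair g)"

lemma pmap_simps: "pmap 0 x = x" "pmap (g + h) x = pmap g (pmap h x)" "pmap (- g) (pmap g x) = x" "pmap g (pmap (- g) x) = x"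
  and lmap_simps: "lmap 0 l = l" "lmap (g + h) l = lmap g (lmap h l)" "lmap (- g) (lmap g l) = l" "lmap g (lmap (- g) l) = l"
  by (simp_all add: pmap_def lmap_def the_pair_zero the_pair_plus the_pair_minus aut_comp_def aut_inv_def
      bij_fst bij_snd bij_is_inj bij_is_surj inv_f_f surj_f_inv_f)

lemma collinear_commute: "collinear I x y \<longleftrightarrow> collinear I y x"
  by (auto simp: collinear_def)

lemma is_stgq_pos:
  fixes I :: "'p::finite \<Rightarrow> 'l::finite \<Rightarrow> bool"
  assumes "is_stgq I s t P E" shows "t > 0"
proof -
  obtain H :: "(('p \<Rightarrow> 'p) \<times> ('l \<Rightarrow> 'l)) set" where H: "perm_group H" "card H = t"
    using assms unfolding is_stgq_def by blast
  then have "(id, id) \<in> H" by (simp add: perm_group_def)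
  then show ?thesis using H(2) by (metis card_gt_0_iff empty_iff finite)
qed

locale skew_translation =
  fixes I :: "'p::finite \<Rightarrow> 'l::finite \<Rightarrow> bool" and s :: nat and P :: 'p
    and E :: "(('p \<Rightarrow> 'p) \<times> ('l \<Rightarrow> 'l)) set" and Q :: 'p
  assumes stgq: "is_stgq I s s P E" and Q: "\<not> collinear I P Q"
begin

definition G :: "('p, 'l) bij_pair set" where "G = {g. the_pair g \<in> E}"

lemma card_line: "card {x. I x l} = s + 1" and card_pencil: "card {l. I x l} = s + 1"
  and line_unique: "x \<noteq> y \<Longrightarrow> I x l \<Longrightarrow> I y l \<Longrightarrow> I x m \<Longrightarrow> I y m \<Longrightarrow> l = m"
  and proj_exists: "\<not> I x l \<Longrightarrow> \<exists>y. I y l \<and> collinear I x y"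
  and proj_unique: "\<not> I x l \<Longrightarrow> I y l \<Longrightarrow> collinear I x y \<Longrightarrow> I z l \<Longrightarrow> collinear I x z \<Longrightarrow> y = z"
  using stgq unfolding is_stgq_def is_egq_def gq_order_def by (metis, metis, metis, metis, metis)

lemma collinearI: "I x l \<Longrightarrow> I y l \<Longrightarrow> collinear I x y"
  by (auto simp: collinear_def)

lemma collinearE: assumes "collinear I x y" obtains l where "I x l" "I y l"
  using assms by (auto simp: collinear_def)

lemma G_aut: "g \<in> G \<Longrightarrow> is_aut I (the_pair g)" and E_G: "a \<in> E \<Longrightarrow> \<exists>g\<in>G. the_pair g = a"
proof -
  have aut: "is_aut I a" if "a \<in> E" for a
    using stgq that by (auto simp: is_stgq_def is_egq_def aut_group_def)
  show "g \<in> G \<Longrightarrow> is_aut I (the_pair g)" using aut by (simp add: G_def)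
  show "a \<in> E \<Longrightarrow> \<exists>g\<in>G. the_pair g = a"
    using aut[of a] by (intro bexI[of _ "Bij_pair a"]) (auto simp: G_def is_aut_def Bij_pair_inverse)
qed

lemma incid: "g \<in> G \<Longrightarrow> I (pmap g x) (lmap g l) \<longleftrightarrow> I x l"
  using G_aut[of g] by (simp add: is_aut_def pmap_def lmap_def)

lemma G: "subgrp G"
  using stgq by (simp add: subgrp_def G_def is_stgq_def is_egq_def aut_group_def perm_group_def
      the_pair_zero the_pair_plus the_pair_minus)

lemma G_closed: "x \<in> G \<Longrightarrow> y \<in> G \<Longrightarrow> x + y \<in> G" "x \<in> G \<Longrightarrow> - x \<in> G" "0 \<in> G"
  by (rule subgrp_closed[OF G]; assumption)+

lemma collinear_pmap: assumes g: "g \<in> G" shows "collinear I (pmap g x) (pmap g y) \<longleftrightarrow> collinear I x y"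
proof
  assume "collinear I (pmap g x) (pmap g y)"
  then obtain l where "I (pmap g x) l" "I (pmap g y) l" by (elim collinearE)
  then have "I x (lmap (- g) l)" "I y (lmap (- g) l)"
    using incid[OF g, of _ "lmap (- g) l"] by (simp_all add: lmap_simps)
  then show "collinear I x y" by (rule collinearI)
next
  assume "collinear I x y"
  then show "collinear I (pmap g x) (pmap g y)" using incid[OF g] by (auto simp: collinear_def)
qed

lemma lmap_fixed: "g \<in> G \<Longrightarrow> I P l \<Longrightarrow> lmap g l = l"
  using stgq by (auto simp: is_stgq_def is_egq_def is_elation_def G_def lmap_def)

lemma regular: "\<not> collinear I P x \<Longrightarrow> \<not> collinear I P y \<Longrightarrow> \<exists>!g. g \<in> G \<and> pmap g x = y"
proof -
  assume "\<not> collinear I P x" "\<not> collinear I P y"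
  then have ex: "\<exists>!a. a \<in> E \<and> fst a x = y" using stgq by (auto simp: is_stgq_def is_egq_def)
  then obtain a where a: "a \<in> E" "fst a x = y" by blast
  obtain g where g: "g \<in> G" "the_pair g = a" using E_G[OF a(1)] by blast
  show ?thesis
  proof (rule ex1I[of _ g])
    show "g \<in> G \<and> pmap g x = y" using g a by (simp add: pmap_def)
    fix h assume h: "h \<in> G \<and> pmap h x = y"
    then have "the_pair h = the_pair g" using ex a g by (auto simp: G_def pmap_def)
    then show "h = g" by (simp add: the_pair_inject)
  qed
qed

lemmas s_pos = is_stgq_pos[OF stgq]

lemma exists_other_line: obtains m where "I x m" "m \<noteq> l"
proof -
  have "\<not> {m. I x m} \<subseteq> {l}"
  proof
    assume "{m. I x m} \<subseteq> {l}"
    then have "card {m. I x m} \<le> 1" using card_mono[of "{l}"] by simp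
    then show False using card_pencil[of x] s_pos by simp
  qed
  then show ?thesis using that by blast
qed

lemma pmap_P: assumes g: "g \<in> G" shows "pmap g P = P"
proof (rule ccontr)
  assume ne: "pmap g P \<noteq> P"
  obtain l where l: "I P l" using exists_other_line .
  obtain m where m: "I P m" "m \<noteq> l" using exists_other_line .
  have "I (pmap g P) l" "I (pmap g P) m" using incid[OF g, of P] lmap_fixed[OF g] l m by metis+
  then show False using line_unique[OF ne _ l(1) _ m(1)] m(2) by blast
qed

lemma opposite: "g \<in> G \<Longrightarrow> \<not> collinear I P (pmap g Q)"
  using collinear_pmap[of g P Q] pmap_P[of g] Q by simp

lemma pmap_Q_inj: "g \<in> G \<Longrightarrow> h \<in> G \<Longrightarrow> pmap g Q = pmap h Q \<Longrightarrow> g = h"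
  using regular[OF Q opposite[of g]] by metis

lemma pmap_Q_surj: assumes "\<not> collinear I P x" obtains g where "g \<in> G" "pmap g Q = x"
  using regular[OF Q assms] by blast

section \<open>Labelling the lines through \<open>Q\<close> by the lines through
  \<open>P\<close>\<close>

definition J :: "'l set" where "J = {l. I P l}"

text \<open>The projection of \<open>Q\<close> on \<open>l\<close>. Joining it to \<open>Q\<close>
  gives \<open>transv l\<close>, and by \<open>line_through_Q\<close> all lines through
  \<open>Q\<close> arise in this way, so the lines through \<open>P\<close> can index the Kantor
  family.\<close>

definition foot :: "'l \<Rightarrow> 'p" where "foot l = (THE y. I y l \<and> collinear I Q y)"

definition transv :: "'l \<Rightarrow> 'l" where "transv l = (SOME m. I Q m \<and> I (foot l) m)"

lemma Q_not_on: "l \<in> J \<Longrightarrow> \<not> I Q l"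
  using Q collinearI[of P l Q] by (auto simp: J_def)

lemma foot: assumes "l \<in> J" shows "I (foot l) l" "collinear I Q (foot l)"
proof -
  have "\<exists>!y. I y l \<and> collinear I Q y"
    using proj_exists[OF Q_not_on[OF assms]] proj_unique[OF Q_not_on[OF assms]] by blast
  then show "I (foot l) l" "collinear I Q (foot l)" unfolding foot_def by (metis (mono_tags, lifting) theI')+
qed

lemma foot_unique: "l \<in> J \<Longrightarrow> I y l \<Longrightarrow> collinear I Q y \<Longrightarrow> y = foot l"
  using proj_unique[OF Q_not_on] foot by blast

lemma transv: assumes "l \<in> J" shows "I Q (transv l)" "I (foot l) (transv l)"
proof -
  have "\<exists>m. I Q m \<and> I (foot l) m" using foot(2)[OF assms] by (simp add: collinear_def)
  then show "I Q (transv l)" "I (foot l) (transv l)" unfolding transv_def by (metis (mono_tags, lifting) someI_ex)+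
qed

lemma foot_P: "l \<in> J \<Longrightarrow> collinear I P (foot l)"
  using foot(1) by (auto simp: J_def intro: collinearI)

lemma foot_ne_P: "l \<in> J \<Longrightarrow> foot l \<noteq> P"
  using foot(2)[of l] Q collinear_commute[of I Q P] by auto

lemma P_not_on_transv: "l \<in> J \<Longrightarrow> \<not> I P (transv l)"
  using transv(1) Q collinearI by blast

lemma on_transv: assumes l: "l \<in> J" and x: "I x (transv l)"
  shows "collinear I P x \<longleftrightarrow> x = foot l"
  using proj_unique[OF P_not_on_transv[OF l] x _ transv(2)[OF l] foot_P[OF l]] foot_P[OF l] by blast

lemma foot_not_on:
  assumes "l \<in> J" "m \<in> J" "l \<noteq> m" shows "\<not> I (foot l) m" "\<not> I (foot l) (transv m)"
proof -
  show 1: "\<not> I (foot l) m"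
    using line_unique[OF foot_ne_P[OF assms(1)] foot(1)[OF assms(1)] _ _, of m] assms by (auto simp: J_def)
  show "\<not> I (foot l) (transv m)"
  proof
    assume "I (foot l) (transv m)"
    then have "foot l = foot m" using on_transv[OF assms(2)] foot_P[OF assms(1)] by blast
    then show False using 1 foot(1)[OF assms(2)] by simp
  qed
qed

lemma line_through_Q: assumes "I Q n" obtains l where "l \<in> J" "n = transv l"
proof -
  have Pn: "\<not> I P n" using Q collinearI[OF _ assms] by blast
  obtain y where y: "I y n" "collinear I P y" using proj_exists[OF Pn] by blast
  obtain l where l: "I P l" "I y l" using y(2) by (elim collinearE)
  have lJ: "l \<in> J" using l by (simp add: J_def)
  have "y = foot l" using foot_unique[OF lJ l(2) collinearI[OF assms y(1)]] .
  moreover have "foot l \<noteq> Q" using foot(1)[OF lJ] Q_not_on[OF lJ] by auto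
  ultimately have "n = transv l" using line_unique[of "foot l" Q n "transv l"] y(1) assms transv[OF lJ] by blast
  then show ?thesis using that lJ by blast
qed

text \<open>For \<open>l\<close> in \<open>J\<close> this is the stabilizer of
  \<open>transv l\<close>, see \<open>A_iff\<close>. Stating it by the image of \<open>Q\<close>
  reduces counting to the points of that line.\<close>

definition A :: "'l \<Rightarrow> ('p, 'l) bij_pair set" where "A l = {g \<in> G. I (pmap g Q) (transv l)}"

text \<open>The kernel of the action of \<open>G\<close> on the points collinear with
  \<open>P\<close>. It contains the given group of symmetries, and by \<open>card_U\<close> it is no
  larger.\<close>

definition U :: "('p, 'l) bij_pair set" where "U = {g \<in> G. \<forall>x. collinear I P x \<longrightarrow> pmap g x = x}"

text \<open>\<open>foot l\<close> and its image both lie on the fixed line \<open>l\<close> and are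
  collinear with the image of \<open>Q\<close>, which is not on \<open>l\<close>; hence they
  coincide.\<close>

lemma A_fixes: assumes l: "l \<in> J" and g: "g \<in> A l" shows "pmap g (foot l) = foot l" "lmap g (transv l) = transv l"
proof -
  have gG: "g \<in> G" and gO: "I (pmap g Q) (transv l)" using g by (auto simp: A_def)
  have gl: "lmap g l = l" using lmap_fixed[OF gG] l by (simp add: J_def)
  have on: "I (pmap g (foot l)) l" using incid[OF gG, of "foot l" l] foot(1)[OF l] gl by simp
  have nl: "\<not> I (pmap g Q) l" using opposite[OF gG] l collinearI[of P l] by (auto simp: J_def)
  have c1: "collinear I (pmap g Q) (pmap g (foot l))" using collinear_pmap[OF gG] foot(2)[OF l] by simp
  have c2: "collinear I (pmap g Q) (foot l)" by (rule collinearI[OF gO transv(2)[OF l]])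
  show fx: "pmap g (foot l) = foot l" by (rule proj_unique[OF nl on c1 foot(1)[OF l] c2])
  have "foot l \<noteq> pmap g Q" using nl foot(1)[OF l] by auto
  moreover have "I (pmap g Q) (lmap g (transv l))" "I (foot l) (lmap g (transv l))"
    using incid[OF gG, of Q "transv l"] incid[OF gG, of "foot l" "transv l"] transv[OF l] fx by simp_all
  ultimately show "lmap g (transv l) = transv l"
    using line_unique[of "foot l" "pmap g Q" "lmap g (transv l)" "transv l"] gO transv(2)[OF l] by blast
qed

lemma A_iff: "l \<in> J \<Longrightarrow> g \<in> A l \<longleftrightarrow> g \<in> G \<and> lmap g (transv l) = transv l"
  using A_fixes(2)[of l g] incid[of g Q "transv l"] transv(1)[of l] by (auto simp: A_def)

lemma A: assumes l: "l \<in> J" shows "subgrp (A l)"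
proof -
  have "lmap (- g) (transv l) = transv l" if "lmap g (transv l) = transv l" for g :: "('p, 'l) bij_pair"
    using lmap_simps(3)[of g "transv l"] that by simp
  then show ?thesis unfolding subgrp_def using A_iff[OF l] by (simp add: G_closed lmap_simps)
qed

lemma card_A: assumes l: "l \<in> J" shows "card (A l) = s"
proof -
  have "bij_betw (\<lambda>g. pmap g Q) (A l) ({x. I x (transv l)} - {foot l})"
  proof (rule bij_betw_imageI)
    show "inj_on (\<lambda>g. pmap g Q) (A l)" by (rule inj_onI) (auto simp: A_def intro: pmap_Q_inj)
    show "(\<lambda>g. pmap g Q) ` A l = {x. I x (transv l)} - {foot l}"
    proof (intro set_eqI iffI)
      fix x assume "x \<in> (\<lambda>g. pmap g Q) ` A l"
      then obtain g where g: "g \<in> G" "I (pmap g Q) (transv l)" "x = pmap g Q" by (auto simp: A_def)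
      then show "x \<in> {x. I x (transv l)} - {foot l}" using on_transv[OF l g(2)] opposite[OF g(1)] by auto
    next
      fix x assume x: "x \<in> {x. I x (transv l)} - {foot l}"
      then have "\<not> collinear I P x" using on_transv[OF l] by auto
      then obtain g where "g \<in> G" "pmap g Q = x" by (elim pmap_Q_surj)
      then show "x \<in> (\<lambda>g. pmap g Q) ` A l" using x by (auto simp: A_def)
    qed
  qed
  then have "card (A l) = card ({x. I x (transv l)} - {foot l})" by (rule bij_betw_same_card)
  also have "\<dots> = s" using transv(2)[OF l] card_line[of "transv l"] by simp
  finally show ?thesis .
qed

lemma U: "normal_in U G"
proof -
  have neg: "- g \<in> U" if g: "g \<in> U" for g
  proof -
    have "pmap (- g) x = x" if "collinear I P x" for x
    proof -
      have "pmap g x = x" using g that by (simp add: U_def)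
      then show ?thesis using pmap_simps(3)[of g x] by simp
    qed
    then show ?thesis using g G_closed by (auto simp: U_def)
  qed
  have "subgrp U" unfolding subgrp_def using neg by (auto simp: U_def pmap_simps intro: G_closed)
  moreover have "g + u - g \<in> U" if g: "g \<in> G" and u: "u \<in> U" for g u
  proof -
    have "pmap (g + u + - g) x = x" if "collinear I P x" for x
    proof -
      have "collinear I P (pmap (- g) x)"
        using collinear_pmap[OF G_closed(2)[OF g], of P x] pmap_P[OF G_closed(2)[OF g]] that by simp
      then have "pmap u (pmap (- g) x) = pmap (- g) x" using u by (simp add: U_def)
      then show ?thesis by (simp add: pmap_simps del: add_uminus_conv_diff)
    qed
    moreover have "g + u + - g \<in> G" 
      using g u by (simp add: U_def G_closed del: add_uminus_conv_diff)
    ultimately show ?thesis by (simp add: U_def)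
  qed
  ultimately show ?thesis by (auto simp: normal_in_def U_def)
qed

lemma U_foot: "u \<in> U \<Longrightarrow> l \<in> J \<Longrightarrow> pmap u (foot l) = foot l"
  using foot_P by (simp add: U_def)

lemma collinear_foot: assumes "g \<in> G" "pmap g (foot l) = foot l" "l \<in> J" shows "collinear I (foot l) (pmap g Q)"
  using collinear_pmap[OF assms(1), of "foot l" Q] assms(2) foot(2)[OF assms(3)] collinear_commute[of I Q] by simp

text \<open>\<open>Q\<close> and its image are both the projection of \<open>foot l\<close> on
  \<open>transv m\<close>, and an element of \<open>G\<close> is determined by the image of
  \<open>Q\<close>.\<close>

lemma fixes_foot_transv:
  assumes g: "g \<in> A m" "pmap g (foot l) = foot l" and lm: "l \<in> J" "m \<in> J" "l \<noteq> m"
  shows "g = 0"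
proof -
  have gG: "g \<in> G" and gO: "I (pmap g Q) (transv m)" using g by (auto simp: A_def)
  have "pmap g Q = Q"
    using proj_unique[OF foot_not_on(2)[OF lm] gO collinear_foot[OF gG g(2) lm(1)] transv(1)[OF lm(2)]]
      foot(2)[OF lm(1)] collinear_commute[of I Q] by blast
  then show ?thesis using pmap_Q_inj[OF gG G_closed(3)] by (simp add: pmap_simps)
qed

lemma exists_other_J: assumes "l \<in> J" obtains m where "m \<in> J" "l \<noteq> m"
  using exists_other_line[of P l] by (auto simp: J_def)

lemma A_U: assumes l: "l \<in> J" and a: "a \<in> A l" "a \<in> U" shows "a = 0"
proof -
  obtain m where m: "m \<in> J" "l \<noteq> m" using exists_other_J[OF l] .
  show ?thesis using fixes_foot_transv[OF a(1) U_foot[OF a(2) m(1)] m(1) l] m(2) by auto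
qed

text \<open>Upper bound: all images of \<open>Q\<close> under \<open>U\<close> are collinear with
  \<open>foot l\<close> and \<open>foot m\<close>. These two points are not collinear and so have at
  most \<open>s + 1\<close> common neighbours, one of which is \<open>P\<close>. Lower bound:
  \<open>U\<close> contains the \<open>s\<close> symmetries of the hypothesis.\<close>

lemma card_U: "card U = s"
proof (rule antisym)
  obtain l where l: "l \<in> J" using exists_other_line[of P] by (auto simp: J_def)
  obtain m where m: "m \<in> J" "l \<noteq> m" using exists_other_J[OF l] .
  have nc: "\<not> collinear I (foot m) (foot l)"
  proof
    assume c: "collinear I (foot m) (foot l)"
    have "collinear I (foot m) P" using foot_P[OF m(1)] collinear_commute[of I P] by simp
    then have "foot l = P"
      using proj_unique[OF foot_not_on(1)[OF m(1) l m(2)[symmetric]] foot(1)[OF l] c, of P] l by (simp add: J_def)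
    then show False using foot_ne_P[OF l] by simp
  qed
  let ?C = "{x. collinear I (foot l) x \<and> collinear I (foot m) x}"
  obtain f where f: "\<And>x. x \<in> ?C \<Longrightarrow> I (foot l) (f x) \<and> I x (f x)"
    by (atomize_elim, intro choice) (auto simp: collinear_def)
  have "card ?C \<le> card {n. I (foot l) n}"
  proof (rule card_inj_on_le[where f = f])
    show "inj_on f ?C"
    proof (rule inj_onI)
      fix x y assume x: "x \<in> ?C" and y: "y \<in> ?C" and e: "f x = f y"
      have "\<not> I (foot m) (f x)" using nc f[OF x] collinearI by blast
      then show "x = y" using proj_unique[of "foot m" "f x" x y] f[OF x] f[OF y] x y e by auto
    qed
    show "f ` ?C \<subseteq> {n. I (foot l) n}" using f by blast
  qed simp
  then have "card ?C \<le> s + 1" by (simp add: card_pencil)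
  moreover have PC: "P \<in> ?C" using foot_P[OF l] foot_P[OF m(1)] by (simp add: collinear_commute)
  ultimately have "card (?C - {P}) \<le> s" by simp
  moreover have "card U \<le> card (?C - {P})"
  proof (rule card_inj_on_le[where f = "\<lambda>g. pmap g Q"])
    show "inj_on (\<lambda>g. pmap g Q) U" by (rule inj_onI) (auto simp: U_def intro: pmap_Q_inj)
    show "(\<lambda>g. pmap g Q) ` U \<subseteq> ?C - {P}"
    proof
      fix x assume "x \<in> (\<lambda>g. pmap g Q) ` U"
      then obtain g where g: "g \<in> U" "x = pmap g Q" by blast
      have gG: "g \<in> G" using g by (simp add: U_def)
      have "collinear I P P" by (rule exists_other_line[of P]) (auto intro: collinearI)
      then have "x \<noteq> P" using g opposite[OF gG] by auto
      then show "x \<in> ?C - {P}"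
        using g collinear_foot[OF gG U_foot[OF g(1) l] l] collinear_foot[OF gG U_foot[OF g(1) m(1)] m(1)] by auto
    qed
  qed simp
  ultimately show "card U \<le> s" by simp
next
  obtain H where H: "H \<subseteq> E" "card H = s" "\<And>a. a \<in> H \<Longrightarrow> is_symmetry I P a"
    using stgq by (auto simp: is_stgq_def)
  have "card H \<le> card (the_pair ` U)"
  proof (rule card_mono)
    show "H \<subseteq> the_pair ` U"
    proof
      fix a assume a: "a \<in> H"
      then obtain g where g: "g \<in> G" "the_pair g = a" using H(1) E_G by blast
      then have "g \<in> U" using H(3)[OF a] by (simp add: U_def is_symmetry_def pmap_def)
      then show "a \<in> the_pair ` U" using g by blast
    qed
  qed simp
  also have "\<dots> = card U" by (rule card_image) (simp add: inj_on_def the_pair_inject)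
  finally show "s \<le> card U" using H(2) by simp
qed

lemma card_fibre:
  assumes l: "I P l" and y: "I y l" "y \<noteq> P"
  shows "card {x. \<not> collinear I P x \<and> collinear I y x} = s\<^sup>2"
proof -
  have "{x. \<not> collinear I P x \<and> collinear I y x} = (\<Union>n\<in>{n. I y n} - {l}. {x. I x n} - {y})" (is "?L = ?R")
  proof (intro set_eqI iffI)
    fix x assume "x \<in> ?L"
    then have x: "\<not> collinear I P x" "collinear I y x" by auto
    then obtain n where n: "I y n" "I x n" by (elim collinearE)
    have "n \<noteq> l" "x \<noteq> y" using x(1) n l y collinearI by blast+
    then show "x \<in> ?R" using n by blast
  next
    fix x assume "x \<in> ?R"
    then obtain n where n: "I y n" "n \<noteq> l" "I x n" "x \<noteq> y" by blast
    have Pn: "\<not> I P n" using line_unique[OF y(2) y(1) l n(1)] n(2) by blast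
    have "\<not> collinear I P x"
      using proj_unique[OF Pn n(3) _ n(1) collinearI[OF l y(1)]] n(4) by blast
    then show "x \<in> ?L" using collinearI[OF n(1,3)] by simp
  qed
  moreover have "card ?R = (\<Sum>n\<in>{n. I y n} - {l}. card ({x. I x n} - {y}))"
  proof (rule card_UN_disjoint)
    show "\<forall>i\<in>{n. I y n} - {l}. \<forall>j\<in>{n. I y n} - {l}. i \<noteq> j \<longrightarrow> ({x. I x i} - {y}) \<inter> ({x. I x j} - {y}) = {}"
      using line_unique[of _ y] by blast
  qed auto
  moreover have "\<dots> = (\<Sum>n\<in>{n. I y n} - {l}. s)"
    by (rule sum.cong) (auto simp: card_line)
  moreover have "\<dots> = s * s" using y card_pencil[of y] by simp
  ultimately show ?thesis by (simp add: power2_eq_square)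
qed

text \<open>\<open>G\<close> acts regularly on the points opposite \<open>P\<close>. These are
  sorted by their projection on a line through \<open>P\<close>, with \<open>s\<^sup>2\<close>
  points over each of the \<open>s\<close> possible projections.\<close>

lemma card_G: "card G = s ^ 3"
proof -
  obtain l where l: "I P l" using exists_other_line[of P] by auto
  have "bij_betw (\<lambda>g. pmap g Q) G {x. \<not> collinear I P x}"
  proof (rule bij_betw_imageI)
    show "inj_on (\<lambda>g. pmap g Q) G" by (rule inj_onI) (auto intro: pmap_Q_inj)
    show "(\<lambda>g. pmap g Q) ` G = {x. \<not> collinear I P x}"
      using opposite pmap_Q_surj by (auto simp: image_iff) metis
  qed
  then have "card G = card {x. \<not> collinear I P x}" by (rule bij_betw_same_card)
  also have "{x. \<not> collinear I P x} = (\<Union>y\<in>{y. I y l} - {P}. {x. \<not> collinear I P x \<and> collinear I y x})"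
  proof (intro set_eqI iffI)
    fix x assume x: "x \<in> {x. \<not> collinear I P x}"
    then have nx: "\<not> I x l" using l collinearI by blast
    obtain y where y: "I y l" "collinear I x y" using proj_exists[OF nx] by blast
    then have "y \<noteq> P" using x by (auto simp: collinear_commute)
    then show "x \<in> (\<Union>y\<in>{y. I y l} - {P}. {x. \<not> collinear I P x \<and> collinear I y x})"
      using x y by (auto simp: collinear_commute)
  qed auto
  also have "card \<dots> = (\<Sum>y\<in>{y. I y l} - {P}. card {x. \<not> collinear I P x \<and> collinear I y x})"
  proof (rule card_UN_disjoint)
    have "y = z" if "\<not> collinear I P x" "collinear I y x" "collinear I z x" "I y l" "I z l" for x y z
    proof -
      have "\<not> I x l" using that(1) l collinearI by blast
      then show ?thesis using proj_unique[of x l y z] that by (simp add: collinear_commute)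
    qed
    then show "\<forall>i\<in>{y. I y l} - {P}. \<forall>j\<in>{y. I y l} - {P}. i \<noteq> j \<longrightarrow>
        {x. \<not> collinear I P x \<and> collinear I i x} \<inter> {x. \<not> collinear I P x \<and> collinear I j x} = {}"
      by blast
  qed auto
  also have "\<dots> = (\<Sum>y\<in>{y. I y l} - {P}. s\<^sup>2)"
    by (rule sum.cong) (use card_fibre[OF l] in auto)
  also have "\<dots> = s * s\<^sup>2" using l card_line[of l] by simp
  finally show ?thesis by (simp add: power3_eq_cube power2_eq_square)
qed

lemma fin_G: "finite G"
  by (rule card_ge_0_finite) (simp add: card_G s_pos)

text \<open>The elements \<open>a + u\<close> fix \<open>foot l\<close>, so they move
  \<open>Q\<close> to points opposite \<open>P\<close> and collinear with \<open>foot l\<close>.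
  There are \<open>s\<^sup>2\<close> such elements and \<open>s\<^sup>2\<close> such points, so
  every such point is reached.\<close>

lemma tangent: assumes l: "l \<in> J" and g: "g \<in> G" "collinear I (foot l) (pmap g Q)"
  shows "\<exists>a\<in>A l. \<exists>u\<in>U. g = a + u"
proof -
  let ?f = "\<lambda>(a, u). pmap (a + u) Q"
  let ?F = "{x. \<not> collinear I P x \<and> collinear I (foot l) x}"
  have AG: "a \<in> G" if "a \<in> A l" for a using that by (simp add: A_def)
  have UG: "u \<in> G" if "u \<in> U" for u using that by (simp add: U_def)
  have inj: "inj_on ?f (A l \<times> U)"
  proof (intro inj_onI, clarify)
    fix a u b v assume h: "a \<in> A l" "u \<in> U" "b \<in> A l" "v \<in> U" "pmap (a + u) Q = pmap (b + v) Q"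
    have eq: "a + u = b + v"
      by (rule pmap_Q_inj[OF _ _ h(5)]) (use h AG UG in \<open>auto intro: G_closed(1)\<close>)
    have "- b + a = v - u" using eq by (metis add_diff_cancel minus_add_cancel add_diff_eq)
    moreover have "v - u \<in> U" using h U by (auto simp: normal_in_def intro: subgrp_diff)
    moreover have "- b + a \<in> A l" using h A[OF l] by (auto intro: subgrp_closed)
    ultimately have "- b + a = 0" using A_U[OF l] by metis
    then have "a = b" by (metis add.right_neutral add_minus_cancel)
    then show "a = b \<and> u = v" using eq by simp
  qed
  have sub: "?f ` (A l \<times> U) \<subseteq> ?F"
  proof clarify
    fix a u assume h: "a \<in> A l" "u \<in> U"
    have G': "a + u \<in> G" using h AG UG by (auto intro: G_closed(1))
    have "pmap (a + u) (foot l) = foot l" using A_fixes(1)[OF l h(1)] U_foot[OF h(2) l] by (simp add: pmap_simps)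
    then show "\<not> collinear I P (pmap (a + u) Q) \<and> collinear I (foot l) (pmap (a + u) Q)"
      using opposite[OF G'] collinear_foot[OF G' _ l] by simp
  qed
  have "card (?f ` (A l \<times> U)) = card ?F"
    using inj card_fibre[of l "foot l"] foot(1)[OF l] foot_ne_P[OF l] l
    by (simp add: card_image card_cartesian_product card_A[OF l] card_U power2_eq_square J_def)
  then have "?f ` (A l \<times> U) = ?F" using sub by (intro card_subset_eq) auto
  moreover have "pmap g Q \<in> ?F" using g opposite by simp
  ultimately obtain a u where au: "a \<in> A l" "u \<in> U" "pmap g Q = pmap (a + u) Q" by force
  then have "g = a + u" using pmap_Q_inj[OF g(1) G_closed(1)] AG UG by blast
  then show ?thesis using au by blast
qed

lemma configuration: assumes "even s" shows "as_configuration G U A J s"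
proof
  fix l m g a u assume lm: "l \<in> J" "m \<in> J" "l \<noteq> m" and a: "a \<in> A l" "u \<in> U" "a + u \<in> A m"
  have "pmap (a + u) (foot l) = foot l" using A_fixes(1)[OF lm(1) a(1)] U_foot[OF a(2) lm(1)] by (simp add: pmap_simps)
  then show "a + u = 0" using fixes_foot_transv[OF a(3) _ lm] by simp
next
  fix l g assume l: "l \<in> J" and g: "g \<in> G" and out: "\<And>a u. a \<in> A l \<Longrightarrow> u \<in> U \<Longrightarrow> g \<noteq> a + u"
  have nc: "\<not> collinear I (foot l) (pmap g Q)" using tangent[OF l g] out by blast
  have nO: "\<not> I (pmap g Q) (transv l)" using nc collinearI[OF transv(2)[OF l]] by blast
  show "\<exists>a\<in>A l. \<exists>b\<in>\<Union>j\<in>J. A j. g = a + b"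
  proof -
    \<comment> \<open>The projection of the image of \<open>Q\<close> under \<open>g\<close> on
      \<open>transv l\<close> is not \<open>foot l\<close>, so it is the image of \<open>Q\<close>
      under some \<open>a\<close> in \<open>A l\<close>. Then \<open>- a + g\<close> moves
      \<open>Q\<close> along a line through \<open>Q\<close>, which puts it into some
      \<open>A j\<close>.\<close>
    obtain x where x: "I x (transv l)" "collinear I (pmap g Q) x" using proj_exists[OF nO] by blast
    have "x \<noteq> foot l" using nc x(2) by (auto simp: collinear_commute)
    then have "\<not> collinear I P x" using on_transv[OF l x(1)] by simp
    then obtain a where a: "a \<in> G" "pmap a Q = x" by (elim pmap_Q_surj)
    have aA: "a \<in> A l" using a x by (simp add: A_def)
    let ?b = "- a + g"
    have bG: "?b \<in> G" using a g by (auto intro: G_closed)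
    have "collinear I Q (pmap ?b Q)"
      using collinear_pmap[OF G_closed(2)[OF a(1)], of "pmap a Q" "pmap g Q"] x(2) a(2)
        collinear_commute[of I x] pmap_simps(3)[of a Q] by (simp add: pmap_simps(2))
    then obtain n where n: "I Q n" "I (pmap ?b Q) n" by (elim collinearE)
    obtain j where j: "j \<in> J" "n = transv j" using line_through_Q[OF n(1)] .
    have "?b \<in> A j" using bG n j by (simp add: A_def)
    then show ?thesis using aA j(1) by (intro bexI[of _ a] bexI[of _ ?b]) auto
  qed
  fix a a' b b' assume ab: "a \<in> A l" "a' \<in> A l" "b \<in> (\<Union>j\<in>J. A j)" "b' \<in> (\<Union>j\<in>J. A j)" "g = a + b" "g = a' + b'"
  \<comment> \<open>Conversely, for any factorization \<open>g = c + d\<close> the image of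
    \<open>Q\<close> under \<open>c\<close> is that projection, so \<open>c\<close> is
    determined.\<close>
  have col: "collinear I (pmap g Q) (pmap c Q)" if c: "c \<in> A l" "d \<in> (\<Union>j\<in>J. A j)" "g = c + d" for c d
  proof -
    obtain j where j: "j \<in> J" "d \<in> A j" using c(2) by blast
    then have "collinear I (pmap d Q) Q" using transv(1)[OF j(1)] by (auto simp: A_def intro: collinearI)
    then show ?thesis using collinear_pmap[of c "pmap d Q" Q] c by (simp add: A_def pmap_simps)
  qed
  have on: "I (pmap a Q) (transv l)" "I (pmap a' Q) (transv l)" "a \<in> G" "a' \<in> G" using ab by (auto simp: A_def)
  have "pmap a Q = pmap a' Q"
    by (rule proj_unique[OF nO on(1) col[OF ab(1,3,5)] on(2) col[OF ab(2,4,6)]])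
  then show "a = a'" using pmap_Q_inj on by blast
qed (use fin_G G U A card_G card_U card_A A_U assms in \<open>auto simp: A_def J_def card_pencil\<close>)

end

text \<open>On a line \<open>m\<close> through a neighbour \<open>y\<close> of \<open>P\<close> that
  misses \<open>P\<close>, the projection of \<open>P\<close> is \<open>y\<close>, so any other
  point of \<open>m\<close> is opposite \<open>P\<close>.\<close>

lemma exists_opposite:
  fixes I :: "'p::finite \<Rightarrow> 'l::finite \<Rightarrow> bool"
  assumes gq: "gq_order I s s" and s: "s > 0"
  shows "\<exists>x. \<not> collinear I P x"
proof -
  have cl: "card {x. I x l} = s + 1" and cp: "card {l. I x l} = s + 1" for x l
    using gq by (auto simp: gq_order_def)
  have "{l. I P l} \<noteq> {}" using cp[of P] by (metis card.empty add_is_0 one_neq_zero)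
  then obtain l where l: "I P l" by blast
  have "\<not> {x. I x l} \<subseteq> {P}"
    using card_mono[of "{P}" "{x. I x l}"] cl[of l] s by auto
  then obtain y where y: "I y l" "y \<noteq> P" by blast
  have "\<not> {m. I y m} \<subseteq> {l}"
    using card_mono[of "{l}" "{m. I y m}"] cp[of y] s by auto
  then obtain m where m: "I y m" "m \<noteq> l" by blast
  have "\<not> {x. I x m} \<subseteq> {y}"
    using card_mono[of "{y}" "{x. I x m}"] cl[of m] s by auto
  then obtain z where z: "I z m" "z \<noteq> y" by blast
  have Pm: "\<not> I P m"
    using gq l y m unfolding gq_order_def by metis
  then have "\<exists>!w. I w m \<and> collinear I P w" using gq by (auto simp: gq_order_def)
  moreover have "collinear I P y" using l y by (auto simp: collinear_def)
  ultimately have "\<not> collinear I P z" using m(1) z by blast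
  then show ?thesis by blast
qed

theorem theorem1p1:
  fixes I :: "'p::finite \<Rightarrow> 'l::finite \<Rightarrow> bool" and s :: nat
  assumes "skew_translation_gq I s s"
    and "even s"
  shows "translation_gq I s s"
proof -
  obtain P E where st: "is_stgq I s s P E" using assms(1) by (auto simp: skew_translation_gq_def)
  then have egq: "is_egq I s s P E" by (simp add: is_stgq_def)
  obtain Q where "\<not> collinear I P Q"
    using exists_opposite[OF _ is_stgq_pos[OF st]] egq by (metis is_egq_def)
  then interpret skew_translation I s P E Q using st by unfold_locales
  have "aut_comp a b = aut_comp b a" if ab: "a \<in> E" "b \<in> E" for a b
  proof -
    obtain g h where gh: "g \<in> G" "the_pair g = a" "h \<in> G" "the_pair h = b" using E_G ab by metis
    have "g + h = h + g" by (rule as_configuration.G_abelian[OF configuration[OF assms(2)] gh(1,3)])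
    then show ?thesis using the_pair_plus[of g h] the_pair_plus[of h g] gh(2,4) by simp
  qed
  \<comment> \<open>\<open>P\<close> and \<open>E\<close> themselves witness the conclusion.\<close>
  then show ?thesis using egq unfolding translation_gq_def by blast
qed

end
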